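(* Let $\Omega\subset\mathbb{R}^n$ be open and let $\varphi\in\Phi_w(\Omega)$ be such that there exists $\beta>0$ with $\varphi(x,\beta)\geq 1$ for almost every $x\in\Omega$. Suppose that $C^1(\Omega)$-functions are dense in $W^{1,\varphi}(\Omega)$. Then $u\in W^{1,\varphi}(\Omega)$ if and only if $u\in L^\varphi(\Omega)$ and $u$ has a representative (a function equal to $u$ almost everywhere) that belongs to $ACC^\varphi(\Omega)$. In short, $ACC^\varphi(\Omega)\cap L^\varphi(\Omega)=W^{1,\varphi}(\Omega)$.
   Context: **Weak $\Phi$-functions.** $\Omega\subset\mathbb{R}^n$ is an open set. A function $\varphi:\Omega\times[0,\infty)\to[0,\infty]$ is a weak $\Phi$-function, $\varphi\in\Phi_w(\Omega)$, if: (i) for every measurable $f:\Omega\to[-\infty,\infty]$ the function $x\mapsto\varphi(x,|f(x)|)$ is measurable, and for every $x\in\Omega$ the function $t\mapsto\varphi(x,t)$ is non-decreasing; (ii) $\varphi(x,0)=\lim_{t\to0^+}\varphi(x,t)=0$ and $\lim_{t\to\infty}\varphi(x,t)=\infty$ for every $x\in\Omega$; (iii) there is $L\ge1$ independent of $x$ such that $\frac{\varphi(x,s)}{s}\le L\frac{\varphi(x,t)}{t}$ for all $x\in\Omega$ and $0<s<t$. Convention: $\varphi(x,\infty)=\infty$. **Spaces.** For measurable $f$ on $\Omega$, $\varrho_\varphi(f)=\int_\Omega\varphi(x,|f(x)|)\,dx$. $L^\varphi(\Omega)$ is the set of measurable $f$ with $\lim_{\lambda\to0^+}\varrho_\varphi(\lambda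 f)=0$, equipped with $\|f\|_\varphi=\inf\{\lambda>0:\varrho_\varphi(f/\lambda)\le1\}$; functions equal a.e. are identified. $W^{1,\varphi}(\Omega)$ is the set of $u\in L^\varphi(\Omega)$ whose weak partial derivatives $\partial_1u,\dots,\partial_nu$ exist and belong to $L^\varphi(\Omega)$, with $\|u\|_{1,\varphi}=\|u\|_\varphi+\||\nabla u|\|_\varphi$. "$C^1(\Omega)$-functions are dense in $W^{1,\varphi}(\Omega)$" means that every $u\in W^{1,\varphi}(\Omega)$ is the limit, with respect to $\|\cdot\|_{1,\varphi}$, of a sequence in $C^1(\Omega)\cap W^{1,\varphi}(\Omega)$. **Curves and modulus.** A curve is a continuous map $\gamma:I\to\mathbb{R}^n$ on a nondegenerate closed interval $I=[a,b]$; rectifiable curves have finite length $\ell(\gamma)>0$ and are parametrized by arc length, $I=[0,\ell(\gamma)]$. $\Gamma_{rect}(\Omega)$ is the family of all rectifiable curves with image contained in $\Omega$. For Borel $v:\Omega\to[0,\infty]$, $\int_\gamma v\,ds=\int_0^{\ell(\gamma)}v(\gamma(t))\,dt$. For $\Gamma\subset\Gamma_{rect}(\Omega)$, $F_{adm}(\Gamma)$ is the set of Borel functions $v:\Omega\to[0,\infty]$ with $\int_\gamma v\,ds\ge1$ for all $\gamma\in\Gamma$, and the $\varphi$-modulus is $M_\varphi(\Gamma)=\inf_{v\in F_{adm}(\Gamma)}\|v\|_\varphi$ (with $M_\varphi(\Gamma)=\infty$ if $F_{adm}(\Gamma)=\emptyset$). **ACC.** For $u:\Omega\to\mathbb{R}$,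 let $\Gamma_{NAC}(u)\subset\Gamma_{rect}(\Omega)$ be the family of curves $\gamma:[0,\ell(\gamma)]\to\Omega$ such that $u\circ\gamma$ is not absolutely continuous on $[0,\ell(\gamma)]$. Then $u\in ACC(\Omega)$ (absolutely continuous on curves) if $M_\varphi(\Gamma_{NAC}(u))=0$. Under the stated condition on $\varphi$, the classical partial derivatives of every $u\in ACC(\Omega)$ exist almost everywhere in $\Omega$; $u\in ACC^\varphi(\Omega)$ means $u\in ACC(\Omega)$ and $|\nabla u|\in L^\varphi(\Omega)$, where $\nabla u$ is the classical gradient. *)

theory Defs
  imports "HOL-Analysis.Analysis"
begin

text \<open>
  Functions on \<open>\<Omega>\<close> are represented by total functions on \<open>real ^ 'n\<close>; no notion below depends
  on their values outside the open set \<open>\<Omega>\<close>. ``Measurable'' means Lebesgue measurable, that is,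
  measurable with respect to \<open>lebesgue_on \<Omega>\<close>.
\<close>

text \<open>
  A function \<open>\<phi> :: \<Omega> \<times> [0,\<infinity>) \<rightarrow> [0,\<infinity>]\<close> is given on all of \<open>real\<close> in its second argument, but only
  its values at nonnegative reals are used. \<open>phi_abs \<phi> x r\<close> is \<open>\<phi>(x, \<bar>r\<bar>)\<close>, including the
  convention \<open>\<phi>(x, \<infinity>) = \<infinity>\<close>.
\<close>

definition phi_abs :: "(real ^ 'n \<Rightarrow> real \<Rightarrow> ennreal) \<Rightarrow> real ^ 'n \<Rightarrow> ereal \<Rightarrow> ennreal" where
  "phi_abs \<phi> x r = (if \<bar>r\<bar> = \<infinity> then \<infinity> else \<phi> x \<bar>real_of_ereal r\<bar>)"

definition weak_Phi :: "(real ^ 'n) set \<Rightarrow> (real ^ 'n \<Rightarrow> real \<Rightarrow> ennreal) \<Rightarrow> bool" where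
  "weak_Phi \<Omega> \<phi> \<longleftrightarrow>
    (\<forall>f :: real ^ 'n \<Rightarrow> ereal. f \<in> borel_measurable (lebesgue_on \<Omega>) \<longrightarrow>
        (\<lambda>x. phi_abs \<phi> x (f x)) \<in> borel_measurable (lebesgue_on \<Omega>)) \<and>
    (\<forall>x\<in>\<Omega>. mono_on {0..} (\<phi> x)) \<and>
    (\<forall>x\<in>\<Omega>. \<phi> x 0 = 0 \<and> (\<phi> x \<longlongrightarrow> 0) (at_right 0) \<and> (\<phi> x \<longlongrightarrow> \<infinity>) at_top) \<and>
    (\<exists>L::real. L \<ge> 1 \<and>
        (\<forall>x\<in>\<Omega>. \<forall>s t. 0 < s \<and> s < t \<longrightarrow>
            \<phi> x s / ennreal s \<le> ennreal L * (\<phi> x t / ennreal t)))"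

definition modular ::
  "(real ^ 'n \<Rightarrow> real \<Rightarrow> ennreal) \<Rightarrow> (real ^ 'n) set \<Rightarrow> (real ^ 'n \<Rightarrow> ereal) \<Rightarrow> ennreal" where
  "modular \<phi> \<Omega> f = (\<integral>\<^sup>+ x. phi_abs \<phi> x (f x) \<partial>lebesgue_on \<Omega>)"

definition Lphi ::
  "(real ^ 'n \<Rightarrow> real \<Rightarrow> ennreal) \<Rightarrow> (real ^ 'n) set \<Rightarrow> (real ^ 'n \<Rightarrow> ereal) set" where
  "Lphi \<phi> \<Omega> = {f \<in> borel_measurable (lebesgue_on \<Omega>).
     ((\<lambda>l::real. modular \<phi> \<Omega> (\<lambda>x. ereal l * f x)) \<longlongrightarrow> 0) (at_right 0)}"

definition phi_norm ::
  "(real ^ 'n \<Rightarrow> real \<Rightarrow> ennreal) \<Rightarrow> (real ^ 'n) set \<Rightarrow> (real ^ 'n \<Rightarrow> ereal) \<Rightarrow> ennreal" where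
  "phi_norm \<phi> \<Omega> f = Inf {ennreal l | l::real. l > 0 \<and> modular \<phi> \<Omega> (\<lambda>x. f x / ereal l) \<le> 1}"

definition partial :: "'n \<Rightarrow> (real ^ 'n \<Rightarrow> real) \<Rightarrow> real ^ 'n \<Rightarrow> real" where
  "partial i f x = deriv (\<lambda>t. f (x + t *\<^sub>R axis i 1)) 0"

definition classical_grad :: "(real ^ 'n \<Rightarrow> real) \<Rightarrow> real ^ 'n \<Rightarrow> real ^ 'n" where
  "classical_grad f x = (\<chi> i. partial i f x)"

primrec Ck_on :: "nat \<Rightarrow> (real ^ 'n) set \<Rightarrow> (real ^ 'n \<Rightarrow> real) \<Rightarrow> bool" where
  "Ck_on 0 \<Omega> f \<longleftrightarrow> continuous_on \<Omega> f"
| "Ck_on (Suc k) \<Omega> f \<longleftrightarrow> (\<forall>x\<in>\<Omega>. f differentiable (at x)) \<and> (\<forall>i. Ck_on k \<Omega> (partial i f))"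

text \<open>The elements of \<open>C\<^sub>c\<^sup>\<infinity>(\<Omega>)\<close>, extended by zero to the whole space.\<close>

definition test_function :: "(real ^ 'n) set \<Rightarrow> (real ^ 'n \<Rightarrow> real) \<Rightarrow> bool" where
  "test_function \<Omega> \<psi> \<longleftrightarrow> (\<forall>k. Ck_on k UNIV \<psi>) \<and>
     compact (closure {x. \<psi> x \<noteq> 0}) \<and> closure {x. \<psi> x \<noteq> 0} \<subseteq> \<Omega>"

definition locally_integrable :: "(real ^ 'n) set \<Rightarrow> (real ^ 'n \<Rightarrow> real) \<Rightarrow> bool" where
  "locally_integrable \<Omega> f \<longleftrightarrow> (\<forall>K. compact K \<and> K \<subseteq> \<Omega> \<longrightarrow> set_integrable lebesgue K f)"

definition has_weak_partial ::
  "(real ^ 'n) set \<Rightarrow> (real ^ 'n \<Rightarrow> real) \<Rightarrow> 'n \<Rightarrow> (real ^ 'n \<Rightarrow> real) \<Rightarrow> bool" where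
  "has_weak_partial \<Omega> u i g \<longleftrightarrow> locally_integrable \<Omega> u \<and> locally_integrable \<Omega> g \<and>
     (\<forall>\<psi>. test_function \<Omega> \<psi> \<longrightarrow>
        (\<integral>x\<in>\<Omega>. u x * partial i \<psi> x \<partial>lebesgue) = - (\<integral>x\<in>\<Omega>. g x * \<psi> x \<partial>lebesgue))"

text \<open>Weak partial derivatives are unique up to null sets; any of them may be chosen.\<close>

definition weak_grad :: "(real ^ 'n) set \<Rightarrow> (real ^ 'n \<Rightarrow> real) \<Rightarrow> real ^ 'n \<Rightarrow> real ^ 'n" where
  "weak_grad \<Omega> u x = (\<chi> i. (SOME g. has_weak_partial \<Omega> u i g) x)"

text \<open>
  A function in \<open>L\<^sup>\<phi>(\<Omega>)\<close> may take infinite values, but is finite almost everywhere (since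
  \<open>\<phi>(x, \<infinity>) = \<infinity>\<close>), so \<open>\<lambda>x. real_of_ereal (u x)\<close> is a real-valued representative of it.
\<close>

definition W1phi ::
  "(real ^ 'n \<Rightarrow> real \<Rightarrow> ennreal) \<Rightarrow> (real ^ 'n) set \<Rightarrow> (real ^ 'n \<Rightarrow> ereal) set" where
  "W1phi \<phi> \<Omega> = {u \<in> Lphi \<phi> \<Omega>. \<forall>i. \<exists>g.
     has_weak_partial \<Omega> (\<lambda>x. real_of_ereal (u x)) i g \<and> (\<lambda>x. ereal (g x)) \<in> Lphi \<phi> \<Omega>}"

definition W1phi_norm ::
  "(real ^ 'n \<Rightarrow> real \<Rightarrow> ennreal) \<Rightarrow> (real ^ 'n) set \<Rightarrow> (real ^ 'n \<Rightarrow> ereal) \<Rightarrow> ennreal" where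
  "W1phi_norm \<phi> \<Omega> u = phi_norm \<phi> \<Omega> u +
     phi_norm \<phi> \<Omega> (\<lambda>x. ereal (norm (weak_grad \<Omega> (\<lambda>y. real_of_ereal (u y)) x)))"

definition C1_dense_in_W1phi ::
  "(real ^ 'n \<Rightarrow> real \<Rightarrow> ennreal) \<Rightarrow> (real ^ 'n) set \<Rightarrow> bool" where
  "C1_dense_in_W1phi \<phi> \<Omega> \<longleftrightarrow> (\<forall>u\<in>W1phi \<phi> \<Omega>. \<exists>c :: nat \<Rightarrow> real ^ 'n \<Rightarrow> real.
     (\<forall>k. Ck_on 1 \<Omega> (c k) \<and> (\<lambda>x. ereal (c k x)) \<in> W1phi \<phi> \<Omega>) \<and>
     (\<lambda>k. W1phi_norm \<phi> \<Omega> (\<lambda>x. u x - ereal (c k x))) \<longlonglongrightarrow> 0)"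

text \<open>
  Lengths and absolute continuity are expressed through finite families \<open>D\<close> of non-overlapping
  compact intervals \<open>k = {Inf k..Sup k}\<close>; the members of a \<open>D\<close> with \<open>D division_of {a..b}\<close> are
  the intervals of a partition of \<open>{a..b}\<close> (possibly with some one-point intervals).
\<close>

definition curve_length :: "(real \<Rightarrow> real ^ 'n) \<Rightarrow> real \<Rightarrow> real \<Rightarrow> ennreal" where
  "curve_length \<gamma> a b =
     (SUP D \<in> {D. D division_of {a..b}}. ennreal (\<Sum>k\<in>D. dist (\<gamma> (Inf k)) (\<gamma> (Sup k))))"

text \<open>
  A rectifiable curve parametrized by arc length is a pair \<open>(l, \<gamma>)\<close> consisting of its length \<open>l\<close>
  and a map \<open>\<gamma>\<close>, of which only the restriction to \<open>{0..l}\<close> matters.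
\<close>

definition rect_curves :: "(real ^ 'n) set \<Rightarrow> (real \<times> (real \<Rightarrow> real ^ 'n)) set" where
  "rect_curves \<Omega> = {(l, \<gamma>). l > 0 \<and> continuous_on {0..l} \<gamma> \<and>
     (\<forall>t\<in>{0..l}. curve_length \<gamma> 0 t = ennreal t) \<and> \<gamma> ` {0..l} \<subseteq> \<Omega>}"

definition curve_integral :: "real \<times> (real \<Rightarrow> real ^ 'n) \<Rightarrow> (real ^ 'n \<Rightarrow> ennreal) \<Rightarrow> ennreal" where
  "curve_integral = (\<lambda>(l, \<gamma>) v. \<integral>\<^sup>+t\<in>{0..l}. v (\<gamma> t) \<partial>lborel)"

definition F_adm ::
  "(real ^ 'n) set \<Rightarrow> (real \<times> (real \<Rightarrow> real ^ 'n)) set \<Rightarrow> (real ^ 'n \<Rightarrow> ennreal) set" where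
  "F_adm \<Omega> \<Gamma> = {v \<in> borel_measurable (restrict_space borel \<Omega>).
     \<forall>c\<in>\<Gamma>. curve_integral c v \<ge> 1}"

definition phi_modulus ::
  "(real ^ 'n \<Rightarrow> real \<Rightarrow> ennreal) \<Rightarrow> (real ^ 'n) set \<Rightarrow>
     (real \<times> (real \<Rightarrow> real ^ 'n)) set \<Rightarrow> ennreal" where
  "phi_modulus \<phi> \<Omega> \<Gamma> = (INF v \<in> F_adm \<Omega> \<Gamma>. phi_norm \<phi> \<Omega> (\<lambda>x. enn2ereal (v x)))"

definition abs_continuous_on_interval :: "real \<Rightarrow> real \<Rightarrow> (real \<Rightarrow> real) \<Rightarrow> bool" where
  "abs_continuous_on_interval a b f \<longleftrightarrow> (\<forall>\<epsilon>>0. \<exists>\<delta>>0. \<forall>D S. D division_of S \<and> S \<subseteq> {a..b} \<and>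
     (\<Sum>k\<in>D. Sup k - Inf k) < \<delta> \<longrightarrow> (\<Sum>k\<in>D. \<bar>f (Sup k) - f (Inf k)\<bar>) < \<epsilon>)"

definition Gamma_NAC ::
  "(real ^ 'n) set \<Rightarrow> (real ^ 'n \<Rightarrow> real) \<Rightarrow> (real \<times> (real \<Rightarrow> real ^ 'n)) set" where
  "Gamma_NAC \<Omega> u =
     {(l, \<gamma>) \<in> rect_curves \<Omega>. \<not> abs_continuous_on_interval 0 l (u \<circ> \<gamma>)}"

definition ACC ::
  "(real ^ 'n \<Rightarrow> real \<Rightarrow> ennreal) \<Rightarrow> (real ^ 'n) set \<Rightarrow> (real ^ 'n \<Rightarrow> real) set" where
  "ACC \<phi> \<Omega> = {u. phi_modulus \<phi> \<Omega> (Gamma_NAC \<Omega> u) = 0}"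

text \<open>
  If \<open>\<phi>(x, \<beta>) \<ge> 1\<close> for some \<open>\<beta> > 0\<close> and almost every \<open>x \<in> \<Omega>\<close>, then the partial derivatives of an
  element of \<open>ACC \<phi> \<Omega>\<close> exist almost everywhere in \<open>\<Omega>\<close>, and the unspecified values of \<open>deriv\<close> at
  the remaining points are irrelevant.
\<close>

definition ACCphi ::
  "(real ^ 'n \<Rightarrow> real \<Rightarrow> ennreal) \<Rightarrow> (real ^ 'n) set \<Rightarrow> (real ^ 'n \<Rightarrow> real) set" where
  "ACCphi \<phi> \<Omega> = {u \<in> ACC \<phi> \<Omega>. (\<lambda>x. ereal (norm (classical_grad u x))) \<in> Lphi \<phi> \<Omega>}"

end

theory Submission
  imports Defs
begin

text \<open>
  Both inclusions rest on one description of small families of curves: a family \<open>\<Gamma>\<close> has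
  \<open>\<phi>\<close>-modulus zero iff there is a Borel function \<open>h \<in> L\<^sup>\<phi>(\<Omega>)\<close> whose integral over every curve
  in \<open>\<Gamma>\<close> is infinite (\<open>phi_modulus_zeroI\<close>, \<open>phi_modulus_zeroD\<close>). If \<open>h\<close> is given, its small
  multiples are admissible; conversely, \<open>h\<close> is a sum of admissible functions with norms
  below \<open>4\<^sup>-\<^sup>k\<^sup>-\<^sup>1\<close>. That such sums stay in \<open>L\<^sup>\<phi>(\<Omega>)\<close> does not follow from a triangle inequality,
  as \<open>\<phi>\<close> need not be convex; the substitute is \<open>\<phi>(x, \<Sum>t\<^sub>k) \<le> \<Sum>\<phi>(x, 2\<^sup>k\<^sup>+\<^sup>2 t\<^sub>k)\<close>
  (\<open>phi_abs_suminf\<close>).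

  Since \<open>\<phi>(x, \<beta>) \<ge> 1\<close>, functions in \<open>L\<^sup>\<phi>(\<Omega>)\<close> are integrable over sets of finite measure
  (\<open>Lphi_integral_finite\<close>). Hence \<open>h\<close> has finite integrals over the compact segments of
  almost every line, and a function in \<open>ACC\<close> is absolutely continuous on the segments in \<open>\<Omega>\<close>
  of almost every line parallel to an axis (\<open>ACC_imp_AC_on_lines\<close>). ``Almost every line in
  direction \<open>e\<close>'' means here that \<open>t \<mapsto> x + t e\<close> has the property in question for almost
  every starting point \<open>x\<close>. Fubini's theorem in the variables \<open>x\<close> and \<open>t\<close>, combined with
  translation invariance in \<open>x\<close>, then does what is usually done by splitting the space into
  a hyperplane and a line (\<open>nn_integral_lines\<close>).

  Let \<open>v \<in> ACC\<^sup>\<phi>(\<Omega>) \<inter> L\<^sup>\<phi>(\<Omega>)\<close>. On almost every line parallel to the \<open>i\<close>-th axis, \<open>v\<close> is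
  differentiable almost everywhere (\<open>AC_differentiable_AE\<close>, by Vitali coverings), and for a
  test function \<open>\<psi>\<close> the product \<open>v \<psi>\<close> is the integral of its derivative (\<open>AC_has_integral\<close>).
  Integrating \<open>\<integral>\<^sub>0\<^sup>1 \<partial>\<^sub>i(v \<psi>)(x + t e\<^sub>i) dt = (v \<psi>)(x + e\<^sub>i) - (v \<psi>)(x)\<close> over all \<open>x\<close> gives zero
  on the right-hand side, so that \<open>\<integral> \<partial>\<^sub>i(v \<psi>) = 0\<close>, which is the integration by parts formula
  (\<open>integral_zero_if_lines_FTC\<close>, \<open>weak_partial_if_AC_on_lines\<close>). The classical partial
  derivative is thus a weak one, and it belongs to \<open>L\<^sup>\<phi>(\<Omega>)\<close> because it is dominated by
  \<open>\<bar>\<nabla>v\<bar>\<close>.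

  Let \<open>u \<in> W\<^sup>1\<^sup>,\<^sup>\<phi>(\<Omega>)\<close> have the weak gradient \<open>G\<close>, which is unique (\<open>weak_partial_unique\<close>), and
  choose \<open>C\<^sup>1\<close>-functions \<open>d\<^sub>k\<close> that converge so fast to \<open>u\<close> that
  \<open>h = \<Sum>\<bar>d\<^sub>k\<^sub>+\<^sub>1 - d\<^sub>k\<bar> + \<Sum>\<bar>\<nabla>d\<^sub>k\<^sub>+\<^sub>1 - \<nabla>d\<^sub>k\<bar>\<close> is in \<open>L\<^sup>\<phi>(\<Omega>)\<close>. If \<open>h\<close> has a finite integral over a
  curve, the first sum is finite at some point of the curve; the second sum controls the
  increments of \<open>d\<^sub>k\<^sub>+\<^sub>1 - d\<^sub>k\<close> along the curve and so carries the convergence of \<open>d\<^sub>k\<close> to all of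
  its points. It also shows that \<open>v = lim d\<^sub>k\<close> is absolutely continuous along the curve
  (\<open>limit_AC_on_curve\<close>). Hence \<open>v\<close> is in \<open>ACC\<close>, and it agrees with \<open>u\<close> almost everywhere. On
  almost every line one may pass to the limit in the integrals of \<open>\<partial>\<^sub>id\<^sub>k\<close>, so that the
  classical gradient of \<open>v\<close> is \<open>G\<close> almost everywhere (\<open>limit_classical_grad\<close>).
\<close>

section \<open>Weak \<open>\<Phi>\<close>-functions and the spaces \<open>L\<^sup>\<phi>\<close>\<close>

lemma ennreal_mult_divide_cancel:
  assumes "0 < c"
  shows "ennreal c * (y / ennreal c) = y"
proof -
  have "ennreal c * (y / ennreal c) = y * ennreal c / ennreal c"
    by (simp add: ennreal_times_divide mult.commute)
  also have "\<dots> = y" using assms by (intro ennreal_mult_divide_eq) auto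
  finally show ?thesis .
qed

lemma weak_PhiD:
  assumes "weak_Phi \<Omega> \<phi>"
  shows "f \<in> borel_measurable (lebesgue_on \<Omega>) \<Longrightarrow> (\<lambda>x. phi_abs \<phi> x (f x)) \<in> borel_measurable (lebesgue_on \<Omega>)"
    and "x \<in> \<Omega> \<Longrightarrow> mono_on {0..} (\<phi> x)"
    and "x \<in> \<Omega> \<Longrightarrow> \<phi> x 0 = 0"
    and "x \<in> \<Omega> \<Longrightarrow> (\<phi> x \<longlongrightarrow> \<infinity>) at_top"
    and "\<exists>L::real. L \<ge> 1 \<and> (\<forall>x\<in>\<Omega>. \<forall>s t. 0 < s \<and> s < t \<longrightarrow>
            \<phi> x s / ennreal s \<le> ennreal L * (\<phi> x t / ennreal t))"
proof -
  note w = assms[unfolded weak_Phi_def]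
  show "f \<in> borel_measurable (lebesgue_on \<Omega>) \<Longrightarrow> (\<lambda>x. phi_abs \<phi> x (f x)) \<in> borel_measurable (lebesgue_on \<Omega>)"
    using w[THEN conjunct1] by simp
  show "x \<in> \<Omega> \<Longrightarrow> mono_on {0..} (\<phi> x)" using w[THEN conjunct2, THEN conjunct1] by simp
  note w3 = w[THEN conjunct2, THEN conjunct2, THEN conjunct1]
  show "x \<in> \<Omega> \<Longrightarrow> \<phi> x 0 = 0" using w3 by simp
  show "x \<in> \<Omega> \<Longrightarrow> (\<phi> x \<longlongrightarrow> \<infinity>) at_top" using w3 by simp
  show "\<exists>L::real. L \<ge> 1 \<and> (\<forall>x\<in>\<Omega>. \<forall>s t. 0 < s \<and> s < t \<longrightarrow>
            \<phi> x s / ennreal s \<le> ennreal L * (\<phi> x t / ennreal t))"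
    by (rule w[THEN conjunct2, THEN conjunct2, THEN conjunct2])
qed

lemma phi_abs_mono:
  assumes "weak_Phi \<Omega> \<phi>" "x \<in> \<Omega>" "\<bar>r\<bar> \<le> \<bar>s\<bar>"
  shows "phi_abs \<phi> x r \<le> phi_abs \<phi> x s"
proof (cases "\<bar>s\<bar> = \<infinity>")
  case False
  have "\<bar>r\<bar> \<noteq> \<infinity>" using False assms(3) by auto
  then obtain a where a: "r = ereal a" by auto
  obtain b where b: "s = ereal b" using False by auto
  note ab = a b
  have "mono_on {0..} (\<phi> x)" by (rule weak_PhiD(2)[OF assms(1,2)])
  then show ?thesis using assms(3) unfolding ab phi_abs_def
    by (auto elim: mono_onD)
qed (simp add: phi_abs_def)

lemma phi_abs_zero:
  assumes "weak_Phi \<Omega> \<phi>" "x \<in> \<Omega>"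
  shows "phi_abs \<phi> x 0 = 0"
  using weak_PhiD(3)[OF assms] by (simp add: phi_abs_def)

text \<open>
  The almost monotonicity of \<open>t \<mapsto> \<phi>(x, t) / t\<close>, read with \<open>s = \<theta> t\<close>. It is what remains of
  convexity and yields all estimates by multiples of the modular.
\<close>

lemma phi_abs_scale:
  assumes "weak_Phi \<Omega> \<phi>"
  obtains L :: real where "L \<ge> 1"
    "\<And>x (\<theta>::real) r. x \<in> \<Omega> \<Longrightarrow> 0 < \<theta> \<Longrightarrow> \<theta> \<le> 1 \<Longrightarrow> phi_abs \<phi> x (ereal \<theta> * r) \<le> ennreal (L * \<theta>) * phi_abs \<phi> x r"
proof -
  obtain L :: real where L: "L \<ge> 1"
    "\<And>x s t. x\<in>\<Omega> \<Longrightarrow> 0 < s \<Longrightarrow> s < t \<Longrightarrow> \<phi> x s / ennreal s \<le> ennreal L * (\<phi> x t / ennreal t)"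
    using weak_PhiD(5)[OF assms] by blast
  show thesis
  proof (rule that[OF L(1)])
    fix x and \<theta> :: real and r :: ereal assume x: "x \<in> \<Omega>" and th: "0 < \<theta>" "\<theta> \<le> 1"
    show "phi_abs \<phi> x (ereal \<theta> * r) \<le> ennreal (L * \<theta>) * phi_abs \<phi> x r"
    proof (cases r)
      case (real a)
      consider "a = 0" | "\<theta> = 1" | "a \<noteq> 0" "\<theta> < 1" using th by linarith
      then show ?thesis
      proof cases
        case 1
        then show ?thesis using real phi_abs_zero[OF assms x] by (simp add: zero_ereal_def)
      next
        case 2
        have "1 * phi_abs \<phi> x r \<le> ennreal L * phi_abs \<phi> x r"
          by (rule mult_right_mono) (use L in auto)
        then show ?thesis using 2 by (simp add: one_ereal_def[symmetric])
      next
        case 3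
        have p: "0 < \<theta> * \<bar>a\<bar>" "\<theta> * \<bar>a\<bar> < \<bar>a\<bar>" using 3 th by auto
        note L(2)[OF x p]
        then have "ennreal (\<theta> * \<bar>a\<bar>) * (\<phi> x (\<theta> * \<bar>a\<bar>) / ennreal (\<theta> * \<bar>a\<bar>)) \<le> ennreal (\<theta> * \<bar>a\<bar>) * (ennreal L * (\<phi> x \<bar>a\<bar> / ennreal \<bar>a\<bar>))"
          by (rule mult_left_mono) simp
        also have "ennreal (\<theta> * \<bar>a\<bar>) * (\<phi> x (\<theta> * \<bar>a\<bar>) / ennreal (\<theta> * \<bar>a\<bar>)) = \<phi> x (\<theta> * \<bar>a\<bar>)"
          using p(1) by (intro ennreal_mult_divide_cancel) auto
        also have "ennreal (\<theta> * \<bar>a\<bar>) * (ennreal L * (\<phi> x \<bar>a\<bar> / ennreal \<bar>a\<bar>)) =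
            ennreal (\<theta> * L) * (ennreal \<bar>a\<bar> * (\<phi> x \<bar>a\<bar> / ennreal \<bar>a\<bar>))"
          using L(1) th by (simp add: ennreal_mult' ac_simps)
        also have "ennreal \<bar>a\<bar> * (\<phi> x \<bar>a\<bar> / ennreal \<bar>a\<bar>) = \<phi> x \<bar>a\<bar>"
          using p(1) by (intro ennreal_mult_divide_cancel) auto
        finally show ?thesis using real th by (simp add: phi_abs_def abs_mult mult.commute)
      qed
    qed (use th L(1) in \<open>auto simp: phi_abs_def ennreal_mult_top\<close>)
  qed
qed

lemma modular_mono:
  assumes "weak_Phi \<Omega> \<phi>" "AE x in lebesgue_on \<Omega>. \<bar>f x\<bar> \<le> \<bar>g x\<bar>"
  shows "modular \<phi> \<Omega> f \<le> modular \<phi> \<Omega> g"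
  unfolding modular_def
proof (rule nn_integral_mono_AE)
  show "AE x in lebesgue_on \<Omega>. phi_abs \<phi> x (f x) \<le> phi_abs \<phi> x (g x)"
    using assms(2) AE_space by eventually_elim (auto intro: phi_abs_mono[OF assms(1)])
qed

lemma modular_scale:
  assumes "weak_Phi \<Omega> \<phi>"
  obtains L :: real where "L \<ge> 1"
    "\<And>(\<theta>::real) f. 0 < \<theta> \<Longrightarrow> \<theta> \<le> 1 \<Longrightarrow> f \<in> borel_measurable (lebesgue_on \<Omega>) \<Longrightarrow>
      modular \<phi> \<Omega> (\<lambda>x. ereal \<theta> * f x) \<le> ennreal (L * \<theta>) * modular \<phi> \<Omega> f"
proof -
  from phi_abs_scale[OF assms] obtain L where L: "L \<ge> 1"
     "\<And>x (\<theta>::real) r. x \<in> \<Omega> \<Longrightarrow> 0 < \<theta> \<Longrightarrow> \<theta> \<le> 1 \<Longrightarrow> phi_abs \<phi> x (ereal \<theta> * r) \<le> ennreal (L * \<theta>) * phi_abs \<phi> x r" by blast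
  show thesis
  proof (rule that[OF L(1)])
    fix \<theta> :: real and f :: "_ \<Rightarrow> ereal"
    assume *: "0 < \<theta>" "\<theta> \<le> 1" and f: "f \<in> borel_measurable (lebesgue_on \<Omega>)"
    have "modular \<phi> \<Omega> (\<lambda>x. ereal \<theta> * f x) \<le> (\<integral>\<^sup>+ x. ennreal (L * \<theta>) * phi_abs \<phi> x (f x) \<partial>lebesgue_on \<Omega>)"
      unfolding modular_def by (rule nn_integral_mono) (use L * in auto)
    also have "\<dots> = ennreal (L * \<theta>) * modular \<phi> \<Omega> f"
      unfolding modular_def by (rule nn_integral_cmult[OF weak_PhiD(1)[OF assms f]])
    finally show "modular \<phi> \<Omega> (\<lambda>x. ereal \<theta> * f x) \<le> ennreal (L * \<theta>) * modular \<phi> \<Omega> f" .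
  qed
qed

text \<open>
  By the scaling estimate, the modular of \<open>l f\<close> tends to zero at least linearly in \<open>l\<close> as
  soon as it is finite for a single \<open>l\<close>.
\<close>

lemma Lphi_iff:
  assumes "weak_Phi \<Omega> \<phi>"
  shows "f \<in> Lphi \<phi> \<Omega> \<longleftrightarrow> f \<in> borel_measurable (lebesgue_on \<Omega>) \<and>
    (\<exists>l>0. modular \<phi> \<Omega> (\<lambda>x. ereal l * f x) < \<infinity>)"
proof safe
  assume f: "f \<in> Lphi \<phi> \<Omega>"
  then show "f \<in> borel_measurable (lebesgue_on \<Omega>)" by (auto simp: Lphi_def)
  have "\<forall>\<^sub>F l in at_right 0. modular \<phi> \<Omega> (\<lambda>x. ereal l * f x) < 1"
    using f by (intro order_tendstoD) (auto simp: Lphi_def)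
  then have "\<forall>\<^sub>F l in at_right (0::real). 0 < l \<and> modular \<phi> \<Omega> (\<lambda>x. ereal l * f x) < \<infinity>"
    using eventually_at_right_less[of "0::real"]
    by eventually_elim (auto intro: order.strict_trans)
  then show "\<exists>l>0. modular \<phi> \<Omega> (\<lambda>x. ereal l * f x) < \<infinity>"
    using eventually_happens'[of "at_right (0::real)"] by (metis (mono_tags, lifting) trivial_limit_at_right_real)
next
  fix l :: real
  assume f: "f \<in> borel_measurable (lebesgue_on \<Omega>)" and l: "0 < l" and fin: "modular \<phi> \<Omega> (\<lambda>x. ereal l * f x) < \<infinity>"
  from modular_scale[OF assms] obtain L where L: "L \<ge> 1"
    "\<And>(\<theta>::real) f. 0 < \<theta> \<Longrightarrow> \<theta> \<le> 1 \<Longrightarrow> f \<in> borel_measurable (lebesgue_on \<Omega>) \<Longrightarrow>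
      modular \<phi> \<Omega> (\<lambda>x. ereal \<theta> * f x) \<le> ennreal (L * \<theta>) * modular \<phi> \<Omega> f" by blast
  obtain M where M: "modular \<phi> \<Omega> (\<lambda>x. ereal l * f x) = ennreal M" "M \<ge> 0"
    using fin by (metis ennreal_cases infinity_ennreal_def less_irrefl)
  have le: "modular \<phi> \<Omega> (\<lambda>x. ereal k * f x) \<le> ennreal (L * (k/l) * M)" if "0 < k" "k \<le> l" for k
  proof -
    have "(\<lambda>x. ereal k * f x) = (\<lambda>x. ereal (k/l) * (ereal l * f x))"
      using l by (auto simp: mult.assoc[symmetric])
    then have "modular \<phi> \<Omega> (\<lambda>x. ereal k * f x) \<le> ennreal (L * (k/l)) * ennreal M"
      using L(2)[of "k/l" "\<lambda>x. ereal l * f x"] that l f M(1) by simp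
    then show ?thesis using M(2) that l L(1) by (subst ennreal_mult) auto
  qed
  have "((\<lambda>k. ennreal (L * (k/l) * M)) \<longlongrightarrow> ennreal (L * (0/l) * M)) (at_right 0)"
    using l by (intro tendsto_intros) auto
  then have "((\<lambda>k. ennreal (L * (k/l) * M)) \<longlongrightarrow> 0) (at_right 0)" by simp
  then have "((\<lambda>l. modular \<phi> \<Omega> (\<lambda>x. ereal l * f x)) \<longlongrightarrow> 0) (at_right 0)"
  proof (rule tendsto_sandwich[rotated -1])
    show "\<forall>\<^sub>F k in at_right 0. modular \<phi> \<Omega> (\<lambda>x. ereal k * f x) \<le> ennreal (L * (k/l) * M)"
      unfolding eventually_at_right_field using le l by (metis less_imp_le)
  qed auto
  then show "f \<in> Lphi \<phi> \<Omega>" using f by (auto simp: Lphi_def)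
qed

lemma Lphi_dominated:
  assumes "weak_Phi \<Omega> \<phi>" "g \<in> Lphi \<phi> \<Omega>" "f \<in> borel_measurable (lebesgue_on \<Omega>)"
    "AE x in lebesgue_on \<Omega>. \<bar>f x\<bar> \<le> \<bar>g x\<bar>"
  shows "f \<in> Lphi \<phi> \<Omega>"
proof -
  obtain l where l: "l > 0" "modular \<phi> \<Omega> (\<lambda>x. ereal l * g x) < \<infinity>"
    using assms(1,2) by (auto simp: Lphi_iff)
  have "modular \<phi> \<Omega> (\<lambda>x. ereal l * f x) \<le> modular \<phi> \<Omega> (\<lambda>x. ereal l * g x)"
  proof (rule modular_mono[OF assms(1)])
    show "AE x in lebesgue_on \<Omega>. \<bar>ereal l * f x\<bar> \<le> \<bar>ereal l * g x\<bar>"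
      using assms(4) by eventually_elim (use l in \<open>simp add: ereal_abs_mult ereal_mult_left_mono\<close>)
  qed
  then show ?thesis using l assms(1,3) by (auto simp: Lphi_iff intro: le_less_trans)
qed

lemma Lphi_finite_AE:
  assumes "weak_Phi \<Omega> \<phi>" "f \<in> Lphi \<phi> \<Omega>"
  shows "AE x in lebesgue_on \<Omega>. \<bar>f x\<bar> \<noteq> \<infinity>"
proof -
  obtain l where l: "l > 0" "modular \<phi> \<Omega> (\<lambda>x. ereal l * f x) < \<infinity>" and f: "f \<in> borel_measurable (lebesgue_on \<Omega>)"
    using assms by (auto simp: Lphi_iff)
  have "AE x in lebesgue_on \<Omega>. phi_abs \<phi> x (ereal l * f x) \<noteq> \<infinity>"
    using l f unfolding modular_def
    by (intro nn_integral_noteq_infinite weak_PhiD(1)[OF assms(1)]) auto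
  then show ?thesis by eventually_elim (use l in \<open>auto simp: phi_abs_def\<close>)
qed

lemma phi_norm_less_imp_modular:
  assumes "weak_Phi \<Omega> \<phi>" "phi_norm \<phi> \<Omega> f < ennreal c"
  shows "modular \<phi> \<Omega> (\<lambda>x. ereal (1/c) * f x) \<le> 1"
proof -
  obtain l where l: "l > 0" "modular \<phi> \<Omega> (\<lambda>x. f x / ereal l) \<le> 1" "ennreal l < ennreal c"
    using assms(2) unfolding phi_norm_def Inf_less_iff by auto
  then have lc: "l < c" by (auto simp: ennreal_less_iff)
  have "\<bar>ereal (1/c) * r\<bar> \<le> \<bar>r / ereal l\<bar>" for r :: ereal
    using l lc by (cases r) (auto simp: divide_simps abs_mult intro: mult_left_mono)
  then have "modular \<phi> \<Omega> (\<lambda>x. ereal (1/c) * f x) \<le> modular \<phi> \<Omega> (\<lambda>x. f x / ereal l)"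
    by (intro modular_mono[OF assms(1)]) auto
  then show ?thesis using l by auto
qed

lemma phi_norm_cong_AE:
  assumes "weak_Phi \<Omega> \<phi>" "AE x in lebesgue_on \<Omega>. \<bar>f x\<bar> = \<bar>g x\<bar>"
  shows "phi_norm \<phi> \<Omega> f = phi_norm \<phi> \<Omega> g"
proof -
  have "modular \<phi> \<Omega> (\<lambda>x. f x / ereal l) = modular \<phi> \<Omega> (\<lambda>x. g x / ereal l)" if "l > 0" for l
  proof -
    have *: "AE x in lebesgue_on \<Omega>. \<bar>f x / ereal l\<bar> = \<bar>g x / ereal l\<bar>"
      using assms(2) by eventually_elim (simp only: divide_ereal_def ereal_abs_mult)
    show ?thesis
      by (intro antisym modular_mono[OF assms(1)]; use * in \<open>elim eventually_mono\<close>) auto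
  qed
  then show ?thesis unfolding phi_norm_def by (metis (no_types, lifting))
qed

lemma phi_norm_scale_small:
  assumes "weak_Phi \<Omega> \<phi>" "f \<in> Lphi \<phi> \<Omega>" "\<epsilon> > 0"
  shows "\<exists>l>0. phi_norm \<phi> \<Omega> (\<lambda>x. ereal l * f x) \<le> ennreal \<epsilon>"
proof -
  have "\<forall>\<^sub>F l in at_right 0. modular \<phi> \<Omega> (\<lambda>x. ereal l * f x) < 1"
    using assms by (intro order_tendstoD) (auto simp: Lphi_def)
  then have "\<forall>\<^sub>F l in at_right (0::real). 0 < l \<and> modular \<phi> \<Omega> (\<lambda>x. ereal l * f x) < 1"
    using eventually_at_right_less[of "0::real"] by eventually_elim auto
  then obtain l where l: "l > 0" "modular \<phi> \<Omega> (\<lambda>x. ereal l * f x) < 1"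
    using eventually_happens'[of "at_right (0::real)"] by (metis (mono_tags, lifting) trivial_limit_at_right_real)
  have "(\<lambda>x. ereal (l * \<epsilon>) * f x / ereal \<epsilon>) = (\<lambda>x. ereal l * f x)"
  proof
    fix x show "ereal (l * \<epsilon>) * f x / ereal \<epsilon> = ereal l * f x"
      using assms(3) l by (cases "f x") auto
  qed
  then have "phi_norm \<phi> \<Omega> (\<lambda>x. ereal (l * \<epsilon>) * f x) \<le> ennreal \<epsilon>"
    unfolding phi_norm_def using assms(3) l by (intro Inf_lower) auto
  then show ?thesis using l assms(3) by (metis mult_pos_pos)
qed

lemma phi_abs_unbounded:
  assumes "weak_Phi \<Omega> \<phi>" "x \<in> \<Omega>" "M < \<infinity>"
  shows "\<exists>R::real. \<forall>r. \<bar>r\<bar> \<ge> ereal R \<longrightarrow> phi_abs \<phi> x r > M"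
proof -
  have "(\<phi> x \<longlongrightarrow> \<infinity>) at_top" by (rule weak_PhiD(4)[OF assms(1,2)])
  then have "\<forall>\<^sub>F t in at_top. M < \<phi> x t" using assms(3) by (intro order_tendstoD) auto
  then obtain R where R: "\<And>t. t \<ge> R \<Longrightarrow> M < \<phi> x t" unfolding eventually_at_top_linorder by blast
  show ?thesis
  proof (intro exI[of _ R] allI impI)
    fix r :: ereal assume "\<bar>r\<bar> \<ge> ereal R"
    then show "phi_abs \<phi> x r > M" using R assms(3) by (cases r) (auto simp: phi_abs_def)
  qed
qed

lemma suminf_half_powers_ennreal: "(\<Sum>k. ennreal (a / 2 ^ k)) = ennreal (2 * a)" if "a \<ge> 0"
proof -
  have "(\<lambda>k. a * (1/2) ^ k) sums (a * (1 / (1 - 1/2)))"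
    by (intro sums_mult geometric_sums) auto
  then have "(\<lambda>k. a / 2 ^ k) sums (2 * a)" by (simp add: power_one_over field_simps)
  then show ?thesis using that by (intro suminf_ennreal_eq) auto
qed

text \<open>
  The weights \<open>2\<^sup>k\<^sup>+\<^sup>2\<close> make a single term dominate: if \<open>2\<^sup>k\<^sup>+\<^sup>2 t\<^sub>k \<le> T\<close> for all \<open>k\<close>, then
  \<open>\<Sum>t\<^sub>k \<le> T / 2\<close>, which is impossible for \<open>T = \<Sum>t\<^sub>k\<close> unless \<open>T = 0\<close>. So the left-hand side is
  bounded by one of the summands on the right, by monotonicity. If \<open>\<Sum>t\<^sub>k = \<infinity>\<close>, the numbers
  \<open>2\<^sup>k\<^sup>+\<^sup>2 t\<^sub>k\<close> are unbounded for the same reason, and \<open>\<phi>(x, t)\<close> tends to infinity with \<open>t\<close>.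
\<close>

lemma phi_abs_suminf:
  fixes t :: "nat \<Rightarrow> ennreal"
  assumes "weak_Phi \<Omega> \<phi>" "x \<in> \<Omega>"
  shows "phi_abs \<phi> x (enn2ereal (\<Sum>k. t k)) \<le> (\<Sum>k. phi_abs \<phi> x (ereal (2^(k+2)) * enn2ereal (t k)))"
    (is "_ \<le> suminf ?g")
proof -
  have g: "?g k \<le> suminf ?g" for k using sum_le_suminf[OF summableI, of "{k}" ?g] by auto
  have bdd: "(\<Sum>k. t k) \<le> ennreal (c/2)" if c: "c \<ge> 0" and *: "\<And>k. ereal (2^(k+2)) * enn2ereal (t k) \<le> ereal c" for c
  proof -
    have "t k \<le> ennreal ((c/4) / 2^k)" for k
    proof -
      have "ereal (2^(k+2)) * enn2ereal (t k) \<le> ereal c" by (rule *)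
      then have "enn2ereal (t k) \<le> ereal ((c/4) / 2^k)"
        using c by (cases "enn2ereal (t k)") (auto simp: field_simps)
      then show ?thesis using c by (simp add: less_eq_ennreal.rep_eq ennreal.rep_eq)
    qed
    then have "(\<Sum>k. t k) \<le> (\<Sum>k. ennreal ((c/4) / 2^k))" by (intro suminf_le) auto
    also have "\<dots> = ennreal (2 * (c/4))" by (rule suminf_half_powers_ennreal) (use c in simp)
    finally show ?thesis by simp
  qed
  show ?thesis
  proof (cases "(\<Sum>k. t k) = \<infinity>")
    case True
    have "M \<le> suminf ?g" if M: "M < \<infinity>" for M
    proof -
      obtain R0 where R0: "\<And>r. \<bar>r\<bar> \<ge> ereal R0 \<Longrightarrow> phi_abs \<phi> x r > M"
        using phi_abs_unbounded[OF assms M] by blast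
      define R where "R = max R0 0"
      have R: "phi_abs \<phi> x r > M" if "ereal R \<le> r" for r
        using that by (intro R0) (cases r; simp add: R_def)
      have "\<exists>k. ereal R < ereal (2^(k+2)) * enn2ereal (t k)"
      proof (rule ccontr)
        assume "\<not> ?thesis"
        then have "(\<Sum>k. t k) \<le> ennreal (R / 2)" by (intro bdd) (simp add: R_def, metis not_less)
        then show False using True by (simp add: top_unique)
      qed
      then obtain k where k: "ereal R < ereal (2^(k+2)) * enn2ereal (t k)" by blast
      then have "ereal R \<le> ereal (2^(k+2)) * enn2ereal (t k)" by (rule less_imp_le)
      then have "?g k > M" by (rule R)
      then show ?thesis using g[of k] by simp
    qed
    then have "\<infinity> \<le> suminf ?g" by (rule dense_le)
    then show ?thesis by (simp add: top_unique)
  next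
    case False
    then obtain T where T: "(\<Sum>k. t k) = ennreal T" "T \<ge> 0" by (metis ennreal_cases infinity_ennreal_def)
    show ?thesis
    proof (cases "T = 0")
      case True
      then show ?thesis using T phi_abs_zero[OF assms] by (simp add: zero_ennreal.rep_eq)
    next
      case T0: False
      have "\<exists>k. ereal (2^(k+2)) * enn2ereal (t k) > ereal T"
      proof (rule ccontr)
        assume "\<not> ?thesis"
        then have "(\<Sum>k. t k) \<le> ennreal (T/2)" by (intro bdd[OF T(2)]) (auto simp: not_less)
        then show False using T T0 by simp
      qed
      then obtain k where k: "ereal (2^(k+2)) * enn2ereal (t k) > ereal T" by blast
      have "phi_abs \<phi> x (enn2ereal (\<Sum>k. t k)) \<le> ?g k"
      proof (rule phi_abs_mono[OF assms])
        have 0: "0 \<le> ereal T" using T by simp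
        have "enn2ereal (\<Sum>k. t k) = ereal T" using T by (simp add: enn2ereal_ennreal)
        moreover have "ereal T \<le> \<bar>ereal (2^(k+2)) * enn2ereal (t k)\<bar>"
          by (subst abs_ereal_ge0, rule order_trans[OF 0 less_imp_le[OF k]], rule less_imp_le[OF k])
        ultimately show "\<bar>enn2ereal (\<Sum>k. t k)\<bar> \<le> \<bar>ereal (2^(k+2)) * enn2ereal (t k)\<bar>"
          using T(2) by simp
      qed
      then show ?thesis using g[of k] by (rule order_trans)
    qed
  qed
qed

text \<open>
  The factor \<open>4\<^sup>k\<^sup>+\<^sup>1 = 2\<^sup>k\<^sup>+\<^sup>2 2\<^sup>k\<close> gained from the norms is spent twice: \<open>2\<^sup>k\<^sup>+\<^sup>2\<close> is consumed by
  the pointwise estimate for series, and \<open>2\<^sup>k\<close> makes the modulars summable.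
\<close>

lemma Lphi_suminf:
  fixes f :: "nat \<Rightarrow> real ^ 'n \<Rightarrow> ennreal"
  assumes "weak_Phi \<Omega> \<phi>" and f: "\<And>k. f k \<in> borel_measurable (lebesgue_on \<Omega>)"
    and le: "\<And>k. phi_norm \<phi> \<Omega> (\<lambda>x. enn2ereal (f k x)) < ennreal (1 / 4^(k+1))"
  shows "(\<lambda>x. enn2ereal (\<Sum>k. f k x)) \<in> Lphi \<phi> \<Omega>"
proof -
  from modular_scale[OF assms(1)] obtain L where L: "L \<ge> 1"
    "\<And>(\<theta>::real) f. 0 < \<theta> \<Longrightarrow> \<theta> \<le> 1 \<Longrightarrow> f \<in> borel_measurable (lebesgue_on \<Omega>) \<Longrightarrow>
      modular \<phi> \<Omega> (\<lambda>x. ereal \<theta> * f x) \<le> ennreal (L * \<theta>) * modular \<phi> \<Omega> f" by blast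
  have m: "modular \<phi> \<Omega> (\<lambda>x. ereal (2^(k+2)) * enn2ereal (f k x)) \<le> ennreal (L / 2^k)" for k
  proof -
    have 1: "modular \<phi> \<Omega> (\<lambda>x. ereal (4^(k+1)) * enn2ereal (f k x)) \<le> 1"
      using phi_norm_less_imp_modular[OF assms(1) le[of k]] by simp
    have "(2::real)^k * 2^k = 4^k" by (metis mult_2 numeral_Bit0 power_mult_distrib)
    then have "(2::real)^(k+2) = 1/2^k * 4^(k+1)" by (simp add: field_simps)
    then have e: "ereal (2^(k+2)) * y = ereal (1/2^k) * (ereal (4^(k+1)) * y)" for y
      by (simp only: mult.assoc[symmetric] times_ereal.simps(1))
    have "modular \<phi> \<Omega> (\<lambda>x. ereal (2^(k+2)) * enn2ereal (f k x)) \<le> ennreal (L * (1/2^k)) * modular \<phi> \<Omega> (\<lambda>x. ereal (4^(k+1)) * enn2ereal (f k x))"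
      unfolding e using f by (intro L(2)) (auto simp: le_divide_eq)
    also have "\<dots> \<le> ennreal (L * (1/2^k)) * 1" using 1 by (rule mult_left_mono) simp
    finally show ?thesis by simp
  qed
  have "modular \<phi> \<Omega> (\<lambda>x. enn2ereal (\<Sum>k. f k x)) \<le>
      (\<integral>\<^sup>+ x. (\<Sum>k. phi_abs \<phi> x (ereal (2^(k+2)) * enn2ereal (f k x))) \<partial>lebesgue_on \<Omega>)"
    unfolding modular_def by (intro nn_integral_mono phi_abs_suminf[OF assms(1)]) auto
  also have "\<dots> = (\<Sum>k. modular \<phi> \<Omega> (\<lambda>x. ereal (2^(k+2)) * enn2ereal (f k x)))"
    unfolding modular_def using f by (intro nn_integral_suminf weak_PhiD(1)[OF assms(1)]) auto
  also have "\<dots> \<le> (\<Sum>k. ennreal (L / 2^k))" by (intro suminf_le m) auto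
  also have "\<dots> = ennreal (2 * L)" by (rule suminf_half_powers_ennreal) (use L in simp)
  finally have "modular \<phi> \<Omega> (\<lambda>x. ereal 1 * enn2ereal (\<Sum>k. f k x)) \<le> ennreal (2*L)"
    by (simp add: one_ereal_def[symmetric])
  then have "modular \<phi> \<Omega> (\<lambda>x. ereal 1 * enn2ereal (\<Sum>k. f k x)) < \<infinity>"
    by (rule le_less_trans) simp
  moreover have "(\<lambda>x. enn2ereal (\<Sum>k. f k x)) \<in> borel_measurable (lebesgue_on \<Omega>)"
    using f by measurable
  ultimately show ?thesis unfolding Lphi_iff[OF assms(1)] by (auto intro!: exI[of _ 1])
qed

text \<open>Twice the larger summand dominates the sum.\<close>

lemma Lphi_add_ennreal:
  fixes f g :: "real ^ 'n \<Rightarrow> ennreal"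
  assumes "weak_Phi \<Omega> \<phi>" "(\<lambda>x. enn2ereal (f x)) \<in> Lphi \<phi> \<Omega>" "(\<lambda>x. enn2ereal (g x)) \<in> Lphi \<phi> \<Omega>"
  shows "(\<lambda>x. enn2ereal (f x + g x)) \<in> Lphi \<phi> \<Omega>"
proof -
  obtain l where l: "l > 0" "modular \<phi> \<Omega> (\<lambda>x. ereal l * enn2ereal (f x)) < \<infinity>"
     and f: "(\<lambda>x. enn2ereal (f x)) \<in> borel_measurable (lebesgue_on \<Omega>)"
    using assms(1,2) by (auto simp: Lphi_iff)
  obtain k where k: "k > 0" "modular \<phi> \<Omega> (\<lambda>x. ereal k * enn2ereal (g x)) < \<infinity>"
     and g: "(\<lambda>x. enn2ereal (g x)) \<in> borel_measurable (lebesgue_on \<Omega>)"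
    using assms(1,3) by (auto simp: Lphi_iff)
  let ?m = "min l k / 2"
  have dom: "phi_abs \<phi> x (ereal ?m * enn2ereal (p + q)) \<le> phi_abs \<phi> x (ereal c * enn2ereal q)"
    if x: "x \<in> \<Omega>" and pq: "p \<le> q" and c: "min l k \<le> c" for x p q c
  proof (rule phi_abs_mono[OF assms(1) x])
    have c0: "c > 0" using l(1) k(1) c by linarith
    show "\<bar>ereal ?m * enn2ereal (p + q)\<bar> \<le> \<bar>ereal c * enn2ereal q\<bar>"
    proof (cases q)
      case (real b)
      then obtain a where a: "p = ennreal a" "a \<ge> 0" using pq by (metis ennreal_cases neq_top_trans ennreal_neq_top)
      have ab: "a \<le> b" using pq a real by simp
      have "(min l k * (a + b)) / 2 \<le> c * b"
      proof -
        have "min l k * (a + b) \<le> c * (b + b)" using c c0 a real ab by (intro mult_mono) auto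
        then show ?thesis by simp
      qed
      moreover have "enn2ereal (p + q) = ereal (a + b)"
        using a real by (simp add: plus_ennreal.rep_eq enn2ereal_ennreal)
      ultimately show ?thesis using a real l k c0 by (simp add: enn2ereal_ennreal)
    next
      case top
      then show ?thesis using c0 by (auto simp: top_ennreal.rep_eq infinity_ennreal_def)
    qed
  qed
  have pt: "phi_abs \<phi> x (ereal ?m * enn2ereal (f x + g x)) \<le>
      phi_abs \<phi> x (ereal l * enn2ereal (f x)) + phi_abs \<phi> x (ereal k * enn2ereal (g x))" if x: "x \<in> \<Omega>" for x
  proof (cases "f x \<le> g x")
    case True
    from dom[OF x this, of k] show ?thesis by (simp add: add_increasing)
  next
    case False
    then have "g x \<le> f x" by simp
    from dom[OF x this, of l, unfolded add.commute[of "g x"]] show ?thesis by (simp add: add_increasing2)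
  qed
  have "modular \<phi> \<Omega> (\<lambda>x. ereal ?m * enn2ereal (f x + g x)) \<le>
     (\<integral>\<^sup>+ x. phi_abs \<phi> x (ereal l * enn2ereal (f x)) + phi_abs \<phi> x (ereal k * enn2ereal (g x)) \<partial>lebesgue_on \<Omega>)"
    unfolding modular_def by (intro nn_integral_mono pt) auto
  also have "\<dots> = modular \<phi> \<Omega> (\<lambda>x. ereal l * enn2ereal (f x)) + modular \<phi> \<Omega> (\<lambda>x. ereal k * enn2ereal (g x))"
    unfolding modular_def using f g by (intro nn_integral_add weak_PhiD(1)[OF assms(1)]) auto
  also have "\<dots> < \<infinity>" using l k by simp
  finally have "modular \<phi> \<Omega> (\<lambda>x. ereal ?m * enn2ereal (f x + g x)) < \<infinity>" .
  moreover have "(\<lambda>x. enn2ereal (f x + g x)) \<in> borel_measurable (lebesgue_on \<Omega>)"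
    using f g by (simp add: plus_ennreal.rep_eq)
  ultimately show ?thesis unfolding Lphi_iff[OF assms(1)] using l k by (auto intro!: exI[of _ ?m])
qed

text \<open>
  Where \<open>l \<bar>h\<bar> \<le> \<beta>\<close>, the integrand is bounded. Where \<open>l \<bar>h\<bar> > \<beta>\<close>, almost monotonicity of
  \<open>t \<mapsto> \<phi>(x, t) / t\<close> compares \<open>\<phi>(x, l \<bar>h\<bar>)\<close> with \<open>\<phi>(x, \<beta>) \<ge> 1\<close> and gives
  \<open>\<bar>h\<bar> \<le> (L \<beta> / l) \<phi>(x, l \<bar>h\<bar>)\<close>.
\<close>

lemma Lphi_integral_finite:
  assumes "weak_Phi \<Omega> \<phi>" "\<exists>\<beta>>0. AE x in lebesgue_on \<Omega>. \<phi> x \<beta> \<ge> 1"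
    and "\<Omega> \<in> sets lebesgue" "h \<in> Lphi \<phi> \<Omega>" "B \<in> sets lebesgue" "emeasure lebesgue B < \<infinity>"
  shows "(\<integral>\<^sup>+x. e2ennreal \<bar>h x\<bar> * indicator B x \<partial>lebesgue_on \<Omega>) < \<infinity>"
proof -
  obtain \<beta> where b: "\<beta> > 0" "AE x in lebesgue_on \<Omega>. \<phi> x \<beta> \<ge> 1" using assms(2) by blast
  from phi_abs_scale[OF assms(1)] obtain L where L: "L \<ge> 1"
     "\<And>x (\<theta>::real) r. x \<in> \<Omega> \<Longrightarrow> 0 < \<theta> \<Longrightarrow> \<theta> \<le> 1 \<Longrightarrow> phi_abs \<phi> x (ereal \<theta> * r) \<le> ennreal (L * \<theta>) * phi_abs \<phi> x r" by blast
  obtain l where l: "l > 0" "modular \<phi> \<Omega> (\<lambda>x. ereal l * h x) < \<infinity>" and h: "h \<in> borel_measurable (lebesgue_on \<Omega>)"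
    using assms(1,4) by (auto simp: Lphi_iff)
  have pt: "AE x in lebesgue_on \<Omega>. e2ennreal \<bar>h x\<bar> * indicator B x \<le>
      ennreal (\<beta>/l) * indicator B x + ennreal (L * \<beta> / l) * phi_abs \<phi> x (ereal l * h x)"
    using b(2) AE_space
  proof eventually_elim
    case (elim x)
    then have x: "x \<in> \<Omega>" by simp
    show ?case
    proof (cases "\<bar>h x\<bar> = \<infinity>")
      case True
      then have "phi_abs \<phi> x (ereal l * h x) = \<infinity>" using l by (auto simp: phi_abs_def)
      then have "ennreal (L * \<beta> / l) * phi_abs \<phi> x (ereal l * h x) = \<infinity>"
        using L b l by (simp add: ennreal_mult_top)
      then show ?thesis by simp
    next
      case False
      then obtain a where a: "h x = ereal a" by auto
      show ?thesis
      proof (cases "l * \<bar>a\<bar> \<le> \<beta>")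
        case True
        then have "\<bar>a\<bar> \<le> \<beta> / l" using l by (simp add: field_simps)
        then have "ennreal \<bar>a\<bar> \<le> ennreal (\<beta>/l)" by (rule ennreal_leI)
        then have "ennreal \<bar>a\<bar> * indicator B x \<le> ennreal (\<beta>/l) * indicator B x" by (rule mult_right_mono) simp
        then show ?thesis using a by (simp add: add_increasing2 e2ennreal_ereal)
      next
        case False
        then have big: "\<beta> < l * \<bar>a\<bar>" by simp
        then have pos: "l * \<bar>a\<bar> > 0" using b by linarith
        let ?\<theta> = "\<beta> / (l * \<bar>a\<bar>)"
        have "1 \<le> phi_abs \<phi> x (ereal ?\<theta> * ereal (l * \<bar>a\<bar>))"
        proof -
          have "\<bar>?\<theta> * (l * \<bar>a\<bar>)\<bar> = \<beta>" using pos b by (cases "a = 0") (auto simp: field_simps)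
          then show ?thesis using elim by (simp add: phi_abs_def del: abs_mult)
        qed
        also have "\<dots> \<le> ennreal (L * ?\<theta>) * phi_abs \<phi> x (ereal (l * \<bar>a\<bar>))"
          using x b big pos by (intro L(2)) (auto simp: divide_simps)
        also have "phi_abs \<phi> x (ereal (l * \<bar>a\<bar>)) = phi_abs \<phi> x (ereal l * h x)"
          using l by (simp add: a phi_abs_def abs_mult)
        finally have "ennreal \<bar>a\<bar> * 1 \<le> ennreal \<bar>a\<bar> * (ennreal (L * ?\<theta>) * phi_abs \<phi> x (ereal l * h x))"
          by (rule mult_left_mono) simp
        also have "\<dots> = ennreal (L * \<beta> / l) * phi_abs \<phi> x (ereal l * h x)"
        proof -
          have "ennreal \<bar>a\<bar> * ennreal (L * ?\<theta>) = ennreal (\<bar>a\<bar> * (L * ?\<theta>))"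
            by (rule ennreal_mult'[symmetric]) simp
          also have "\<bar>a\<bar> * (L * ?\<theta>) = L * \<beta> / l" using pos l by (auto simp: field_simps)
          finally show ?thesis by (simp only: mult.assoc[symmetric])
        qed
        finally have "ennreal \<bar>a\<bar> \<le> ennreal (L * \<beta> / l) * phi_abs \<phi> x (ereal l * h x)" by simp
        moreover have "e2ennreal \<bar>h x\<bar> * indicator B x \<le> ennreal \<bar>a\<bar>"
          using a by (simp add: e2ennreal_ereal indicator_def)
        ultimately show ?thesis by (meson add_increasing order_trans zero_le)
      qed
    qed
  qed
  have Bm: "(\<lambda>x. indicator B x :: ennreal) \<in> borel_measurable (lebesgue_on \<Omega>)"
    using assms(5) by (intro measurable_restrict_space1) auto
  note pm = weak_PhiD(1)[OF assms(1), of "\<lambda>x. ereal l * h x"]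
  have "(\<integral>\<^sup>+x. e2ennreal \<bar>h x\<bar> * indicator B x \<partial>lebesgue_on \<Omega>) \<le>
     (\<integral>\<^sup>+x. ennreal (\<beta>/l) * indicator B x + ennreal (L * \<beta> / l) * phi_abs \<phi> x (ereal l * h x) \<partial>lebesgue_on \<Omega>)"
    by (rule nn_integral_mono_AE[OF pt])
  also have "\<dots> = ennreal (\<beta>/l) * (\<integral>\<^sup>+x. indicator B x \<partial>lebesgue_on \<Omega>) + ennreal (L * \<beta> / l) * modular \<phi> \<Omega> (\<lambda>x. ereal l * h x)"
    unfolding modular_def using h Bm pm
    by (subst nn_integral_add) (auto simp: nn_integral_cmult)
  also have "(\<integral>\<^sup>+x. indicator B x \<partial>lebesgue_on \<Omega>) \<le> emeasure lebesgue B"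
  proof -
    have "(\<integral>\<^sup>+x. indicator B x \<partial>lebesgue_on \<Omega>) = (\<integral>\<^sup>+x. indicator B x * indicator \<Omega> x \<partial>lebesgue)"
      using assms(3) by (subst nn_integral_restrict_space) auto
    also have "\<dots> \<le> (\<integral>\<^sup>+x. indicator B x \<partial>lebesgue)" by (rule nn_integral_mono) (auto simp: indicator_def)
    finally show ?thesis using assms(5) by simp
  qed
  also have "ennreal (\<beta>/l) * emeasure lebesgue B + ennreal (L * \<beta> / l) * modular \<phi> \<Omega> (\<lambda>x. ereal l * h x) < \<infinity>"
    using assms(6) l(2) by (simp add: ennreal_mult_less_top)
  finally show ?thesis by (simp add: add_mono mult_left_mono)
qed

section \<open>Absolutely continuous functions of one variable\<close>

lemma sum_increments_division:
  fixes F :: "real \<Rightarrow> real"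
  assumes "D division_of {a..b}" "a \<le> b"
  shows "(\<Sum>k\<in>D. F (Sup k) - F (Inf k)) = F b - F a"
proof -
  note d = division_ofD[OF assms(1)]
  let ?p = "(\<lambda>k. (Inf k, k)) ` D"
  have "?p tagged_division_of {a..b}"
  proof (rule tagged_division_ofI)
    show "finite ?p" using d(1) by simp
    fix x K assume "(x,K) \<in> ?p"
    then have K: "K \<in> D" "x = Inf K" by auto
    show "K \<subseteq> {a..b}" using d(2) K by blast
    show "\<exists>a b. K = cbox a b" using d(4) K by blast
    then show "x \<in> K" using d(3)[OF K(1)] K by auto
  next
    fix x1 K1 x2 K2 assume "(x1,K1) \<in> ?p" "(x2,K2) \<in> ?p" "(x1,K1) \<noteq> (x2,K2)"
    then show "interior K1 \<inter> interior K2 = {}" using d(5)[of K1 K2] by auto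
  next
    have "{K. \<exists>x. (x, K) \<in> ?p} = D" by auto
    then show "\<Union>{K. \<exists>x. (x, K) \<in> ?p} = {a..b}" using d(6) by simp
  qed
  from additive_tagged_division_1[OF assms(2) this, of F]
  show ?thesis by (subst (asm) sum.reindex) (auto simp: inj_on_def)
qed

text \<open>
  Disjoint and not merely non-overlapping intervals, as they are selected by the Vitali
  covering theorem.
\<close>

definition disjoint_intervals :: "real set set \<Rightarrow> bool" where
  "disjoint_intervals D \<longleftrightarrow> finite D \<and> pairwise disjnt D \<and> (\<forall>k\<in>D. \<exists>s t. s < t \<and> k = {s..t})"

lemma disjoint_intervalsD:
  assumes "disjoint_intervals D" "k \<in> D"
  obtains s t where "s < t" "k = {s..t}"
  using assms unfolding disjoint_intervals_def by blast

lemma disjoint_intervals_division: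
  assumes "disjoint_intervals D"
  shows "D division_of \<Union>D"
proof (rule division_ofI)
  show "finite D" using assms by (auto simp: disjoint_intervals_def)
  fix K assume K: "K \<in> D"
  then obtain s t where "s < t" "K = {s..t}" using assms by (auto simp: disjoint_intervals_def)
  then show "K \<noteq> {}" "\<exists>a b. K = cbox a b" by auto
  show "K \<subseteq> \<Union>D" using K by auto
next
  fix K1 K2 assume "K1 \<in> D" "K2 \<in> D" "K1 \<noteq> K2"
  then have "disjnt K1 K2" using assms by (auto simp: disjoint_intervals_def pairwise_def)
  then show "interior K1 \<inter> interior K2 = {}" using interior_subset by (fastforce simp: disjnt_def)
qed simp

lemma disjoint_intervals_measure:
  assumes "disjoint_intervals D"
  shows "\<Union>D \<in> lmeasurable" "measure lebesgue (\<Union>D) = (\<Sum>k\<in>D. Sup k - Inf k)"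
proof -
  have D: "finite D" "pairwise disjnt D" "\<And>k. k \<in> D \<Longrightarrow> \<exists>s t. s < t \<and> k = {s..t}"
    using assms by (auto simp: disjoint_intervals_def)
  have k: "k \<in> lmeasurable" "measure lebesgue k = Sup k - Inf k" if "k \<in> D" for k
    using D(3)[OF that] by auto
  show "\<Union>D \<in> lmeasurable" using D k by (intro fmeasurable.finite_Union) auto
  have "measure lebesgue (\<Union>D) = (\<Sum>k\<in>D. measure lebesgue k)"
    using D k(1) by (intro measure_Union') (auto simp: pairwise_def disjnt_def disjoint_def)
  then show "measure lebesgue (\<Union>D) = (\<Sum>k\<in>D. Sup k - Inf k)" using k by simp
qed

text \<open>
  The intervals \<open>s\<close> fill \<open>\<Union>D1 - \<Union>D2\<close>, up to end points, and do not depend on \<open>F\<close>. The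
  identity in the place of \<open>F\<close> gives their total length.
\<close>

lemma disjoint_intervals_remainder:
  assumes D1: "disjoint_intervals D1" and D2: "disjoint_intervals D2"
    and sub: "\<forall>j\<in>D2. \<exists>k\<in>D1. j \<subseteq> k"
  shows "\<exists>s. s division_of \<Union>s \<and> \<Union>s \<subseteq> \<Union>D1 \<and>
    (\<forall>F::real\<Rightarrow>real. (\<Sum>k\<in>D1. F (Sup k) - F (Inf k)) =
       (\<Sum>k\<in>D2. F (Sup k) - F (Inf k)) + (\<Sum>k\<in>s. F (Sup k) - F (Inf k)))"
proof -
  have fin: "finite D1" "finite D2" and disj: "\<And>k j. k \<in> D1 \<Longrightarrow> j \<in> D1 \<Longrightarrow> k \<noteq> j \<Longrightarrow> k \<inter> j = {}"
    using D1 D2 by (auto simp: disjoint_intervals_def pairwise_def disjnt_def)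
  define sub2 where "sub2 k = {j\<in>D2. j \<subseteq> k}" for k
  have ne: "j \<noteq> {}" if "j \<in> D2" for j by (rule disjoint_intervalsD[OF D2 that]) simp
  have ex: "\<exists>q. sub2 k \<subseteq> q \<and> q division_of k" if "k \<in> D1" for k
  proof -
    obtain a b where ab: "k = {a..b}" by (rule disjoint_intervalsD[OF D1 \<open>k \<in> D1\<close>])
    have "disjoint_intervals (sub2 k)" using D2 unfolding disjoint_intervals_def sub2_def
      by (auto intro: pairwise_subset)
    from disjoint_intervals_division[OF this] have d: "sub2 k division_of \<Union>(sub2 k)" .
    have s: "\<Union>(sub2 k) \<subseteq> cbox a b" using ab by (auto simp: sub2_def)
    obtain q where "sub2 k \<subseteq> q" "q division_of cbox a b" by (rule partial_division_extend_interval[OF d s])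
    then show ?thesis using ab by (intro exI[of _ q]) simp
  qed
  define q where "q k = (SOME q. sub2 k \<subseteq> q \<and> q division_of k)" for k
  have q: "sub2 k \<subseteq> q k" "q k division_of k" if "k \<in> D1" for k
    using someI_ex[OF ex[OF that]] by (auto simp: q_def)
  define r where "r k = q k - sub2 k" for k
  have rsub: "j \<subseteq> k" "j \<noteq> {}" "\<exists>a b. j = cbox a b" if "k \<in> D1" "j \<in> r k" for j k
    using division_ofD(2,3,4)[OF q(2)[OF that(1)]] that(2) by (auto simp: r_def)
  have finr: "finite (r k)" if "k \<in> D1" for k using division_ofD(1)[OF q(2)[OF that]] by (simp add: r_def)
  let ?s = "\<Union>(r ` D1)"
  show ?thesis
  proof (intro exI[of _ ?s] conjI allI)
    show "?s division_of \<Union>?s"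
    proof (rule division_ofI)
      show "finite ?s" using fin finr by auto
      fix K assume K: "K \<in> ?s"
      then obtain k where "k \<in> D1" "K \<in> r k" by blast
      then show "K \<noteq> {}" "\<exists>a b. K = cbox a b" using rsub(2,3) by blast+
      show "K \<subseteq> \<Union>?s" using K by blast
    next
      fix K1 K2 assume "K1 \<in> ?s" "K2 \<in> ?s" and neq: "K1 \<noteq> K2"
      then obtain k1 k2 where k: "k1 \<in> D1" "K1 \<in> r k1" "k2 \<in> D1" "K2 \<in> r k2" by auto
      show "interior K1 \<inter> interior K2 = {}"
      proof (cases "k1 = k2")
        case True
        then show ?thesis using division_ofD(5)[OF q(2)[OF k(1)]] k neq by (auto simp: r_def)
      next
        case False
        then have "K1 \<inter> K2 = {}" using disj[OF k(1,3)] rsub(1)[OF k(1,2)] rsub(1)[OF k(3,4)] by blast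
        then show ?thesis using interior_subset[of K1] interior_subset[of K2] by blast
      qed
    qed simp
    show "\<Union>?s \<subseteq> \<Union>D1" using rsub(1) by blast
    fix F :: "real \<Rightarrow> real"
    let ?D = "\<lambda>k. F (Sup k) - F (Inf k)"
    have "(\<Sum>k\<in>D1. ?D k) = (\<Sum>k\<in>D1. (\<Sum>j\<in>sub2 k. ?D j) + (\<Sum>j\<in>r k. ?D j))"
    proof (rule sum.cong[OF refl])
      fix k assume k: "k \<in> D1"
      obtain a b where ab: "a < b" "k = {a..b}" by (rule disjoint_intervalsD[OF D1 k])
      have "?D k = F b - F a" using ab by simp
      also have "\<dots> = (\<Sum>j\<in>q k. ?D j)" using q(2)[OF k] ab by (intro sum_increments_division[symmetric]) auto
      also have "\<dots> = (\<Sum>j\<in>r k. ?D j) + (\<Sum>j\<in>sub2 k. ?D j)"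
        unfolding r_def using q(1)[OF k] division_ofD(1)[OF q(2)[OF k]] by (rule sum.subset_diff)
      finally show "?D k = (\<Sum>j\<in>sub2 k. ?D j) + (\<Sum>j\<in>r k. ?D j)" by simp
    qed
    also have "\<dots> = (\<Sum>k\<in>D1. \<Sum>j\<in>sub2 k. ?D j) + (\<Sum>k\<in>D1. \<Sum>j\<in>r k. ?D j)" by (rule sum.distrib)
    finally have split: "(\<Sum>k\<in>D1. ?D k) = (\<Sum>k\<in>D1. \<Sum>j\<in>sub2 k. ?D j) + (\<Sum>k\<in>D1. \<Sum>j\<in>r k. ?D j)" .
    have 1: "(\<Sum>k\<in>D1. \<Sum>j\<in>r k. ?D j) = (\<Sum>j\<in>?s. ?D j)"
    proof (rule sum.UNION_disjoint[of D1 r ?D, symmetric])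
      show "\<forall>i\<in>D1. \<forall>j\<in>D1. i \<noteq> j \<longrightarrow> r i \<inter> r j = {}"
      proof (intro ballI impI)
        fix i j assume ij: "i \<in> D1" "j \<in> D1" "i \<noteq> j"
        have False if x: "x \<in> r i" "x \<in> r j" for x
          using disj[OF ij] rsub(1,2)[OF ij(1) x(1)] rsub(1)[OF ij(2) x(2)] by blast
        then show "r i \<inter> r j = {}" by blast
      qed
    qed (use fin finr in simp_all)
    have 2: "(\<Sum>k\<in>D1. \<Sum>j\<in>sub2 k. ?D j) = (\<Sum>j\<in>(\<Union>(sub2 ` D1)). ?D j)"
    proof (rule sum.UNION_disjoint[of D1 sub2 ?D, symmetric])
      show "\<forall>i\<in>D1. \<forall>j\<in>D1. i \<noteq> j \<longrightarrow> sub2 i \<inter> sub2 j = {}"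
      proof (intro ballI impI)
        fix i j assume ij: "i \<in> D1" "j \<in> D1" "i \<noteq> j"
        have False if x: "x \<in> sub2 i" "x \<in> sub2 j" for x
        proof -
          have "x \<subseteq> i \<inter> j" "x \<in> D2" using x by (auto simp: sub2_def)
          then show False using disj[OF ij] ne[of x] by simp
        qed
        then show "sub2 i \<inter> sub2 j = {}" by blast
      qed
    qed (use fin in \<open>simp_all add: sub2_def\<close>)
    have 3: "\<Union>(sub2 ` D1) = D2"
    proof
      show "\<Union>(sub2 ` D1) \<subseteq> D2" by (auto simp: sub2_def)
      show "D2 \<subseteq> \<Union>(sub2 ` D1)"
      proof
        fix j assume j: "j \<in> D2"
        obtain k where "k \<in> D1" "j \<subseteq> k" using bspec[OF sub j] by (elim bexE)
        then show "j \<in> \<Union>(sub2 ` D1)" using j by (auto simp: sub2_def)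
      qed
    qed
    show "(\<Sum>k\<in>D1. ?D k) = (\<Sum>k\<in>D2. ?D k) + (\<Sum>k\<in>?s. ?D k)"
      unfolding split 1 2 3 ..
  qed
qed

text \<open>
  The disjoint intervals provided by the Vitali covering theorem lie in a bounded set, so
  that finitely many of them fill their union up to measure \<open>\<delta>\<close>. The set \<open>R\<close> consists of
  what these leave out and of the null set missed by the covering.
\<close>

lemma Vitali_finite_intervals:
  assumes S: "\<And>x d. x \<in> S \<Longrightarrow> 0 < d \<Longrightarrow> \<exists>s t. s < t \<and> t - s < d \<and> s \<le> x \<and> x \<le> t \<and> good s t"
    and bdd: "\<And>s t. good s t \<Longrightarrow> a \<le> s \<and> t \<le> b" and "0 < (\<delta>::real)"
  obtains D R where "disjoint_intervals D" "\<And>k. k \<in> D \<Longrightarrow> \<exists>s t. s < t \<and> good s t \<and> k = {s..t}"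
    "R \<in> lmeasurable" "measure lebesgue R < \<delta>" "S \<subseteq> \<Union>D \<union> R"
proof -
  define K where "K = {(s,t). s < t \<and> good s t}"
  define c where "c = (\<lambda>(s::real,t). (s + t)/2)"
  define r where "r = (\<lambda>(s::real,t). (t - s)/2)"
  have ball: "cball (c i) (r i) = {fst i..snd i}" for i
  proof -
    obtain s t where i: "i = (s, t)" by (cases i)
    have "(s + t)/2 - (t - s)/2 = s" "(s + t)/2 + (t - s)/2 = t"
      by (simp_all add: diff_divide_distrib add_divide_distrib)
    then show ?thesis unfolding i c_def r_def by (simp add: cball_eq_atLeastAtMost)
  qed
  have rpos: "0 < r i" if "i \<in> K" for i using that by (auto simp: K_def r_def)
  have cov: "\<exists>i. i \<in> K \<and> x \<in> cball (c i) (r i) \<and> r i < d" if xd: "x \<in> S" "0 < d" for x d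
  proof -
    obtain s t where st: "s < t" "t - s < d" "s \<le> x" "x \<le> t" "good s t" using S[OF xd] by (elim exE conjE)
    then have "(s,t) \<in> K \<and> x \<in> cball (c (s,t)) (r (s,t)) \<and> r (s,t) < d"
      unfolding ball by (simp add: K_def r_def)
    then show ?thesis by blast
  qed
  obtain C where C: "countable C" "C \<subseteq> K" "pairwise (\<lambda>i j. disjnt (cball (c i) (r i)) (cball (c j) (r j))) C"
     "negligible (S - (\<Union>i \<in> C. cball (c i) (r i)))"
    by (rule Vitali_covering_theorem_cballs[OF rpos cov])
  define I where "I i = cball (c i) (r i)" for i
  have I: "\<exists>s t. s < t \<and> good s t \<and> I i = {s..t}" if "i \<in> C" for i
    using that C(2) by (cases i) (auto simp: I_def ball K_def)
  show thesis
  proof (cases "C = {}")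
    case True
    then have "negligible S" using C(4) by simp
    then show thesis using assms(3)
      by (intro that[of "{}" S]) (simp_all add: disjoint_intervals_def negligible_iff_measure)
  next
    case False
    define A where "A = (\<Union>i\<in>C. I i)"
    define B where "B n = (\<Union>i\<in>from_nat_into C ` {..<n}. I i)" for n :: nat
    have fC: "from_nat_into C n \<in> C" for n using False by (simp add: from_nat_into)
    have mI: "I i \<in> sets lebesgue" for i by (simp add: I_def)
    have "A \<subseteq> {a..b}" unfolding A_def using I bdd by fastforce
    moreover have "A \<in> sets lebesgue" unfolding A_def using C(1) mI by auto
    ultimately have A: "A \<in> lmeasurable"
      by (intro bounded_set_imp_lmeasurable) (auto intro: bounded_subset[OF bounded_closed_interval])
    have B: "B n \<in> sets lebesgue" for n unfolding B_def using mI by auto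
    have "(\<lambda>n. measure lebesgue (A - B n)) \<longlonglongrightarrow> measure lebesgue (\<Inter>n. A - B n)"
    proof (rule Lim_measure_decseq)
      show "range (\<lambda>n. A - B n) \<subseteq> sets lebesgue" using A B by auto
      show "decseq (\<lambda>n. A - B n)" unfolding decseq_def B_def by fastforce
      show "emeasure lebesgue (A - B n) \<noteq> \<infinity>" for n
        using fmeasurable_Diff[OF A B, of n] by (auto simp: fmeasurable_def)
    qed
    moreover have "(\<Inter>n. A - B n) = {}"
    proof -
      have "\<exists>n. x \<in> B n" if "x \<in> A" for x
      proof -
        obtain i where i: "i \<in> C" "x \<in> I i" using \<open>x \<in> A\<close> unfolding A_def by (rule UN_E)
        then obtain m where "from_nat_into C m = i" using C(1) from_nat_into_surj by metis
        then show ?thesis using i by (intro exI[of _ "Suc m"]) (auto simp: B_def)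
      qed
      then show ?thesis by auto
    qed
    ultimately have "(\<lambda>n. measure lebesgue (A - B n)) \<longlonglongrightarrow> 0" by (simp only: measure_empty)
    then have "\<forall>\<^sub>F n in sequentially. measure lebesgue (A - B n) < \<delta>" using assms(3) by (rule order_tendstoD)
    then obtain n where n: "measure lebesgue (A - B n) < \<delta>" by (auto simp: eventually_sequentially)
    define D where "D = I ` from_nat_into C ` {..<n}"
    have UD: "\<Union>D = B n" by (simp add: D_def B_def)
    have SA: "S - A \<in> null_sets lebesgue" using C(4) by (simp add: A_def I_def negligible_iff_null_sets)
    have meas: "measure lebesgue ((A - B n) \<union> (S - A)) = measure lebesgue (A - B n)"
      using A B SA by (intro measure_Un_null_set) auto
    show thesis
    proof (rule that[of D "(A - B n) \<union> (S - A)"])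
      have Dsub: "\<exists>i\<in>C. k = I i" if "k \<in> D" for k using that fC by (auto simp: D_def)
      show g: "\<exists>s t. s < t \<and> good s t \<and> k = {s..t}" if "k \<in> D" for k using Dsub[OF that] I by metis
      show "disjoint_intervals D" unfolding disjoint_intervals_def
      proof (intro conjI)
        show "pairwise disjnt D"
        proof (rule pairwiseI)
          fix k j assume kj: "k \<in> D" "j \<in> D" "k \<noteq> j"
          obtain i where i: "i \<in> C" "k = I i" using Dsub[OF kj(1)] by blast
          obtain i' where i': "i' \<in> C" "j = I i'" using Dsub[OF kj(2)] by blast
          have "i \<noteq> i'" using kj(3) i i' by blast
          then show "disjnt k j" using C(3) i i' unfolding pairwise_def I_def by blast
        qed
        show "finite D" by (simp add: D_def)
        show "\<forall>k\<in>D. \<exists>s t. s < t \<and> k = {s..t}" using g by blast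
      qed
      show "A - B n \<union> (S - A) \<in> lmeasurable"
        by (rule fmeasurable.Un[OF fmeasurable_Diff[OF A B] fmeasurableI_null_sets[OF SA]])
      show "measure lebesgue (A - B n \<union> (S - A)) < \<delta>" using n meas by simp
      show "S \<subseteq> \<Union>D \<union> (A - B n \<union> (S - A))" using UD by auto
    qed
  qed
qed

lemma AC_sum_increments:
  assumes "abs_continuous_on_interval a b F" "\<epsilon> > 0"
  shows "\<exists>\<delta>>0. \<forall>D. D division_of \<Union>D \<longrightarrow> \<Union>D \<subseteq> {a..b} \<longrightarrow> (\<Sum>k\<in>D. Sup k - Inf k) < \<delta> \<longrightarrow>
     (\<Sum>k\<in>D. \<bar>F (Sup k) - F (Inf k)\<bar>) < \<epsilon>"
proof -
  from assms have "\<exists>\<delta>>0. \<forall>D S. D division_of S \<and> S \<subseteq> {a..b} \<and> (\<Sum>k\<in>D. Sup k - Inf k) < \<delta> \<longrightarrow>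
     (\<Sum>k\<in>D. \<bar>F (Sup k) - F (Inf k)\<bar>) < \<epsilon>"
    unfolding abs_continuous_on_interval_def by simp
  then show ?thesis by (elim ex_forward conj_forward all_forward) auto
qed

text \<open>
  On disjoint intervals with slopes above \<open>N\<close>, the increments of \<open>F\<close> add up to at least \<open>N\<close>
  times the total length. For intervals within a window shorter than \<open>\<delta>\<close> they add up to at
  most \<open>1\<close>, by absolute continuity, so that the total length is at most \<open>1 / N\<close>.
\<close>

lemma AC_unbounded_slopes_negligible:
  assumes "abs_continuous_on_interval a b F"
  shows "negligible {x. \<forall>N d::real. 0 < d \<longrightarrow> (\<exists>s t. s < t \<and> t - s < d \<and> s \<le> x \<and> x \<le> t \<and> a \<le> s \<and> t \<le> b \<and>
     N * (t - s) < \<bar>F t - F s\<bar>)}" (is "negligible ?E")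
proof -
  obtain \<delta> where \<delta>: "\<delta> > 0" and \<delta>2: "\<forall>D. D division_of \<Union>D \<longrightarrow> \<Union>D \<subseteq> {a..b} \<longrightarrow> (\<Sum>k\<in>D. Sup k - Inf k) < \<delta> \<longrightarrow>
     (\<Sum>k\<in>D. \<bar>F (Sup k) - F (Inf k)\<bar>) < 1"
    using AC_sum_increments[OF assms zero_less_one] by (elim exE conjE)
  have Ed: "\<exists>s t. s < t \<and> t - s < d \<and> s \<le> x \<and> x \<le> t \<and> a \<le> s \<and> t \<le> b \<and> N * (t - s) < \<bar>F t - F s\<bar>"
    if "x \<in> ?E" "0 < d" for x N d using that by simp
  have loc: "negligible (?E \<inter> {p<..<q})" if pq: "p < q" "q - p < \<delta>" for p q
    unfolding negligible_outer_le
  proof (intro allI impI)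
    fix e :: real assume e: "e > 0"
    define good where "good s t \<longleftrightarrow> a \<le> s \<and> t \<le> b \<and> p \<le> s \<and> t \<le> q \<and> (2/e) * (t - s) < \<bar>F t - F s\<bar>" for s t
    obtain D R where D: "disjoint_intervals D" "\<And>k. k \<in> D \<Longrightarrow> \<exists>s t. s < t \<and> good s t \<and> k = {s..t}"
       and R: "R \<in> lmeasurable" "measure lebesgue R < e/2" "?E \<inter> {p<..<q} \<subseteq> \<Union>D \<union> R"
    proof (rule Vitali_finite_intervals[of "?E \<inter> {p<..<q}" good a b "e/2"])
      fix x d :: real assume x: "x \<in> ?E \<inter> {p<..<q}" and d: "0 < d"
      have d': "0 < min d (min (x - p) (q - x))" using x d by simp
      have "x \<in> ?E" using x by (rule IntD1)
      note Ed[OF this d', of "2/e"]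
      then obtain s t where st: "s < t" "t - s < min d (min (x - p) (q - x))" "s \<le> x" "x \<le> t" "a \<le> s" "t \<le> b"
         "(2/e) * (t - s) < \<bar>F t - F s\<bar>" by (elim exE conjE)
      then show "\<exists>s t. s < t \<and> t - s < d \<and> s \<le> x \<and> x \<le> t \<and> good s t"
        by (intro exI[of _ s] exI[of _ t]) (auto simp: good_def)
    qed (use e in \<open>auto simp: good_def\<close>)
    note m = disjoint_intervals_measure[OF D(1)]
    have sub: "\<Union>D \<subseteq> {p..q}" "\<Union>D \<subseteq> {a..b}" using D(2) by (fastforce simp: good_def)+
    have len: "(\<Sum>k\<in>D. Sup k - Inf k) < \<delta>"
    proof -
      have "measure lebesgue (\<Union>D) \<le> measure lebesgue {p..q}"
        using sub m(1) by (intro measure_mono_fmeasurable) auto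
      then show ?thesis using m(2) pq by simp
    qed
    have "(2/e) * measure lebesgue (\<Union>D) = (\<Sum>k\<in>D. (2/e) * (Sup k - Inf k))" by (simp add: m(2) sum_distrib_left)
    also have "\<dots> \<le> (\<Sum>k\<in>D. \<bar>F (Sup k) - F (Inf k)\<bar>)"
    proof (rule sum_mono)
      fix k assume "k \<in> D"
      then obtain s t where "s < t" "good s t" "k = {s..t}" using D(2) by blast
      then show "(2/e) * (Sup k - Inf k) \<le> \<bar>F (Sup k) - F (Inf k)\<bar>" by (simp add: good_def)
    qed
    also have "\<dots> < 1" by (rule \<delta>2[rule_format, OF disjoint_intervals_division[OF D(1)] sub(2) len])
    finally have "measure lebesgue (\<Union>D) < e/2" using e by (simp add: field_simps)
    then have "measure lebesgue (\<Union>D \<union> R) \<le> e" using measure_Un_le[of "\<Union>D" lebesgue R] m(1) R by auto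
    then show "\<exists>T. ?E \<inter> {p<..<q} \<subseteq> T \<and> T \<in> lmeasurable \<and> measure lebesgue T \<le> e"
      using R m(1) by (intro exI[of _ "\<Union>D \<union> R"]) auto
  qed
  have "?E \<subseteq> (\<Union>p\<in>\<rat>. ?E \<inter> {p<..<p + \<delta>/2})"
  proof
    fix x assume x: "x \<in> ?E"
    obtain p where p: "p \<in> \<rat>" "x - \<delta>/2 < p" "p < x" using Rats_dense_in_real[of "x - \<delta>/2" x] \<delta> by auto
    then have "x \<in> {p<..<p + \<delta>/2}" by simp
    then show "x \<in> (\<Union>p\<in>\<rat>. ?E \<inter> {p<..<p + \<delta>/2})" using x p(1) by (intro UN_I[of p] IntI)
  qed
  moreover have "negligible (\<Union>((\<lambda>p. ?E \<inter> {p<..<p + \<delta>/2}) ` \<rat>))"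
    using \<delta> loc by (intro negligible_countable_Union) (auto simp: countable_rat)
  ultimately show ?thesis by (rule negligible_subset[rotated])
qed

text \<open>
  Cover \<open>E\<close>, up to a small set, by disjoint intervals \<open>D1\<close> with slopes above \<open>q\<close> that lie in
  an open set slightly larger than \<open>E\<close>, and then by disjoint intervals \<open>D2\<close> inside those of
  \<open>D1\<close> with slopes below \<open>p\<close>. Both have nearly the outer measure of \<open>E\<close> as their total
  length, so that \<open>\<Union>D1 - \<Union>D2\<close> is short and, by absolute continuity, contributes little to
  the increments of \<open>F\<close>. Hence \<open>q \<bar>D1\<bar> \<le> p \<bar>D2\<bar> + \<epsilon>\<close> with \<open>\<bar>D1\<bar>\<close> close to \<open>\<bar>D2\<bar>\<close>, which is
  possible only if both are small.
\<close>

lemma AC_two_slopes_negligible: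
  assumes AC: "abs_continuous_on_interval a b F" and pq: "p < q"
  shows "negligible {x. \<forall>d::real. 0 < d \<longrightarrow>
      (\<exists>s t. s < t \<and> t - s < d \<and> s \<le> x \<and> x \<le> t \<and> a \<le> s \<and> t \<le> b \<and> q * (t - s) < F t - F s) \<and>
      (\<exists>s t. s < t \<and> t - s < d \<and> s \<le> x \<and> x \<le> t \<and> a \<le> s \<and> t \<le> b \<and> F t - F s < p * (t - s))}" (is "negligible ?E")
proof -
  define E where "E = ?E"
  have "negligible E" unfolding negligible_outer_le
  proof (intro allI impI)
    fix e :: real assume e: "e > 0"
    have Ed1: "\<exists>s t. s < t \<and> t - s < d \<and> s \<le> x \<and> x \<le> t \<and> a \<le> s \<and> t \<le> b \<and> q * (t - s) < F t - F s"
      if "x \<in> E" "0 < d" for x d using that unfolding E_def by simp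
    have Ed2: "\<exists>s t. s < t \<and> t - s < d \<and> s \<le> x \<and> x \<le> t \<and> a \<le> s \<and> t \<le> b \<and> F t - F s < p * (t - s)"
      if "x \<in> E" "0 < d" for x d using that unfolding E_def by simp
    \<comment> \<open>The final estimate is \<open>(q - p) \<bar>D2\<bar> \<le> 2 \<epsilon>\<close>, and \<open>\<bar>D2\<bar>\<close> should be at most \<open>e / 2\<close>.\<close>
    define \<epsilon> where "\<epsilon> = e * (q - p) / 4"
    have \<epsilon>: "\<epsilon> > 0" using e pq by (simp add: \<epsilon>_def)
    obtain \<delta> where \<delta>: "\<delta> > 0" and \<delta>2: "\<forall>D. D division_of \<Union>D \<longrightarrow> \<Union>D \<subseteq> {a..b} \<longrightarrow> (\<Sum>k\<in>D. Sup k - Inf k) < \<delta> \<longrightarrow>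
       (\<Sum>k\<in>D. \<bar>F (Sup k) - F (Inf k)\<bar>) < \<epsilon>"
      using AC_sum_increments[OF AC \<epsilon>] by (elim exE conjE)
    \<comment> \<open>Four sets of measure at most \<open>\<eta>\<close> will be lost: two in passing from \<open>E\<close> to the
      open set \<open>U\<close>, one in each covering.\<close>
    define \<eta> where "\<eta> = min (\<delta>/5) (min (e/4) (\<epsilon> / (4 * (\<bar>q\<bar> + 1))))"
    have \<eta>: "\<eta> > 0" "4 * \<eta> < \<delta>" "\<eta> \<le> e/4" "\<bar>q\<bar> * (4 * \<eta>) \<le> \<epsilon>"
    proof -
      show 1: "\<eta> > 0" using \<delta> e \<epsilon> by (simp add: \<eta>_def)
      have "\<eta> \<le> \<delta>/5" unfolding \<eta>_def by (rule min.cobounded1)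
      then show "4 * \<eta> < \<delta>" using \<delta> by simp
      show "\<eta> \<le> e/4" unfolding \<eta>_def by linarith
      from 1 have "\<bar>q\<bar> * (4 * \<eta>) \<le> (\<bar>q\<bar> + 1) * (4 * \<eta>)" by (intro mult_right_mono) auto
      also have "\<dots> \<le> (\<bar>q\<bar> + 1) * (4 * (\<epsilon> / (4 * (\<bar>q\<bar> + 1))))" by (intro mult_left_mono) (auto simp: \<eta>_def)
      also have "\<dots> = \<epsilon>" by (simp add: field_simps)
      finally show "\<bar>q\<bar> * (4 * \<eta>) \<le> \<epsilon>" .
    qed
    \<comment> \<open>\<open>Inf M\<close> is the outer measure of \<open>E\<close>, whose measurability is not known at this
      stage.\<close>
    define M where "M = {measure lebesgue T | T. T \<in> lmeasurable \<and> E \<subseteq> T}"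
    have Eab: "E \<subseteq> {a..b}"
    proof
      fix x assume "x \<in> E"
      from Ed1[OF this zero_less_one] obtain s t where "s \<le> x" "x \<le> t" "a \<le> s" "t \<le> b" by (elim exE conjE)
      then show "x \<in> {a..b}" by auto
    qed
    have "measure lebesgue {a..b} \<in> M" unfolding M_def using Eab by blast
    then have Mne: "M \<noteq> {}" by blast
    have Mbdd: "bdd_below M" unfolding M_def by (rule bdd_belowI[of _ 0]) auto
    obtain T where T: "T \<in> lmeasurable" "E \<subseteq> T" "measure lebesgue T < Inf M + \<eta>"
      using cInf_lessD[OF Mne, of "Inf M + \<eta>"] \<eta>(1) by (auto simp: M_def)
    obtain U where U: "open U" "T \<subseteq> U" "U - T \<in> lmeasurable" "emeasure lebesgue (U - T) < ennreal \<eta>"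
      using sets_lebesgue_outer_open[of T \<eta>] T(1) \<eta>(1) by auto
    have Um: "U \<in> lmeasurable" "measure lebesgue U \<le> Inf M + 2 * \<eta>"
    proof -
      have eq: "U = T \<union> (U - T)" using U(2) by auto
      show "U \<in> lmeasurable" by (subst eq) (rule fmeasurable.Un[OF T(1) U(3)])
      have "measure lebesgue (U - T) < \<eta>"
        using U(3,4) \<eta>(1) by (simp add: emeasure_eq_measure2 ennreal_less_iff)
      moreover have "measure lebesgue U \<le> measure lebesgue T + measure lebesgue (U - T)"
        using T(1) U(3) by (subst eq) (intro measure_Un_le, auto)
      ultimately show "measure lebesgue U \<le> Inf M + 2 * \<eta>" using T(3) by simp
    qed
    define good1 where "good1 s t \<longleftrightarrow> a \<le> s \<and> t \<le> b \<and> {s..t} \<subseteq> U \<and> q * (t - s) < F t - F s" for s t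
    obtain D1 R1 where D1: "disjoint_intervals D1" "\<And>k. k \<in> D1 \<Longrightarrow> \<exists>s t. s < t \<and> good1 s t \<and> k = {s..t}"
         and R1: "R1 \<in> lmeasurable" "measure lebesgue R1 < \<eta>" "E \<subseteq> \<Union>D1 \<union> R1"
    proof (rule Vitali_finite_intervals[of E good1 a b \<eta>])
      fix x d :: real assume x: "x \<in> E" and d: "0 < d"
      obtain r where r: "r > 0" "ball x r \<subseteq> U" by (rule openE[OF U(1) subsetD[OF U(2) subsetD[OF T(2) x]]])
      have d': "0 < min d r" using d r by simp
      from Ed1[OF x d'] obtain s t where st: "s < t" "t - s < min d r" "s \<le> x" "x \<le> t" "a \<le> s" "t \<le> b"
           "q * (t - s) < F t - F s" by (elim exE conjE)
      have "{s..t} \<subseteq> ball x r" using st by (auto simp: dist_real_def)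
      from subset_trans[OF this r(2)] have "good1 s t" using st unfolding good1_def by simp
      then show "\<exists>s t. s < t \<and> t - s < d \<and> s \<le> x \<and> x \<le> t \<and> good1 s t"
        using st by (intro exI[of _ s] exI[of _ t]) simp
    qed (use \<eta> in \<open>auto simp: good1_def\<close>)
    define good2 where "good2 s t \<longleftrightarrow> a \<le> s \<and> t \<le> b \<and> (\<exists>k\<in>D1. {s..t} \<subseteq> k) \<and> F t - F s < p * (t - s)" for s t
    \<comment> \<open>Short intervals around a point stay inside an interval of \<open>D1\<close> only if the point
      is an interior one; the end points form the null set \<open>N\<close>.\<close>
    let ?E2 = "E \<inter> (\<Union>k\<in>D1. interior k)"
    obtain D2 R2 where D2: "disjoint_intervals D2" "\<And>k. k \<in> D2 \<Longrightarrow> \<exists>s t. s < t \<and> good2 s t \<and> k = {s..t}"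
         and R2: "R2 \<in> lmeasurable" "measure lebesgue R2 < \<eta>" "?E2 \<subseteq> \<Union>D2 \<union> R2"
    proof (rule Vitali_finite_intervals[of ?E2 good2 a b \<eta>])
      fix x d :: real assume x: "x \<in> ?E2" and d: "0 < d"
      have xE: "x \<in> E" using x by (rule IntD1)
      obtain k where k: "k \<in> D1" "x \<in> interior k" using IntD2[OF x] by (rule UN_E)
      then obtain r where r: "r > 0" "ball x r \<subseteq> k" by (metis mem_interior)
      have d': "0 < min d r" using d r by simp
      from Ed2[OF xE d'] obtain s t where st: "s < t" "t - s < min d r" "s \<le> x" "x \<le> t" "a \<le> s" "t \<le> b"
           "F t - F s < p * (t - s)" by (elim exE conjE)
      have "{s..t} \<subseteq> ball x r" using st by (auto simp: dist_real_def)
      from subset_trans[OF this r(2)] have "good2 s t" using st k(1) unfolding good2_def by blast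
      then show "\<exists>s t. s < t \<and> t - s < d \<and> s \<le> x \<and> x \<le> t \<and> good2 s t"
        using st by (intro exI[of _ s] exI[of _ t]) simp
    qed (use \<eta> in \<open>auto simp: good2_def\<close>)
    note m1 = disjoint_intervals_measure[OF D1(1)] and m2 = disjoint_intervals_measure[OF D2(1)]
    define N where "N = (\<Union>k\<in>D1. k - interior k)"
    have N: "N \<in> null_sets lebesgue"
    proof -
      have "negligible (k - interior k)" if "k \<in> D1" for k
      proof -
        obtain s t where "k = {s..t}" by (rule disjoint_intervalsD[OF D1(1) \<open>k \<in> D1\<close>])
        then have "k - interior k \<subseteq> {s, t}" by (auto simp: interior_atLeastAtMost_real)
        then show ?thesis by (rule negligible_subset[rotated]) simp
      qed
      then have "negligible N" unfolding N_def using D1(1)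
        by (intro negligible_Union) (auto simp: disjoint_intervals_def)
      then show ?thesis by (simp add: negligible_iff_null_sets)
    qed
    let ?T = "\<Union>D2 \<union> R1 \<union> R2 \<union> N"
    have ET: "E \<subseteq> ?T"
    proof
      fix x assume x: "x \<in> E"
      show "x \<in> ?T"
      proof (cases "x \<in> R1 \<or> x \<in> N")
        case False
        then obtain k where k: "k \<in> D1" "x \<in> k" using subsetD[OF R1(3) x] by auto
        then have "x \<in> interior k" using False unfolding N_def by blast
        then have "x \<in> ?E2" using x k(1) by (intro IntI UN_I)
        from subsetD[OF R2(3) this] show ?thesis by (elim UnE) (intro UnI1 UnI2 | assumption)+
      qed (elim disjE; intro UnI1 UnI2 | assumption)
    qed
    have Tm: "?T \<in> lmeasurable"
      by (rule fmeasurable.Un[OF fmeasurable.Un[OF fmeasurable.Un[OF m2(1) R1(1)] R2(1)] fmeasurableI_null_sets[OF N]])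
    have Tle: "measure lebesgue ?T \<le> measure lebesgue (\<Union>D2) + 2 * \<eta>"
    proof -
      have "measure lebesgue ?T = measure lebesgue (\<Union>D2 \<union> R1 \<union> R2)"
        using m2(1) R1(1) R2(1) N by (intro measure_Un_null_set) auto
      also have "\<dots> \<le> measure lebesgue (\<Union>D2 \<union> R1) + measure lebesgue R2"
        using m2(1) R1(1) R2(1) by (intro measure_Un_le) auto
      also have "measure lebesgue (\<Union>D2 \<union> R1) \<le> measure lebesgue (\<Union>D2) + measure lebesgue R1"
        using m2(1) R1(1) by (intro measure_Un_le) auto
      finally show ?thesis using R1(2) R2(2) by simp
    qed
    have "measure lebesgue ?T \<in> M" unfolding M_def using ET Tm by blast
    then have "Inf M \<le> measure lebesgue ?T" using Mbdd by (rule cInf_lower)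
    have D1U: "\<Union>D1 \<subseteq> U" "\<Union>D1 \<subseteq> {a..b}" using D1(2) by (fastforce simp: good1_def)+
    have "measure lebesgue (\<Union>D1) \<le> measure lebesgue U"
      using D1U(1) m1(1) Um by (intro measure_mono_fmeasurable) auto
    then have diff: "measure lebesgue (\<Union>D1) - measure lebesgue (\<Union>D2) \<le> 4 * \<eta>"
      using Um(2) Tle \<open>Inf M \<le> measure lebesgue ?T\<close> by simp
    have subD: "\<forall>j\<in>D2. \<exists>k\<in>D1. j \<subseteq> k"
    proof
      fix j assume "j \<in> D2"
      from D2(2)[OF this] show "\<exists>k\<in>D1. j \<subseteq> k" unfolding good2_def by auto
    qed
    obtain r where r: "r division_of \<Union>r" "\<Union>r \<subseteq> \<Union>D1"
      and r3: "\<forall>F::real\<Rightarrow>real. (\<Sum>k\<in>D1. F (Sup k) - F (Inf k)) =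
         (\<Sum>k\<in>D2. F (Sup k) - F (Inf k)) + (\<Sum>k\<in>r. F (Sup k) - F (Inf k))"
      using disjoint_intervals_remainder[OF D1(1) D2(1) subD] by (elim exE conjE)
    have rlen: "(\<Sum>k\<in>r. Sup k - Inf k) < \<delta>" "0 \<le> (\<Sum>k\<in>r. Sup k - Inf k)"
    proof -
      show "(\<Sum>k\<in>r. Sup k - Inf k) < \<delta>" using spec[OF r3, of "\<lambda>x. x"] diff \<eta>(2) m1(2) m2(2) by simp
      show "0 \<le> (\<Sum>k\<in>r. Sup k - Inf k)"
      proof (rule sum_nonneg)
        fix k assume "k \<in> r"
        then obtain u v where "k = cbox u v" "k \<noteq> {}" using division_ofD(3,4)[OF r(1)] by blast
        then show "0 \<le> Sup k - Inf k" by auto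
      qed
    qed
    have rF: "(\<Sum>k\<in>r. \<bar>F (Sup k) - F (Inf k)\<bar>) < \<epsilon>" by (rule \<delta>2[rule_format, OF r(1) subset_trans[OF r(2) D1U(2)] rlen(1)])
    have "q * measure lebesgue (\<Union>D1) = (\<Sum>k\<in>D1. q * (Sup k - Inf k))" by (simp add: m1(2) sum_distrib_left)
    also have "\<dots> \<le> (\<Sum>k\<in>D1. F (Sup k) - F (Inf k))"
    proof (rule sum_mono)
      fix k assume "k \<in> D1"
      from D1(2)[OF this] obtain s t where "s < t" "good1 s t" "k = {s..t}" by (elim exE conjE)
      then show "q * (Sup k - Inf k) \<le> F (Sup k) - F (Inf k)" by (simp add: good1_def)
    qed
    also have "\<dots> = (\<Sum>k\<in>D2. F (Sup k) - F (Inf k)) + (\<Sum>k\<in>r. F (Sup k) - F (Inf k))" by (rule spec[OF r3])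
    also have "(\<Sum>k\<in>r. F (Sup k) - F (Inf k)) \<le> \<epsilon>"
      using rF sum_mono[of r "\<lambda>k. F (Sup k) - F (Inf k)" "\<lambda>k. \<bar>F (Sup k) - F (Inf k)\<bar>", OF abs_ge_self] by linarith
    also have "(\<Sum>k\<in>D2. F (Sup k) - F (Inf k)) \<le> (\<Sum>k\<in>D2. p * (Sup k - Inf k))"
    proof (rule sum_mono)
      fix k assume "k \<in> D2"
      from D2(2)[OF this] obtain s t where "s < t" "good2 s t" "k = {s..t}" by (elim exE conjE)
      then show "F (Sup k) - F (Inf k) \<le> p * (Sup k - Inf k)" by (simp add: good2_def)
    qed
    also have "\<dots> = p * measure lebesgue (\<Union>D2)" by (simp add: m2(2) sum_distrib_left)
    finally have main: "q * measure lebesgue (\<Union>D1) \<le> p * measure lebesgue (\<Union>D2) + \<epsilon>" by simp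
    have "\<bar>q * (measure lebesgue (\<Union>D1) - measure lebesgue (\<Union>D2))\<bar> \<le> \<bar>q\<bar> * (4 * \<eta>)"
      unfolding abs_mult using diff rlen(2) spec[OF r3, of "\<lambda>x. x"] m1(2) m2(2) by (intro mult_left_mono) auto
    then have "(q - p) * measure lebesgue (\<Union>D2) \<le> 2 * \<epsilon>" using main \<eta>(4) by (simp add: algebra_simps)
    then have "(q - p) * measure lebesgue (\<Union>D2) \<le> (q - p) * (e / 2)" by (simp add: \<epsilon>_def mult.commute)
    then have "measure lebesgue (\<Union>D2) \<le> e / 2" using pq by (subst (asm) mult_le_cancel_left_pos) auto
    then have "measure lebesgue ?T \<le> e" using Tle \<eta>(3) by simp
    then show "\<exists>T. E \<subseteq> T \<and> T \<in> lmeasurable \<and> measure lebesgue T \<le> e"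
      by (intro exI[of _ ?T] conjI ET Tm)
  qed
  then show ?thesis unfolding E_def .
qed

text \<open>
  Translates difference quotients at \<open>x\<close> into slopes over intervals that have \<open>x\<close> as an end
  point.
\<close>

lemma two_point_interval:
  fixes F :: "real \<Rightarrow> real"
  assumes "y \<noteq> x"
  shows "min x y < max x y" "max x y - min x y = \<bar>y - x\<bar>" "min x y \<le> x" "x \<le> max x y"
    "F (max x y) - F (min x y) = (F y - F x) / (y - x) * (max x y - min x y)"
proof -
  show "min x y < max x y" "max x y - min x y = \<bar>y - x\<bar>" "min x y \<le> x" "x \<le> max x y"
    using assms by (simp_all add: min_def max_def)
  show "F (max x y) - F (min x y) = (F y - F x) / (y - x) * (max x y - min x y)"
    using assms by (cases "x \<le> y") (simp_all add: min_def max_def divide_simps, simp add: algebra_simps)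
qed

text \<open>
  Outside the set of unbounded slopes the lower and the upper limit of the difference
  quotients are finite. If they differ, two rational numbers fit strictly between them, and
  \<open>x\<close> is an exceptional point for this pair of slopes.
\<close>

theorem AC_differentiable_AE:
  assumes AC: "abs_continuous_on_interval a b F"
  shows "negligible {x \<in> {a<..<b}. \<not> (\<exists>D. (F has_real_derivative D) (at x))}"
proof -
  define B where "B = {x. \<forall>N d::real. 0 < d \<longrightarrow> (\<exists>s t. s < t \<and> t - s < d \<and> s \<le> x \<and> x \<le> t \<and> a \<le> s \<and> t \<le> b \<and>
     N * (t - s) < \<bar>F t - F s\<bar>)}"
  define A where "A p q = {x. \<forall>d::real. 0 < d \<longrightarrow>
      (\<exists>s t. s < t \<and> t - s < d \<and> s \<le> x \<and> x \<le> t \<and> a \<le> s \<and> t \<le> b \<and> q * (t - s) < F t - F s) \<and>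
      (\<exists>s t. s < t \<and> t - s < d \<and> s \<le> x \<and> x \<le> t \<and> a \<le> s \<and> t \<le> b \<and> F t - F s < p * (t - s))}" for p q
  define PQ where "PQ = {(p,q). p \<in> \<rat> \<and> q \<in> \<rat> \<and> (p::real) < q}"
  have "countable PQ"
    by (rule countable_subset[of _ "\<rat> \<times> \<rat>"]) (auto simp: PQ_def countable_rat)
  then have "negligible (\<Union>((\<lambda>(p,q). A p q) ` PQ))"
    by (intro negligible_countable_Union) (auto simp: PQ_def A_def intro: AC_two_slopes_negligible[OF AC])
  then have N: "negligible (B \<union> \<Union>((\<lambda>(p,q). A p q) ` PQ))"
    using AC_unbounded_slopes_negligible[OF AC] unfolding B_def by (rule negligible_Un[rotated])
  have diff: "\<exists>D. (F has_real_derivative D) (at x)"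
    if x: "a < x" "x < b" and xB: "x \<notin> B" and xA: "\<And>p q. (p,q) \<in> PQ \<Longrightarrow> x \<notin> A p q" for x
  proof -
    define Q where "Q y = (F y - F x) / (y - x)" for y
    have near: "\<forall>\<^sub>F y in at x. y \<noteq> x \<and> \<bar>y - x\<bar> < d \<and> a \<le> min x y \<and> max x y \<le> b" if "d > 0" for d
      unfolding eventually_at
      using x that by (intro exI[of _ "min d (min (x - a) (b - x))"]) (auto simp: dist_real_def)
    obtain M d where d: "d > 0" and noM: "\<not> (\<exists>s t. s < t \<and> t - s < d \<and> s \<le> x \<and> x \<le> t \<and> a \<le> s \<and> t \<le> b \<and>
      M * (t - s) < \<bar>F t - F s\<bar>)"
      using xB unfolding B_def mem_Collect_eq not_all not_imp by (elim exE conjE)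
    have Md: "\<bar>F t - F s\<bar> \<le> M * (t - s)" if "s < t \<and> t - s < d \<and> s \<le> x \<and> x \<le> t \<and> a \<le> s \<and> t \<le> b" for s t
      using noM that by (metis not_less)
    have bd: "\<forall>\<^sub>F y in at x. \<bar>Q y\<bar> \<le> M"
      using near[OF d]
    proof eventually_elim
      case (elim y)
      then have yx: "y \<noteq> x" by simp
      note tp = two_point_interval[OF yx]
      have "\<bar>F (max x y) - F (min x y)\<bar> \<le> M * (max x y - min x y)"
        using elim tp(1-4) by (intro Md) simp
      then have "\<bar>Q y\<bar> * (max x y - min x y) \<le> M * (max x y - min x y)"
        using tp(1) unfolding tp(5)[of F] Q_def by (simp only: abs_mult abs_of_pos diff_gt_0_iff_gt)
      then show ?case using tp(1) by (simp only: mult_le_cancel_right_pos diff_gt_0_iff_gt)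
    qed
    let ?l = "Liminf (at x) (\<lambda>y. ereal (Q y))" and ?u = "Limsup (at x) (\<lambda>y. ereal (Q y))"
    have l: "ereal (- M) \<le> ?l"
      by (rule Liminf_bounded) (use bd in eventually_elim, simp add: abs_le_iff)
    have u: "?u \<le> ereal M"
      by (rule Limsup_bounded) (use bd in eventually_elim, simp add: abs_le_iff)
    have nt: "at x \<noteq> bot" by simp
    have lu: "?l \<le> ?u" by (rule Liminf_le_Limsup) simp
    have "\<not> ?l < ?u"
    proof
      assume "?l < ?u"
      from ereal_dense3[OF this] obtain r where r: "?l < ereal (real_of_rat r)" "ereal (real_of_rat r) < ?u" by auto
      from ereal_dense3[OF r(2)] obtain r' where r': "real_of_rat r < real_of_rat r'" "ereal (real_of_rat r') < ?u" by auto
      let ?p = "real_of_rat r" and ?q = "real_of_rat r'"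
      have "(?p, ?q) \<in> PQ" using r'(1) by (simp add: PQ_def)
      from xA[OF this] obtain e where e: "e > 0" and
        no: "\<not> (\<exists>s t. s < t \<and> t - s < e \<and> s \<le> x \<and> x \<le> t \<and> a \<le> s \<and> t \<le> b \<and> ?q * (t - s) < F t - F s) \<or>
         \<not> (\<exists>s t. s < t \<and> t - s < e \<and> s \<le> x \<and> x \<le> t \<and> a \<le> s \<and> t \<le> b \<and> F t - F s < ?p * (t - s))"
        unfolding A_def mem_Collect_eq not_all not_imp de_Morgan_conj by (elim exE conjE)
      from no show False
      proof
        assume n: "\<not> (\<exists>s t. s < t \<and> t - s < e \<and> s \<le> x \<and> x \<le> t \<and> a \<le> s \<and> t \<le> b \<and> ?q * (t - s) < F t - F s)"
        have "\<forall>\<^sub>F y in at x. ereal (Q y) \<le> ereal ?q"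
          using near[OF e]
        proof eventually_elim
          case (elim y)
          then have yx: "y \<noteq> x" by simp
          note tp = two_point_interval[OF yx]
          have "\<not> ?q * (max x y - min x y) < F (max x y) - F (min x y)"
            using n elim tp(1-4) by metis
          then have "Q y * (max x y - min x y) \<le> ?q * (max x y - min x y)"
            unfolding tp(5)[of F] Q_def by (simp only: not_less)
          then show ?case using tp(1) by (simp only: mult_le_cancel_right_pos diff_gt_0_iff_gt ereal_less_eq)
        qed
        then have "?u \<le> ereal ?q" by (rule Limsup_bounded)
        then show False using r'(2) by simp
      next
        assume n: "\<not> (\<exists>s t. s < t \<and> t - s < e \<and> s \<le> x \<and> x \<le> t \<and> a \<le> s \<and> t \<le> b \<and> F t - F s < ?p * (t - s))"
        have "\<forall>\<^sub>F y in at x. ereal ?p \<le> ereal (Q y)"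
          using near[OF e]
        proof eventually_elim
          case (elim y)
          then have yx: "y \<noteq> x" by simp
          note tp = two_point_interval[OF yx]
          have "\<not> F (max x y) - F (min x y) < ?p * (max x y - min x y)"
            using n elim tp(1-4) by metis
          then have "?p * (max x y - min x y) \<le> Q y * (max x y - min x y)"
            unfolding tp(5)[of F] Q_def by (simp only: not_less)
          then show ?case using tp(1) by (simp only: mult_le_cancel_right_pos diff_gt_0_iff_gt ereal_less_eq)
        qed
        then have "ereal ?p \<le> ?l" by (rule Liminf_bounded)
        then show False using r(1) by simp
      qed
    qed
    then have eq: "?u = ?l" using lu by simp
    obtain D where D: "?l = ereal D" using l u eq by (cases ?l) auto
    have "((\<lambda>y. ereal (Q y)) \<longlongrightarrow> ereal D) (at x)"
      by (rule Liminf_eq_Limsup[OF nt D]) (simp add: eq D)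
    then have "(Q \<longlongrightarrow> D) (at x)" by (simp only: lim_ereal)
    then have "(F has_real_derivative D) (at x)" unfolding has_field_derivative_iff Q_def .
    then show ?thesis by blast
  qed
  have "{x \<in> {a<..<b}. \<not> (\<exists>D. (F has_real_derivative D) (at x))} \<subseteq> B \<union> \<Union>((\<lambda>(p,q). A p q) ` PQ)"
  proof
    fix x assume x: "x \<in> {x \<in> {a<..<b}. \<not> (\<exists>D. (F has_real_derivative D) (at x))}"
    show "x \<in> B \<union> \<Union>((\<lambda>(p,q). A p q) ` PQ)"
    proof (rule ccontr)
      assume n: "x \<notin> B \<union> \<Union>((\<lambda>(p,q). A p q) ` PQ)"
      have "\<exists>D. (F has_real_derivative D) (at x)"
      proof (rule diff)
        show "a < x" "x < b" using x by simp_all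
        show "x \<notin> B" using n by simp
        fix p q assume "(p,q) \<in> PQ"
        then show "x \<notin> A p q" using n by (metis (mono_tags, lifting) UN_I UnI2 case_prod_conv)
      qed
      then show False using x by simp
    qed
  qed
  then show ?thesis by (rule negligible_subset[OF N])
qed

text \<open>
  The gauge integral needs no prior integrability of \<open>f\<close>. At tags outside \<open>N\<close>, the gauge
  makes the increments of \<open>F\<close> comparable to those of its linear approximation. At tags in
  \<open>N\<close>, it confines the intervals to an open set \<open>U\<close> of small measure, where absolute
  continuity makes the sum of the increments small.
\<close>

theorem AC_has_integral:
  fixes F f :: "real \<Rightarrow> real"
  assumes ab: "a \<le> b" and AC: "abs_continuous_on_interval a b F" and N: "negligible N"
    and der: "\<And>x. x \<in> {a..b} - N \<Longrightarrow> (F has_real_derivative f x) (at x within {a..b})"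
  shows "(f has_integral (F b - F a)) {a..b}"
proof -
  define g where "g x = (if x \<in> N then 0 else f x)" for x
  have "(g has_integral (F b - F a)) {a..b}"
    unfolding has_integral_real
  proof (intro allI impI)
    fix e :: real assume e: "e > 0"
    obtain \<delta> where \<delta>: "\<delta> > 0" and \<delta>2: "\<forall>D. D division_of \<Union>D \<longrightarrow> \<Union>D \<subseteq> {a..b} \<longrightarrow> (\<Sum>k\<in>D. Sup k - Inf k) < \<delta> \<longrightarrow>
     (\<Sum>k\<in>D. \<bar>F (Sup k) - F (Inf k)\<bar>) < e/2"
      using AC_sum_increments[OF AC half_gt_zero[OF e]] by (elim exE conjE)
    have Ns: "N \<in> sets lebesgue" using N by (simp add: negligible_iff_null_sets null_setsD2)
    obtain U where U: "open U" "N \<subseteq> U" "U - N \<in> lmeasurable" "emeasure lebesgue (U - N) < ennreal \<delta>"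
      by (rule sets_lebesgue_outer_open[OF Ns \<delta>])
    have Um: "U \<in> lmeasurable" "measure lebesgue U < \<delta>"
    proof -
      have Nn: "N \<in> null_sets lebesgue" using N by (simp add: negligible_iff_null_sets)
      have eq: "U = (U - N) \<union> N" using U(2) by auto
      show "U \<in> lmeasurable" by (subst eq) (rule fmeasurable.Un[OF U(3) fmeasurableI_null_sets[OF Nn]])
      have "measure lebesgue U = measure lebesgue (U - N)"
        by (subst eq) (rule measure_Un_null_set[OF fmeasurableD[OF U(3)] Nn])
      also have "\<dots> < \<delta>" using U(3,4) \<delta> by (simp add: emeasure_eq_measure2 ennreal_less_iff)
      finally show "measure lebesgue U < \<delta>" .
    qed
    define e1 where "e1 = e / (2 * (b - a + 1))"
    have e1: "e1 > 0" "e1 * (b - a) \<le> e/2"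
    proof -
      show "e1 > 0" using e ab by (simp add: e1_def)
      then have "e1 * (b - a) \<le> e1 * (b - a + 1)" by simp
      also have "\<dots> = e/2" using ab by (simp add: e1_def field_simps)
      finally show "e1 * (b - a) \<le> e/2" .
    qed
    have "\<exists>d>0. x \<in> {a..b} - N \<longrightarrow> (\<forall>y\<in>{a..b}. \<bar>y - x\<bar> < d \<longrightarrow> \<bar>F y - F x - f x * (y - x)\<bar> \<le> e1 * \<bar>y - x\<bar>)" for x
    proof (cases "x \<in> {a..b} - N")
      case True
      from der[OF True] e1(1) show ?thesis
        unfolding has_field_derivative_def has_derivative_within_alt real_norm_def by blast
    qed (auto intro: zero_less_one)
    then obtain dd where dd: "\<And>x. dd x > 0"
      "\<And>x y. x \<in> {a..b} - N \<Longrightarrow> y \<in> {a..b} \<Longrightarrow> \<bar>y - x\<bar> < dd x \<Longrightarrow> \<bar>F y - F x - f x * (y - x)\<bar> \<le> e1 * \<bar>y - x\<bar>"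
      by metis
    define \<gamma> where "\<gamma> x = (if x \<in> N then U else ball x (dd x))" for x
    have "gauge \<gamma>" using U dd(1) unfolding gauge_def \<gamma>_def by auto
    moreover have "norm ((\<Sum>(x,k)\<in>p. measure lborel k *\<^sub>R g x) - (F b - F a)) < e"
      if p: "p tagged_division_of {a..b}" "\<gamma> fine p" for p
    proof -
      note pd = tagged_division_ofD[OF p(1)]
      have cb: "\<exists>u v. k = {u..v} \<and> u \<le> x \<and> x \<le> v \<and> a \<le> u \<and> v \<le> b" if xk: "(x,k) \<in> p" for x k
      proof -
        obtain u v where uv: "k = cbox u v" using pd(4)[OF xk] by blast
        show ?thesis using pd(2,3)[OF xk] unfolding uv by (intro exI[of _ u] exI[of _ v]) (auto simp: subset_iff)
      qed
      define p1 where "p1 = {(x,k)\<in>p. x \<in> N}"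
      have p1: "p1 \<subseteq> p" by (auto simp: p1_def)
      let ?h = "\<lambda>(x,k). measure lborel k *\<^sub>R g x - (F (Sup k) - F (Inf k))"
      have "(\<Sum>(x,k)\<in>p. measure lborel k *\<^sub>R g x) - (F b - F a) = (\<Sum>(x,k)\<in>p. measure lborel k *\<^sub>R g x) - (\<Sum>(x,k)\<in>p. F (Sup k) - F (Inf k))"
        using additive_tagged_division_1[OF ab p(1), of F] by simp
      also have "\<dots> = (\<Sum>xk\<in>p. ?h xk)" by (simp add: sum_subtractf[symmetric] case_prod_unfold)
      also have "\<dots> = (\<Sum>xk\<in>p - p1. ?h xk) + (\<Sum>xk\<in>p1. ?h xk)" by (rule sum.subset_diff[OF p1 pd(1)])
      finally have split: "(\<Sum>(x,k)\<in>p. measure lborel k *\<^sub>R g x) - (F b - F a) = \<dots>" .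
      have "\<bar>\<Sum>xk\<in>p - p1. ?h xk\<bar> \<le> (\<Sum>xk\<in>p - p1. \<bar>?h xk\<bar>)" by (rule sum_abs)
      also have "\<dots> \<le> (\<Sum>xk\<in>p - p1. e1 * measure lborel (snd xk))"
      proof (rule sum_mono)
        fix xk assume xk: "xk \<in> p - p1"
        obtain x k where e: "xk = (x,k)" by (cases xk)
        have xkp: "(x,k) \<in> p" "x \<notin> N" using xk e by (auto simp: p1_def)
        obtain u v where uv: "k = {u..v}" "u \<le> x" "x \<le> v" "a \<le> u" "v \<le> b" using cb[OF xkp(1)] by (elim exE conjE)
        have "k \<subseteq> \<gamma> x" using p(2) xkp(1) by (auto simp: fine_def)
        then have "{u..v} \<subseteq> ball x (dd x)" using xkp(2) uv by (simp add: \<gamma>_def)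
        then have "u \<in> ball x (dd x)" "v \<in> ball x (dd x)" using uv(2,3) by (auto simp: subset_iff simp del: mem_ball)
        then have "\<bar>u - x\<bar> < dd x" "\<bar>v - x\<bar> < dd x" by (simp_all add: dist_real_def abs_minus_commute)
        moreover have "x \<in> {a..b} - N" using uv xkp by simp
        ultimately have "\<bar>F u - F x - f x * (u - x)\<bar> \<le> e1 * \<bar>u - x\<bar>" "\<bar>F v - F x - f x * (v - x)\<bar> \<le> e1 * \<bar>v - x\<bar>"
          using uv(2-5) by (intro dd(2); simp)+
        moreover have "(v - u) * f x - (F v - F u) = (F u - F x - f x * (u - x)) - (F v - F x - f x * (v - x))"
          by (simp add: algebra_simps)
        moreover have "e1 * \<bar>u - x\<bar> + e1 * \<bar>v - x\<bar> = e1 * (v - u)" using uv by (simp add: algebra_simps)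
        ultimately have "\<bar>(v - u) * f x - (F v - F u)\<bar> \<le> e1 * (v - u)" by linarith
        then show "\<bar>?h xk\<bar> \<le> e1 * measure lborel (snd xk)" using uv xkp by (simp add: e g_def)
      qed
      also have "\<dots> \<le> (\<Sum>xk\<in>p. e1 * measure lborel (snd xk))"
        using pd(1) e1(1) by (intro sum_mono2) auto
      also have "\<dots> = e1 * (b - a)"
        using additive_content_tagged_division[of p a b] p(1) ab
        by (simp add: sum_distrib_left[symmetric] case_prod_unfold)
      finally have 1: "\<bar>\<Sum>xk\<in>p - p1. ?h xk\<bar> \<le> e/2" using e1(2) by simp
      have "p1 tagged_partial_division_of {a..b}"
        by (rule tagged_partial_division_subset[OF _ p1]) (use p(1) in \<open>simp add: tagged_division_of_def\<close>)
      then have p1d: "p1 tagged_division_of \<Union>(snd ` p1)" by (rule tagged_partial_division_of_Union_self)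
      let ?D = "snd ` p1"
      \<comment> \<open>Sums over tagged divisions reduce to sums over divisions for functions that
        vanish on degenerate intervals, among them the empty one.\<close>
      let ?d = "\<lambda>k. if k = {} then 0 else \<bar>F (Sup k) - F (Inf k)\<bar>"
      have dD: "?D division_of \<Union>?D" by (rule division_of_tagged_division[OF p1d])
      have memD: "\<exists>x\<in>N. (x,k) \<in> p" if "k \<in> ?D" for k using that by (auto simp: p1_def)
      have ne: "k \<noteq> {}" if "k \<in> ?D" for k by (rule division_ofD(3)[OF dD that])
      have "\<bar>\<Sum>xk\<in>p1. ?h xk\<bar> \<le> (\<Sum>xk\<in>p1. \<bar>?h xk\<bar>)" by (rule sum_abs)
      also have "\<dots> = (\<Sum>(x,k)\<in>p1. ?d k)"
      proof (rule sum.cong[OF refl])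
        fix xk assume xk: "xk \<in> p1"
        obtain x k where e: "xk = (x,k)" by (cases xk)
        have "x \<in> N" using xk e by (auto simp: p1_def)
        moreover have "k \<noteq> {}" using ne[of k] xk e by force
        ultimately show "\<bar>?h xk\<bar> = (case xk of (x, k) \<Rightarrow> ?d k)" by (simp add: e g_def abs_minus_commute)
      qed
      also have "\<dots> = (\<Sum>k\<in>?D. ?d k)"
      proof (rule sum.over_tagged_division_lemma[OF p1d])
        fix u v :: real assume "box u v = {}"
        then show "?d (cbox u v) = 0" by (cases "u = v") auto
      qed
      also have "\<dots> = (\<Sum>k\<in>?D. \<bar>F (Sup k) - F (Inf k)\<bar>)" using ne by (intro sum.cong) auto
      also have "\<dots> < e/2"
      proof (rule \<delta>2[rule_format, OF dD])
        show "\<Union>?D \<subseteq> {a..b}"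
        proof (rule Union_least)
          fix k assume "k \<in> ?D"
          then obtain x where "(x,k) \<in> p" using memD by blast
          then show "k \<subseteq> {a..b}" by (rule pd(3))
        qed
        have "(\<Sum>k\<in>?D. Sup k - Inf k) = (\<Sum>k\<in>?D. measure lebesgue k)"
        proof (rule sum.cong[OF refl])
          fix k assume "k \<in> ?D"
          then obtain x where "(x,k) \<in> p" using memD by blast
          from cb[OF this] show "Sup k - Inf k = measure lebesgue k" by auto
        qed
        also have "\<dots> = measure lebesgue (\<Union>?D)" by (rule content_division[OF dD])
        also have "\<dots> \<le> measure lebesgue U"
        proof (rule measure_mono_fmeasurable[OF _ fmeasurableD[OF lmeasurable_division[OF dD]] Um(1)])
          have "k \<subseteq> U" if "k \<in> ?D" for k
          proof -
            obtain x where x: "x \<in> N" "(x,k) \<in> p" using memD[OF \<open>k \<in> ?D\<close>] by blast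
            have "k \<subseteq> \<gamma> x" by (rule fineD[OF p(2) x(2)])
            then show ?thesis using x(1) by (simp add: \<gamma>_def)
          qed
          then show "\<Union>?D \<subseteq> U" by (rule Union_least)
        qed
        finally show "(\<Sum>k\<in>?D. Sup k - Inf k) < \<delta>" using Um(2) by simp
      qed
      finally have 2: "\<bar>\<Sum>xk\<in>p1. ?h xk\<bar> < e/2" .
      show ?thesis unfolding split real_norm_def using 1 2 by linarith
    qed
    ultimately show "\<exists>\<gamma>. gauge \<gamma> \<and> (\<forall>p. p tagged_division_of {a..b} \<and> \<gamma> fine p \<longrightarrow>
        norm ((\<Sum>(x,k)\<in>p. measure lborel k *\<^sub>R g x) - (F b - F a)) < e)" by (intro exI[of _ \<gamma>] conjI allI impI) auto
  qed
  then show ?thesis by (rule has_integral_spike[OF N, rotated]) (simp add: g_def)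
qed

lemma AC_subinterval:
  assumes "abs_continuous_on_interval a b f" "{c..d} \<subseteq> {a..b}"
  shows "abs_continuous_on_interval c d f"
  using assms unfolding abs_continuous_on_interval_def by (meson subset_trans)

lemma AC_imp_continuous_on:
  assumes AC: "abs_continuous_on_interval a b f"
  shows "continuous_on {a..b} f"
  unfolding continuous_on_iff
proof (intro ballI allI impI)
  fix x e :: real assume x: "x \<in> {a..b}" and e: "e > 0"
  obtain \<delta> where \<delta>: "\<delta> > 0" and \<delta>2: "\<forall>D. D division_of \<Union>D \<longrightarrow> \<Union>D \<subseteq> {a..b} \<longrightarrow> (\<Sum>k\<in>D. Sup k - Inf k) < \<delta> \<longrightarrow>
     (\<Sum>k\<in>D. \<bar>f (Sup k) - f (Inf k)\<bar>) < e"
    using AC_sum_increments[OF AC e] by (elim exE conjE)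
  have "dist (f y) (f x) < e" if y: "y \<in> {a..b}" "dist y x < \<delta>" for y
  proof -
    let ?k = "{min x y..max x y}"
    have "{?k} division_of ?k" using division_of_self[of "min x y" "max x y"] by (simp add: min_le_iff_disj)
    then have "{?k} division_of \<Union>{?k}" by simp
    moreover have "\<Union>{?k} \<subseteq> {a..b}" using x y by auto
    moreover have "(\<Sum>k\<in>{?k}. Sup k - Inf k) < \<delta>" using y(2) by (auto simp: dist_real_def min_def max_def)
    ultimately have "(\<Sum>k\<in>{?k}. \<bar>f (Sup k) - f (Inf k)\<bar>) < e" using \<delta>2 by blast
    then show ?thesis by (auto simp: dist_real_def min_def max_def abs_minus_commute split: if_splits)
  qed
  then show "\<exists>d>0. \<forall>x'\<in>{a..b}. dist x' x < d \<longrightarrow> dist (f x') (f x) < e" using \<delta> by blast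
qed

lemma AC_mult_Lipschitz:
  fixes f \<psi> :: "real \<Rightarrow> real"
  assumes AC: "abs_continuous_on_interval a b f"
    and f: "\<And>x. x \<in> {a..b} \<Longrightarrow> \<bar>f x\<bar> \<le> M" and \<psi>: "\<And>x. x \<in> {a..b} \<Longrightarrow> \<bar>\<psi> x\<bar> \<le> B"
    and lip: "\<And>x y. x \<in> {a..b} \<Longrightarrow> y \<in> {a..b} \<Longrightarrow> \<bar>\<psi> y - \<psi> x\<bar> \<le> L * \<bar>y - x\<bar>"
    and pos: "0 \<le> M" "0 \<le> B" "0 \<le> L"
  shows "abs_continuous_on_interval a b (\<lambda>x. f x * \<psi> x)"
  unfolding abs_continuous_on_interval_def
proof (intro allI impI)
  fix e :: real assume e: "e > 0"
  have "e / (2 * (B + 1)) > 0" using e pos by simp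
  from AC_sum_increments[OF AC this] obtain \<delta> where \<delta>: "\<delta> > 0" and \<delta>2: "\<forall>D. D division_of \<Union>D \<longrightarrow> \<Union>D \<subseteq> {a..b} \<longrightarrow> (\<Sum>k\<in>D. Sup k - Inf k) < \<delta> \<longrightarrow>
     (\<Sum>k\<in>D. \<bar>f (Sup k) - f (Inf k)\<bar>) < e / (2 * (B + 1))"
    by (elim exE conjE)
  define \<eta> where "\<eta> = min \<delta> (e / (2 * (M * L + 1)))"
  have mlp: "M * L + 1 > 0" using pos by (simp add: add_nonneg_pos)
  show "\<exists>\<delta>>0. \<forall>D S. D division_of S \<and> S \<subseteq> {a..b} \<and> (\<Sum>k\<in>D. Sup k - Inf k) < \<delta> \<longrightarrow>
     (\<Sum>k\<in>D. \<bar>f (Sup k) * \<psi> (Sup k) - f (Inf k) * \<psi> (Inf k)\<bar>) < e"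
  proof (intro exI[of _ \<eta>] conjI allI impI; (elim conjE)?)
    show "\<eta> > 0" using \<delta> e mlp by (simp add: \<eta>_def)
    fix D S assume D: "D division_of S" "S \<subseteq> {a..b}" "(\<Sum>k\<in>D. Sup k - Inf k) < \<eta>"
    have US: "\<Union>D = S" by (rule division_ofD(6)[OF D(1)])
    have 1: "(\<Sum>k\<in>D. \<bar>f (Sup k) - f (Inf k)\<bar>) < e / (2 * (B + 1))"
      using D by (intro \<delta>2[rule_format]) (simp_all add: US \<eta>_def)
    have "(\<Sum>k\<in>D. \<bar>f (Sup k) * \<psi> (Sup k) - f (Inf k) * \<psi> (Inf k)\<bar>) \<le>
       (\<Sum>k\<in>D. B * \<bar>f (Sup k) - f (Inf k)\<bar> + (M * L) * (Sup k - Inf k))"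
    proof (rule sum_mono)
      fix k assume k: "k \<in> D"
      obtain u v where uv: "k = {u..v}" using division_ofD(4)[OF D(1) k] by auto
      have "u \<le> v" using division_ofD(3)[OF D(1) k] uv by simp
      moreover have "k \<subseteq> {a..b}" using division_ofD(2)[OF D(1) k] D(2) by (rule subset_trans)
      ultimately have m: "u \<in> {a..b}" "v \<in> {a..b}" using uv by (auto simp: subset_iff)
      have "f v * \<psi> v - f u * \<psi> u = (f v - f u) * \<psi> v + f u * (\<psi> v - \<psi> u)" by (simp add: algebra_simps)
      then have "\<bar>f v * \<psi> v - f u * \<psi> u\<bar> \<le> \<bar>f v - f u\<bar> * \<bar>\<psi> v\<bar> + \<bar>f u\<bar> * \<bar>\<psi> v - \<psi> u\<bar>"
        by (metis abs_mult abs_triangle_ineq)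
      also have "\<dots> \<le> \<bar>f v - f u\<bar> * B + M * (L * \<bar>v - u\<bar>)"
        using m pos by (intro add_mono mult_mono f \<psi> lip) auto
      finally show "\<bar>f (Sup k) * \<psi> (Sup k) - f (Inf k) * \<psi> (Inf k)\<bar> \<le>
         B * \<bar>f (Sup k) - f (Inf k)\<bar> + (M * L) * (Sup k - Inf k)"
        using uv \<open>u \<le> v\<close> by (simp add: mult.commute mult.left_commute)
    qed
    also have "\<dots> = B * (\<Sum>k\<in>D. \<bar>f (Sup k) - f (Inf k)\<bar>) + (M * L) * (\<Sum>k\<in>D. Sup k - Inf k)"
      by (simp only: sum.distrib sum_distrib_left)
    also have "\<dots> \<le> B * (e / (2 * (B + 1))) + (M * L) * (e / (2 * (M * L + 1)))"
      using 1 D(3) pos by (intro add_mono mult_left_mono) (simp_all add: \<eta>_def)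
    also have "\<dots> < e/2 + e/2"
    proof (rule add_strict_mono)
      have "B * e < (B + 1) * e" "(M * L) * e < (M * L + 1) * e" using e by simp_all
      then show "B * (e / (2 * (B + 1))) < e/2" "(M * L) * (e / (2 * (M * L + 1))) < e/2"
        using pos mlp by (simp_all add: divide_simps algebra_simps)
    qed
    finally show "(\<Sum>k\<in>D. \<bar>f (Sup k) * \<psi> (Sup k) - f (Inf k) * \<psi> (Inf k)\<bar>) < e" by simp
  qed
qed

section \<open>Almost every line in a given direction\<close>

lemma nn_integral_lborel_translate:
  fixes f :: "'a::euclidean_space \<Rightarrow> ennreal"
  assumes [measurable]: "f \<in> borel_measurable borel"
  shows "(\<integral>\<^sup>+x. f (x + c) \<partial>lborel) = (\<integral>\<^sup>+x. f x \<partial>lborel)"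
proof -
  have "(\<integral>\<^sup>+x. f x \<partial>lborel) = (\<integral>\<^sup>+x. f x \<partial>distr lborel borel ((+) c))" by (simp add: lborel_distr_plus)
  also have "\<dots> = (\<integral>\<^sup>+x. f (c + x) \<partial>lborel)" by (subst nn_integral_distr) auto
  finally show ?thesis by (simp add: add.commute)
qed

text \<open>
  Exchange the integrals; for fixed \<open>t\<close>, the inner integral does not depend on \<open>t\<close> because
  Lebesgue measure is invariant under translation by \<open>t e\<close>.
\<close>

lemma nn_integral_lines:
  fixes f :: "'a::euclidean_space \<Rightarrow> ennreal" and e :: 'a
  assumes f[measurable]: "f \<in> borel_measurable borel" and A[measurable]: "A \<in> sets borel"
  shows "(\<integral>\<^sup>+x. \<integral>\<^sup>+t. f (x + t *\<^sub>R e) * indicator A t \<partial>lborel \<partial>lborel) = emeasure lborel A * (\<integral>\<^sup>+x. f x \<partial>lborel)"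
proof -
  have "(\<integral>\<^sup>+x. \<integral>\<^sup>+t. f (x + t *\<^sub>R e) * indicator A t \<partial>lborel \<partial>lborel) =
        (\<integral>\<^sup>+t. \<integral>\<^sup>+x. f (x + t *\<^sub>R e) * indicator A t \<partial>lborel \<partial>lborel)"
    by (rule lborel_pair.Fubini'[symmetric]) measurable
  also have "\<dots> = (\<integral>\<^sup>+t. (\<integral>\<^sup>+x. f x \<partial>lborel) * indicator A t \<partial>lborel)"
    by (intro nn_integral_cong) (simp add: nn_integral_multc nn_integral_lborel_translate)
  also have "\<dots> = emeasure lborel A * (\<integral>\<^sup>+x. f x \<partial>lborel)"
    by (subst nn_integral_cmult) (auto simp: mult.commute)
  finally show ?thesis .
qed

lemma AE_lines:
  fixes e :: "'a::euclidean_space"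
  assumes "AE y in lborel. P y"
  shows "AE x in lborel. AE t in lborel. P (x + t *\<^sub>R e)"
proof -
  obtain N where N: "{y \<in> space lborel. \<not> P y} \<subseteq> N" "emeasure lborel N = 0" "N \<in> sets lborel"
    using assms by (rule AE_E)
  have Nb[measurable]: "N \<in> sets borel" using N(3) by simp
  have "(\<integral>\<^sup>+x. \<integral>\<^sup>+t. indicator N (x + t *\<^sub>R e) * indicator (UNIV :: real set) t \<partial>lborel \<partial>lborel) =
      emeasure lborel (UNIV :: real set) * (\<integral>\<^sup>+x. indicator N x \<partial>lborel)"
    by (rule nn_integral_lines) auto
  also have "\<dots> = 0" using N by simp
  finally have "(\<integral>\<^sup>+x. \<integral>\<^sup>+t. indicator N (x + t *\<^sub>R e) \<partial>lborel \<partial>lborel) = 0" by simp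
  then have "AE x in lborel. (\<integral>\<^sup>+t. indicator N (x + t *\<^sub>R e) \<partial>lborel) = 0"
    by (subst (asm) nn_integral_0_iff_AE) measurable
  then show ?thesis
  proof eventually_elim
    case (elim x)
    then have "AE t in lborel. (indicator N (x + t *\<^sub>R e) :: ennreal) = 0"
      by (subst (asm) nn_integral_0_iff_AE) measurable
    then show ?case
    proof eventually_elim
      case (elim t)
      then have "x + t *\<^sub>R e \<notin> N" by (simp add: indicator_eq_0_iff)
      then show ?case using N(1) by auto
    qed
  qed
qed

text \<open>
  \<open>nn_integral_lines\<close> for \<open>A = {0..1}\<close> shows that the Borel part of \<open>B\<close> has measure zero.
  This is where measurability of \<open>B\<close> enters.
\<close>

lemma AE_from_lines:
  fixes e :: "'a::euclidean_space"
  assumes B: "B \<in> sets lebesgue" and ae: "AE x in lborel. AE t in lborel. x + t *\<^sub>R e \<notin> B"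
  shows "AE y in lborel. y \<notin> B"
proof -
  obtain S N N' where SN: "B = S \<union> N" "N \<subseteq> N'" "N' \<in> null_sets lborel" "S \<in> sets lborel"
    using B by (rule sets_completionE)
  have S[measurable]: "S \<in> sets borel" using SN(4) by simp
  have "(\<integral>\<^sup>+x. \<integral>\<^sup>+t. indicator S (x + t *\<^sub>R e) * indicator {0..1::real} t \<partial>lborel \<partial>lborel) = emeasure lborel {0..1::real} * (\<integral>\<^sup>+x. indicator S x \<partial>lborel)"
    by (rule nn_integral_lines) auto
  moreover have "(\<integral>\<^sup>+x. \<integral>\<^sup>+t. indicator S (x + t *\<^sub>R e) * indicator {0..1::real} t \<partial>lborel \<partial>lborel) = (\<integral>\<^sup>+(x::'a). 0 \<partial>lborel)"
  proof (rule nn_integral_cong_AE, use ae in eventually_elim)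
    case (elim x)
    have "(\<integral>\<^sup>+t. indicator S (x + t *\<^sub>R e) * indicator {0..1::real} t \<partial>lborel) = (\<integral>\<^sup>+(t::real). 0 \<partial>lborel)"
      by (rule nn_integral_cong_AE, use elim in eventually_elim) (simp add: SN(1))
    then show ?case by simp
  qed
  ultimately have "emeasure lborel S = 0" by simp
  then have "S \<in> null_sets lborel" using SN(4) by (simp add: null_sets_def)
  then have "S \<union> N' \<in> null_sets lborel" using SN(3) by (rule null_sets.Un)
  then have "AE y in lborel. y \<notin> S \<union> N'" by (rule AE_not_in)
  then show ?thesis by eventually_elim (use SN in auto)
qed

lemma AE_translate:
  fixes c :: "'a::euclidean_space"
  assumes "AE y in lborel. P y"
  shows "AE x in lborel. P (x + c)"
proof -
  obtain N where N: "{y \<in> space lborel. \<not> P y} \<subseteq> N" "emeasure lborel N = 0" "N \<in> sets lborel"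
    using assms by (rule AE_E)
  have Nb[measurable]: "N \<in> sets borel" using N(3) by simp
  have "(\<integral>\<^sup>+x. indicator N (x + c) \<partial>lborel) = (\<integral>\<^sup>+x. indicator N x \<partial>lborel)"
    by (rule nn_integral_lborel_translate) auto
  then have "(\<integral>\<^sup>+x. indicator N (x + c) \<partial>lborel) = 0" using N by simp
  then have "AE x in lborel. (indicator N (x + c) :: ennreal) = 0"
    by (subst (asm) nn_integral_0_iff_AE) measurable
  then show ?thesis
  proof eventually_elim
    case (elim x)
    then have "x + c \<notin> N" by (simp add: indicator_eq_0_iff)
    then show ?case using N(1) by auto
  qed
qed

lemma lebesgue_measurable_translate:
  fixes c :: "'a::euclidean_space"
  assumes "f \<in> borel_measurable lebesgue"
  shows "(\<lambda>x. f (x + c)) \<in> borel_measurable lebesgue"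
proof -
  have "(\<lambda>x::'a. c + (\<Sum>j\<in>Basis. (1 * (x \<bullet> j)) *\<^sub>R j)) \<in> lebesgue \<rightarrow>\<^sub>M lebesgue"
    by (rule lebesgue_affine_measurable) simp
  then have "(\<lambda>x::'a. x + c) \<in> lebesgue \<rightarrow>\<^sub>M lebesgue"
    by (simp add: euclidean_representation add.commute)
  from measurable_compose[OF this assms] show ?thesis .
qed

text \<open>
  Fubini's theorem is applied to the product of two copies of \<open>lborel\<close>, which calls for
  Borel functions.
\<close>

lemma lebesgue_integrable_ex_borel:
  fixes F :: "'a::euclidean_space \<Rightarrow> real"
  assumes "integrable lebesgue F"
  obtains F' where "F' \<in> borel_measurable borel" "AE x in lborel. F x = F' x" "integrable lborel F'"
     "integral\<^sup>L lebesgue F = integral\<^sup>L lborel F'"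
proof -
  obtain F' where F': "F' \<in> borel_measurable lborel" "AE x in lborel. F x = F' x"
    using completion_ex_borel_measurable_real[OF borel_measurable_integrable[OF assms]] by blast
  have F'm: "F' \<in> borel_measurable lebesgue" using F'(1) by (rule measurable_completion)
  have ae: "AE x in lebesgue. F x = F' x" using F'(2) by (simp add: AE_completion_iff)
  have "integrable lebesgue F'" using assms F'm ae by (metis integrable_cong_AE borel_measurable_integrable)
  then have "integrable lborel F'" using integrable_completion[OF F'(1)] by simp
  moreover have "integral\<^sup>L lebesgue F = integral\<^sup>L lebesgue F'"
    by (rule integral_cong_AE[OF borel_measurable_integrable[OF assms] F'm ae])
  ultimately show thesis using F' integral_completion[OF F'(1)] by (intro that[of F']) auto
qed

lemma integral_lborel_translate:
  fixes w :: "'a::euclidean_space \<Rightarrow> real"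
  assumes w: "integrable lborel w"
  shows "integrable lborel (\<lambda>x. w (x + c))" "(\<integral>x. w (x + c) \<partial>lborel) = (\<integral>x. w x \<partial>lborel)"
proof -
  have [measurable]: "w \<in> borel_measurable borel" using borel_measurable_integrable[OF w] by simp
  have "integrable (distr lborel borel ((+) c)) w" using w by (simp add: lborel_distr_plus)
  then have "integrable lborel (\<lambda>x. w (c + x))" by (subst (asm) integrable_distr_eq) auto
  then show "integrable lborel (\<lambda>x. w (x + c))" by (simp add: add.commute)
  have "(\<integral>x. w x \<partial>lborel) = (\<integral>x. w x \<partial>distr lborel borel ((+) c))" by (simp add: lborel_distr_plus)
  also have "\<dots> = (\<integral>x. w (c + x) \<partial>lborel)" by (subst integral_distr) auto
  finally show "(\<integral>x. w (x + c) \<partial>lborel) = (\<integral>x. w x \<partial>lborel)" by (simp add: add.commute)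
qed

text \<open>
  By translation invariance, the integral of \<open>F\<close> is that of \<open>F(x + t e)\<close> over all \<open>x\<close> and
  all \<open>t\<close> in \<open>{0..1}\<close>. Integrating over \<open>t\<close> first leaves \<open>w(x + e) - w(x)\<close>, whose integral
  vanishes, again by translation invariance. For a derivative \<open>F\<close> of \<open>w = v \<psi>\<close> in direction
  \<open>e\<close>, this is integration by parts.
\<close>

lemma integral_zero_if_lines_FTC:
  fixes F w :: "'a::euclidean_space \<Rightarrow> real" and e :: 'a
  assumes F: "integrable lebesgue F" and w: "integrable lebesgue w"
    and ftc: "AE x in lborel. ((\<lambda>t. F (x + t *\<^sub>R e)) has_integral (w (x + e) - w x)) {0..1}"
  shows "integral\<^sup>L lebesgue F = 0"
proof -
  obtain F' where F'm: "F' \<in> borel_measurable borel" and FF': "AE x in lborel. F x = F' x" and F': "integrable lborel F'"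
    and iF: "integral\<^sup>L lebesgue F = integral\<^sup>L lborel F'" by (rule lebesgue_integrable_ex_borel[OF F])
  obtain w' where w'm: "w' \<in> borel_measurable borel" and ww': "AE x in lborel. w x = w' x" and w': "integrable lborel w'"
    and "integral\<^sup>L lebesgue w = integral\<^sup>L lborel w'" by (rule lebesgue_integrable_ex_borel[OF w])
  note [measurable] = F'm w'm
  let ?G = "\<lambda>(x,t). indicator {0..1::real} t * F' (x + t *\<^sub>R e)"
  have G: "integrable (lborel \<Otimes>\<^sub>M lborel) ?G"
  proof (rule integrableI_bounded)
    show "?G \<in> borel_measurable (lborel \<Otimes>\<^sub>M lborel)" by measurable
    have "(\<integral>\<^sup>+ z. ennreal (norm (?G z)) \<partial>(lborel \<Otimes>\<^sub>M lborel)) = (\<integral>\<^sup>+x. \<integral>\<^sup>+t. ennreal (norm (?G (x,t))) \<partial>lborel \<partial>lborel)"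
      by (rule lborel.nn_integral_fst[symmetric]) measurable
    also have "\<dots> = (\<integral>\<^sup>+x. \<integral>\<^sup>+t. ennreal (norm (F' (x + t *\<^sub>R e))) * indicator {0..1} t \<partial>lborel \<partial>lborel)"
      by (intro nn_integral_cong) (auto simp: indicator_def)
    also have "\<dots> = emeasure lborel {0..1::real} * (\<integral>\<^sup>+x. ennreal (norm (F' x)) \<partial>lborel)"
      by (rule nn_integral_lines) auto
    also have "\<dots> < \<infinity>" using F' by (simp add: integrable_iff_bounded)
    finally show "(\<integral>\<^sup>+ z. ennreal (norm (?G z)) \<partial>(lborel \<Otimes>\<^sub>M lborel)) < \<infinity>" .
  qed
  have line: "AE x in lborel. (\<integral>t. ?G (x,t) \<partial>lborel) = w' (x + e) - w' x"
    using AE_lines[OF FF', of e] ftc lborel_pair.AE_integrable_fst'[OF G] ww' AE_translate[OF ww', of e]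
  proof eventually_elim
    case (elim x)
    have int: "set_integrable lborel {0..1} (\<lambda>t. F' (x + t *\<^sub>R e))"
      using elim(3) by (simp add: set_integrable_def)
    have "((\<lambda>t. F (x + t *\<^sub>R e)) has_integral (w (x + e) - w x)) {0..1} \<longleftrightarrow>
          ((\<lambda>t. F' (x + t *\<^sub>R e)) has_integral (w (x + e) - w x)) {0..1}"
      using elim(1) by (intro has_integral_AE) auto
    then have "integral {0..1} (\<lambda>t. F' (x + t *\<^sub>R e)) = w (x + e) - w x"
      using elim(2) by (simp add: integral_unique)
    then show ?case using set_borel_integral_eq_integral(2)[OF int] elim(4,5)
      by (simp add: set_lebesgue_integral_def)
  qed
  have "(\<integral>x. (\<integral>t. ?G (x,t) \<partial>lborel) \<partial>lborel) = (\<integral>x. w' (x + e) - w' x \<partial>lborel)"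
    by (rule integral_cong_AE[OF _ _ line]) measurable
  also have "\<dots> = 0" using w' integral_lborel_translate[OF w', of e] by (subst Bochner_Integration.integral_diff) auto
  finally have 0: "(\<integral>x. (\<integral>t. ?G (x,t) \<partial>lborel) \<partial>lborel) = 0" .
  have G2: "integrable (lborel \<Otimes>\<^sub>M lborel) (case_prod (\<lambda>x t. indicator {0..1::real} t * F' (x + t *\<^sub>R e)))"
    using G .
  have "(\<integral>t. (\<integral>x. indicator {0..1::real} t * F' (x + t *\<^sub>R e) \<partial>lborel) \<partial>lborel) =
        (\<integral>x. (\<integral>t. indicator {0..1::real} t * F' (x + t *\<^sub>R e) \<partial>lborel) \<partial>lborel)"
    by (rule lborel_pair.Fubini_integral[OF G2])
  also have "\<dots> = 0" using 0 by simp
  also have "(\<integral>t. (\<integral>x. indicator {0..1::real} t * F' (x + t *\<^sub>R e) \<partial>lborel) \<partial>lborel) =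
        (\<integral>t. indicator {0..1::real} t * (\<integral>x. F' x \<partial>lborel) \<partial>lborel)"
    by (intro Bochner_Integration.integral_cong refl) (simp add: integral_lborel_translate(2)[OF F'])
  also have "\<dots> = (\<integral>x. F' x \<partial>lborel)" by simp
  finally show ?thesis using iF by simp
qed

text \<open>
  A compact piece of a line lies in one of countably many balls, so that \<open>h\<close> may be cut off
  outside a ball.
\<close>

lemma lines_nn_integral_finite:
  fixes h :: "'a::euclidean_space \<Rightarrow> ennreal" and e :: 'a
  assumes h[measurable]: "h \<in> borel_measurable borel"
    and fin: "\<And>j::nat. (\<integral>\<^sup>+x. h x * indicator (ball 0 (real j)) x \<partial>lborel) < \<infinity>"
  shows "AE x in lborel. \<forall>a b. (\<integral>\<^sup>+t. h (x + t *\<^sub>R e) * indicator {a..b} t \<partial>lborel) < \<infinity>"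
proof -
  have bm[measurable]: "ball (0::'a) (real j) \<in> sets borel" for j by simp
  have "AE x in lborel. (\<integral>\<^sup>+t. (h (x + t *\<^sub>R e) * indicator (ball 0 (real j)) (x + t *\<^sub>R e)) * indicator {-real m..real m} t \<partial>lborel) \<noteq> \<infinity>" for j m :: nat
  proof (rule nn_integral_noteq_infinite)
    have "(\<integral>\<^sup>+x. \<integral>\<^sup>+t. (h (x + t *\<^sub>R e) * indicator (ball 0 (real j)) (x + t *\<^sub>R e)) * indicator {-real m..real m} t \<partial>lborel \<partial>lborel) =
      emeasure lborel {-real m..real m} * (\<integral>\<^sup>+x. h x * indicator (ball 0 (real j)) x \<partial>lborel)"
      by (rule nn_integral_lines) auto
    also have "\<dots> < \<infinity>" using fin[of j] by (simp add: ennreal_mult_less_top)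
    finally show "(\<integral>\<^sup>+x. \<integral>\<^sup>+t. (h (x + t *\<^sub>R e) * indicator (ball 0 (real j)) (x + t *\<^sub>R e)) * indicator {-real m..real m} t \<partial>lborel \<partial>lborel) \<noteq> \<infinity>"
      by simp
  qed measurable
  then have "AE x in lborel. \<forall>(j::nat) (m::nat). (\<integral>\<^sup>+t. (h (x + t *\<^sub>R e) * indicator (ball 0 (real j)) (x + t *\<^sub>R e)) * indicator {-real m..real m} t \<partial>lborel) \<noteq> \<infinity>"
    by (simp add: AE_all_countable)
  then show ?thesis
  proof eventually_elim
    case (elim x)
    show ?case
    proof (intro allI)
      fix a b :: real
      obtain m :: nat where m: "max \<bar>a\<bar> \<bar>b\<bar> \<le> real m" using real_arch_simple by blast
      obtain j :: nat where j: "norm x + real m * norm e < real j" using reals_Archimedean2 by blast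
      have "h (x + t *\<^sub>R e) * indicator {a..b} t \<le> (h (x + t *\<^sub>R e) * indicator (ball 0 (real j)) (x + t *\<^sub>R e)) * indicator {-real m..real m} t" for t
      proof (cases "t \<in> {a..b}")
        case True
        then have t: "\<bar>t\<bar> \<le> real m" using m by auto
        have "norm (x + t *\<^sub>R e) \<le> norm x + \<bar>t\<bar> * norm e" using norm_triangle_ineq[of x "t *\<^sub>R e"] by simp
        also have "\<dots> \<le> norm x + real m * norm e" using t by (intro add_left_mono mult_right_mono) auto
        finally have "x + t *\<^sub>R e \<in> ball 0 (real j)" using j by simp
        moreover have "t \<in> {-real m..real m}" using t by auto
        ultimately show ?thesis using True by simp
      qed simp
      then have "(\<integral>\<^sup>+t. h (x + t *\<^sub>R e) * indicator {a..b} t \<partial>lborel) \<le> (\<integral>\<^sup>+t. (h (x + t *\<^sub>R e) * indicator (ball 0 (real j)) (x + t *\<^sub>R e)) * indicator {-real m..real m} t \<partial>lborel)"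
        by (intro nn_integral_mono) auto
      also have "\<dots> < \<infinity>" using elim by (simp add: less_top)
      finally show "(\<integral>\<^sup>+t. h (x + t *\<^sub>R e) * indicator {a..b} t \<partial>lborel) < \<infinity>" .
    qed
  qed
qed

lemma has_real_derivative_at_alt:
  "(f has_real_derivative D) (at t) \<longleftrightarrow>
    (\<forall>\<epsilon>>0. \<exists>d>0. \<forall>s. \<bar>s - t\<bar> < d \<longrightarrow> \<bar>f s - f t - D * (s - t)\<bar> \<le> \<epsilon> * \<bar>s - t\<bar>)"
  unfolding has_field_derivative_def has_derivative_at_alt real_norm_def
  by (simp add: bounded_linear_mult_right)

text \<open>
  On almost every line the derivative is \<open>g\<close> at almost every point. To conclude that it is
  \<open>g\<close> at almost every point of \<open>\<Omega>\<close>, the set of the remaining points should be measurable.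
  The condition \<open>R\<close> therefore involves rational increments only, so that its failure set \<open>B\<close>
  is measurable; continuity along the line brings the real increments back.
\<close>

lemma AE_directional_derivative:
  fixes v g :: "'a::euclidean_space \<Rightarrow> real" and e :: 'a
  assumes \<Omega>: "open \<Omega>" and v: "v \<in> borel_measurable (lebesgue_on \<Omega>)" and g: "g \<in> borel_measurable (lebesgue_on \<Omega>)"
    and cont: "AE x in lborel. \<forall>t. x + t *\<^sub>R e \<in> \<Omega> \<longrightarrow> isCont (\<lambda>s. v (x + s *\<^sub>R e)) t"
    and der: "AE x in lborel. AE t in lborel. x + t *\<^sub>R e \<in> \<Omega> \<longrightarrow>
       ((\<lambda>s. v (x + s *\<^sub>R e)) has_real_derivative g (x + t *\<^sub>R e)) (at t)"
  shows "AE x in lborel. x \<in> \<Omega> \<longrightarrow> ((\<lambda>s. v (x + s *\<^sub>R e)) has_real_derivative g x) (at 0)"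
proof -
  define v0 where "v0 x = (if x \<in> \<Omega> then v x else 0)" for x
  define g0 where "g0 x = (if x \<in> \<Omega> then g x else 0)" for x
  have \<Omega>s: "\<Omega> \<in> sets lebesgue" using \<Omega> by simp
  have v0: "v0 \<in> borel_measurable lebesgue" unfolding v0_def by (rule borel_measurable_if_I[OF v \<Omega>s])
  have g0: "g0 \<in> borel_measurable lebesgue" unfolding g0_def by (rule borel_measurable_if_I[OF g \<Omega>s])
  have vq: "(\<lambda>x. v0 (x + q *\<^sub>R e)) \<in> borel_measurable lebesgue" for q
    by (rule lebesgue_measurable_translate[OF v0])
  \<comment> \<open>Differentiability at \<open>x\<close> with derivative \<open>g x\<close>, tested on rational increments.\<close>
  define R where "R x \<longleftrightarrow> (\<forall>j::nat. \<exists>i::nat. \<forall>r::rat. \<bar>real_of_rat r\<bar> < 1 / real (Suc i) \<longrightarrow>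
     \<bar>v0 (x + real_of_rat r *\<^sub>R e) - v0 x - real_of_rat r * g0 x\<bar> \<le> \<bar>real_of_rat r\<bar> / real (Suc j))" for x
  define B where "B = {x \<in> \<Omega>. \<not> R x}"
  have near: "\<exists>d>0. \<forall>s. \<bar>s\<bar> < d \<longrightarrow> y + s *\<^sub>R e \<in> \<Omega>" if "y \<in> \<Omega>" for y
  proof -
    obtain r where r: "r > 0" "ball y r \<subseteq> \<Omega>" by (rule openE[OF \<Omega> \<open>y \<in> \<Omega>\<close>])
    have "y + s *\<^sub>R e \<in> \<Omega>" if "\<bar>s\<bar> < r / (norm e + 1)" for s
    proof -
      have "\<bar>s\<bar> * (norm e + 1) < r" using that by (simp add: pos_less_divide_eq add_nonneg_pos)
      moreover have "\<bar>s\<bar> * norm e \<le> \<bar>s\<bar> * (norm e + 1)" by (intro mult_left_mono) auto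
      ultimately have "dist y (y + s *\<^sub>R e) < r" by (simp add: dist_norm)
      then show ?thesis using r(2) by auto
    qed
    moreover have "r / (norm e + 1) > 0" using r(1) by (simp add: add_nonneg_pos)
    ultimately show ?thesis by blast
  qed
  have Bm: "B \<in> sets lebesgue"
  proof -
    note [measurable] = \<Omega>s v0 g0 vq
    have "{x \<in> space lebesgue. x \<in> \<Omega> \<and> \<not> R x} \<in> sets lebesgue"
      unfolding R_def by measurable
    then show ?thesis by (simp add: B_def)
  qed
  have "AE x in lborel. AE t in lborel. x + t *\<^sub>R e \<notin> B"
    using der
  proof eventually_elim
    case (elim x)
    then show ?case
    proof eventually_elim
      case (elim t)
      show ?case
      proof
        assume "x + t *\<^sub>R e \<in> B"
        then have y: "x + t *\<^sub>R e \<in> \<Omega>" and nR: "\<not> R (x + t *\<^sub>R e)" by (auto simp: B_def)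
        let ?y = "x + t *\<^sub>R e"
        have D: "((\<lambda>s. v (x + s *\<^sub>R e)) has_real_derivative g ?y) (at t)" using elim y by simp
        have "R ?y" unfolding R_def
        proof
          fix j :: nat
          have "0 < 1 / real (Suc j)" by simp
          from D[unfolded has_real_derivative_at_alt, rule_format, OF this] obtain d where d: "d > 0"
            and d2: "\<forall>s. \<bar>s - t\<bar> < d \<longrightarrow> \<bar>v (x + s *\<^sub>R e) - v ?y - g ?y * (s - t)\<bar> \<le> 1 / real (Suc j) * \<bar>s - t\<bar>"
            by (elim exE conjE)
          obtain d' where d': "d' > 0" and d'2: "\<forall>s. \<bar>s\<bar> < d' \<longrightarrow> ?y + s *\<^sub>R e \<in> \<Omega>"
            using near[OF y] by (elim exE conjE)
          have "0 < min d d'" using d d' by simp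
          then obtain i where i: "1 / real (Suc i) < min d d'" by (rule nat_approx_posE)
          show "\<exists>i. \<forall>r. \<bar>real_of_rat r\<bar> < 1 / real (Suc i) \<longrightarrow>
             \<bar>v0 (?y + real_of_rat r *\<^sub>R e) - v0 ?y - real_of_rat r * g0 ?y\<bar> \<le> \<bar>real_of_rat r\<bar> / real (Suc j)"
          proof (intro exI[of _ i] allI impI)
            fix r assume r: "\<bar>real_of_rat r\<bar> < 1 / real (Suc i)"
            let ?q = "real_of_rat r"
            have "?y + ?q *\<^sub>R e \<in> \<Omega>" using r i by (intro d'2[rule_format]) simp
            moreover have "\<bar>v (x + (t + ?q) *\<^sub>R e) - v ?y - g ?y * ((t + ?q) - t)\<bar> \<le> 1 / real (Suc j) * \<bar>(t + ?q) - t\<bar>"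
              using r i by (intro d2[rule_format]) simp
            moreover have "x + (t + ?q) *\<^sub>R e = ?y + ?q *\<^sub>R e" by (simp add: algebra_simps)
            ultimately show "\<bar>v0 (?y + ?q *\<^sub>R e) - v0 ?y - ?q * g0 ?y\<bar> \<le> \<bar>?q\<bar> / real (Suc j)"
              using y by (simp add: v0_def g0_def mult.commute)
          qed
        qed
        then show False using nR by simp
      qed
    qed
  qed
  from AE_from_lines[OF Bm this] have "AE x in lborel. x \<notin> B" .
  then show ?thesis using cont
  proof eventually_elim
    case (elim x)
    show ?case
    proof
      assume x: "x \<in> \<Omega>"
      then have Rx: "R x" using elim(1) by (simp add: B_def)
      obtain d' where d': "d' > 0" and d'2: "\<forall>s. \<bar>s\<bar> < d' \<longrightarrow> x + s *\<^sub>R e \<in> \<Omega>"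
        using near[OF x] by (elim exE conjE)
      have "\<exists>d>0. \<forall>s. \<bar>s - 0\<bar> < d \<longrightarrow> \<bar>v (x + s *\<^sub>R e) - v (x + 0 *\<^sub>R e) - g x * (s - 0)\<bar> \<le> \<epsilon> * \<bar>s - 0\<bar>" if \<epsilon>: "\<epsilon> > 0" for \<epsilon>
      proof -
        obtain j where j: "1 / real (Suc j) < \<epsilon>" using \<epsilon> by (rule nat_approx_posE)
        obtain i where i: "\<forall>r. \<bar>real_of_rat r\<bar> < 1 / real (Suc i) \<longrightarrow>
          \<bar>v0 (x + real_of_rat r *\<^sub>R e) - v0 x - real_of_rat r * g0 x\<bar> \<le> \<bar>real_of_rat r\<bar> / real (Suc j)"
          using spec[OF Rx[unfolded R_def], of j] by (elim exE)
        define d where "d = min d' (1 / real (Suc i))"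
        have "\<bar>v (x + s *\<^sub>R e) - v x - g x * s\<bar> \<le> \<epsilon> * \<bar>s\<bar>" if s: "\<bar>s\<bar> < d" for s
        proof -
          \<comment> \<open>\<open>H\<close> is continuous near \<open>0\<close> and nonnegative at small rational numbers.\<close>
          define H where "H s = \<bar>s\<bar> / real (Suc j) - \<bar>v (x + s *\<^sub>R e) - v x - g x * s\<bar>" for s
          have "isCont (\<lambda>s. v (x + s *\<^sub>R e)) s" using elim(2) d'2 s by (simp add: d_def)
          then have "isCont H s" unfolding H_def by (intro continuous_intros) auto
          have "H s \<ge> 0"
          proof (rule ccontr)
            assume "\<not> H s \<ge> 0"
            then have "H s < 0" by simp
            with \<open>isCont H s\<close> have "\<forall>\<^sub>F y in at s. H y < 0" unfolding isCont_def by (rule order_tendstoD(2))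
            then obtain \<rho> where \<rho>: "\<rho> > 0" "\<And>y. y \<noteq> s \<Longrightarrow> dist y s < \<rho> \<Longrightarrow> H y < 0" unfolding eventually_at by blast
            define \<rho>' where "\<rho>' = min \<rho> (d - \<bar>s\<bar>)"
            have "\<rho>' > 0" using \<rho> s by (simp add: \<rho>'_def)
            then obtain r where r: "s < real_of_rat r" "real_of_rat r < s + \<rho>'" using of_rat_dense[of s "s + \<rho>'"] by auto
            have "\<rho>' \<le> d - \<bar>s\<bar>" unfolding \<rho>'_def by (rule min.cobounded2)
            then have rd: "\<bar>real_of_rat r\<bar> < d" using r by linarith
            have "H (real_of_rat r) < 0" using r by (intro \<rho>(2)) (auto simp: \<rho>'_def dist_real_def)
            moreover have "x + real_of_rat r *\<^sub>R e \<in> \<Omega>" using rd by (intro d'2[rule_format]) (simp add: d_def)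
            moreover have "\<bar>v0 (x + real_of_rat r *\<^sub>R e) - v0 x - real_of_rat r * g0 x\<bar> \<le> \<bar>real_of_rat r\<bar> / real (Suc j)"
              using rd by (intro i[rule_format]) (simp add: d_def)
            ultimately show False using x by (simp add: H_def v0_def g0_def mult.commute)
          qed
          then have "\<bar>v (x + s *\<^sub>R e) - v x - g x * s\<bar> \<le> \<bar>s\<bar> * (1 / real (Suc j))" by (simp add: H_def)
          also have "\<dots> \<le> \<bar>s\<bar> * \<epsilon>" using j by (intro mult_left_mono) auto
          finally show ?thesis by (simp add: mult.commute)
        qed
        moreover have "d > 0" using d' by (simp add: d_def)
        ultimately show ?thesis by (intro exI[of _ d]) simp
      qed
      then show "((\<lambda>s. v (x + s *\<^sub>R e)) has_real_derivative g x) (at 0)"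
        unfolding has_real_derivative_at_alt by simp
    qed
  qed
qed

section \<open>Smooth bumps and the uniqueness of weak derivatives\<close>

text \<open>Functions of one variable of class \<open>C\<^sup>k\<close>, the factors of the bumps below.\<close>

primrec ck_real :: "nat \<Rightarrow> (real \<Rightarrow> real) \<Rightarrow> bool" where
  "ck_real 0 f \<longleftrightarrow> continuous_on UNIV f"
| "ck_real (Suc k) f \<longleftrightarrow> (\<exists>f'. (\<forall>x. (f has_real_derivative f' x) (at x)) \<and> ck_real k f')"

lemma ck_real_SucI:
  "(\<And>x. (f has_real_derivative f' x) (at x)) \<Longrightarrow> ck_real k f' \<Longrightarrow> ck_real (Suc k) f"
  by auto

lemma ck_real_Suc_imp: "ck_real (Suc k) f \<Longrightarrow> ck_real k f"
proof (induction k arbitrary: f)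
  case 0
  then obtain f' where "\<forall>x. (f has_real_derivative f' x) (at x)" by auto
  then have "(f has_real_derivative f' x) (at x)" for x by (rule spec)
  then show ?case unfolding ck_real.simps by (rule DERIV_continuous_on)
next
  case (Suc k)
  then obtain f' where f': "\<forall>x. (f has_real_derivative f' x) (at x)" "ck_real (Suc k) f'" unfolding ck_real.simps(2)[of "Suc k"] by (elim exE conjE)
  show ?case by (rule ck_real_SucI[OF f'(1)[rule_format] Suc.IH[OF f'(2)]])
qed

lemma ck_real_add: "ck_real k f \<Longrightarrow> ck_real k g \<Longrightarrow> ck_real k (\<lambda>x. f x + g x)"
proof (induction k arbitrary: f g)
  case 0
  then show ?case by (auto intro: continuous_intros)
next
  case (Suc k)
  obtain f' where f: "\<forall>x. (f has_real_derivative f' x) (at x)" "ck_real k f'" using Suc.prems(1) by auto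
  obtain g' where g: "\<forall>x. (g has_real_derivative g' x) (at x)" "ck_real k g'" using Suc.prems(2) by auto
  show ?case
    by (rule ck_real_SucI[OF DERIV_add[OF f(1)[rule_format] g(1)[rule_format]] Suc.IH[OF f(2) g(2)]])
qed

lemma ck_real_mult: "ck_real k f \<Longrightarrow> ck_real k g \<Longrightarrow> ck_real k (\<lambda>x. f x * g x)"
proof (induction k arbitrary: f g)
  case 0
  then show ?case by (auto intro: continuous_intros)
next
  case (Suc k)
  obtain f' where f: "\<forall>x. (f has_real_derivative f' x) (at x)" "ck_real k f'" using Suc.prems(1) by auto
  obtain g' where g: "\<forall>x. (g has_real_derivative g' x) (at x)" "ck_real k g'" using Suc.prems(2) by auto
  have "ck_real k (\<lambda>x. f' x * g x + g' x * f x)"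
    by (rule ck_real_add[OF Suc.IH[OF f(2) ck_real_Suc_imp[OF Suc.prems(2)]] Suc.IH[OF g(2) ck_real_Suc_imp[OF Suc.prems(1)]]])
  then show ?case by (rule ck_real_SucI[OF DERIV_mult[OF f(1)[rule_format] g(1)[rule_format]]])
qed

lemma ck_real_const: "ck_real k (\<lambda>x. c)"
proof (induction k arbitrary: c)
  case (Suc k)
  show ?case by (rule ck_real_SucI[OF DERIV_const Suc])
qed simp

lemma ck_real_affine: "ck_real k f \<Longrightarrow> ck_real k (\<lambda>x. f (a * x + b))"
proof (induction k arbitrary: f)
  case 0
  have "continuous_on UNIV (\<lambda>x. a * x + b)" by (intro continuous_intros)
  then show ?case using 0 continuous_on_compose2[of UNIV f UNIV "\<lambda>x. a * x + b"] by simp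
next
  case (Suc k)
  obtain f' where f: "\<forall>x. (f has_real_derivative f' x) (at x)" "ck_real k f'" using Suc.prems(1) by auto
  have "((\<lambda>x. f (a * x + b)) has_real_derivative f' (a * x + b) * a) (at x)" for x
  proof -
    have "((\<lambda>x. a * x + b) has_real_derivative a) (at x)" by (auto intro!: derivative_eq_intros)
    from DERIV_chain2[OF f(1)[rule_format] this] show ?thesis .
  qed
  then show ?case using ck_real_mult[OF Suc.IH[OF f(2)] ck_real_const] by (rule ck_real_SucI)
qed

text \<open>
  The powers of \<open>t\<close> close the family under differentiation; only \<open>n = 0\<close> occurs in the
  bumps.
\<close>

definition exp_recip :: "nat \<Rightarrow> real \<Rightarrow> real" where
  "exp_recip n t = (if t > 0 then exp (- 1 / t) / t ^ n else 0)"

lemma exp_recip_tendsto_0: "(exp_recip n \<longlongrightarrow> 0) (at 0)"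
proof -
  have "((\<lambda>t::real. (inverse t) ^ n / exp (inverse t)) \<longlongrightarrow> 0) (at_right 0)"
    by (rule filterlim_compose[OF tendsto_power_div_exp_0 filterlim_inverse_at_top_right])
  then have r: "(exp_recip n \<longlongrightarrow> 0) (at_right 0)"
  proof (rule Lim_transform_eventually)
    show "\<forall>\<^sub>F t in at_right 0. inverse t ^ n / exp (inverse t) = exp_recip n t"
      using eventually_at_right_less[of "0::real"]
      by eventually_elim (simp add: exp_recip_def exp_minus power_inverse inverse_eq_divide field_simps)
  qed
  have "((\<lambda>t. 0) \<longlongrightarrow> 0) (at_left (0::real))" by simp
  then have l: "(exp_recip n \<longlongrightarrow> 0) (at_left 0)"
  proof (rule Lim_transform_eventually)
    show "\<forall>\<^sub>F t in at_left 0. 0 = exp_recip n t"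
      unfolding eventually_at by (intro exI[of _ 1]) (simp add: exp_recip_def)
  qed
  show ?thesis using l r by (simp add: filterlim_split_at)
qed

lemma exp_recip_derivative:
  "(exp_recip n has_real_derivative (- real n * exp_recip (Suc n) x + exp_recip (Suc (Suc n)) x)) (at x)"
proof -
  consider "x > 0" | "x = 0" | "x < 0" by linarith
  then show ?thesis
  proof cases
    case 1
    have "((\<lambda>t. exp (- 1 / t) / t ^ n) has_real_derivative
       (exp (-1/x) * (1 / x^2) * x ^ n - exp (-1/x) * (real n * x ^ (n - 1))) / (x ^ n * x ^ n)) (at x)"
      using 1 by (auto intro!: derivative_eq_intros simp: power2_eq_square)
    also have "(exp (-1/x) * (1 / x^2) * x ^ n - exp (-1/x) * (real n * x ^ (n - 1))) / (x ^ n * x ^ n) =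
       - real n * exp_recip (Suc n) x + exp_recip (Suc (Suc n)) x"
      using 1 by (cases n) (simp_all add: exp_recip_def field_simps power2_eq_square)
    finally show ?thesis
      by (rule has_field_derivative_transform_within_open[of _ _ _ "{0<..}"]) (use 1 in \<open>auto simp: exp_recip_def\<close>)
  next
    case 2
    have "((\<lambda>t. (exp_recip n t - exp_recip n 0) / (t - 0)) \<longlongrightarrow> 0) (at 0)"
      using exp_recip_tendsto_0[of "Suc n"]
    proof (rule Lim_transform_eventually)
      show "\<forall>\<^sub>F t in at 0. exp_recip (Suc n) t = (exp_recip n t - exp_recip n 0) / (t - 0)"
        by (intro always_eventually) (simp add: exp_recip_def)
    qed
    then have "(exp_recip n has_real_derivative 0) (at 0)" by (simp add: has_field_derivative_iff)
    then show ?thesis using 2 by (simp add: exp_recip_def)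
  next
    case 3
    have "((\<lambda>t. 0) has_real_derivative 0) (at x)" by simp
    then have "(exp_recip n has_real_derivative 0) (at x)"
      by (rule has_field_derivative_transform_within_open[of _ _ _ "{..<0}"]) (use 3 in \<open>auto simp: exp_recip_def\<close>)
    then show ?thesis using 3 by (simp add: exp_recip_def)
  qed
qed

lemma ck_real_exp_recip: "ck_real k (exp_recip n)"
proof (induction k arbitrary: n)
  case 0
  show ?case unfolding ck_real.simps by (rule DERIV_continuous_on[OF exp_recip_derivative])
next
  case (Suc k)
  show ?case
    by (rule ck_real_SucI[OF exp_recip_derivative ck_real_add[OF ck_real_mult[OF ck_real_const Suc] Suc]])
qed

text \<open>
  A smooth function that is positive exactly on \<open>(a, b)\<close> and converges to the indicator of
  this interval as \<open>m\<close> tends to infinity. The arguments have the form to which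
  \<open>ck_real_affine\<close> applies.
\<close>

definition bump :: "nat \<Rightarrow> real \<Rightarrow> real \<Rightarrow> real \<Rightarrow> real" where
  "bump m a b t = exp_recip 0 (real (Suc m) * t + (- real (Suc m) * a)) * exp_recip 0 (- real (Suc m) * t + real (Suc m) * b)"

lemma bump_ck: "ck_real k (bump m a b)"
  unfolding bump_def by (intro ck_real_mult ck_real_affine ck_real_exp_recip)

lemma bump_alt: "bump m a b t = exp_recip 0 (real (Suc m) * (t - a)) * exp_recip 0 (real (Suc m) * (b - t))"
  unfolding bump_def by (intro arg_cong2[where f="(*)"] arg_cong[where f="exp_recip 0"]) (simp_all add: algebra_simps)

lemma bump_range: "0 \<le> bump m a b t" "bump m a b t \<le> 1"
proof -
  have e: "0 \<le> exp_recip 0 s" "exp_recip 0 s \<le> 1" for s by (auto simp: exp_recip_def)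
  show "0 \<le> bump m a b t" unfolding bump_def by (intro mult_nonneg_nonneg e)
  show "bump m a b t \<le> 1" unfolding bump_def by (intro mult_le_one e)
qed

lemma bump_outside: "\<not> (a < t \<and> t < b) \<Longrightarrow> bump m a b t = 0"
  unfolding bump_alt by (auto simp: exp_recip_def zero_less_mult_iff)

lemma exp_recip_0_tendsto_1: "s > 0 \<Longrightarrow> (\<lambda>m. exp_recip 0 (real (Suc m) * s)) \<longlonglongrightarrow> 1"
proof -
  assume s: "s > 0"
  have "(\<lambda>m. exp (- (1/s) * inverse (real (Suc m)))) \<longlonglongrightarrow> exp (- (1/s) * 0)"
    by (intro tendsto_intros LIMSEQ_inverse_real_of_nat)
  moreover have "exp (- (1/s) * inverse (real (Suc m))) = exp_recip 0 (real (Suc m) * s)" for m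
  proof -
    have p: "real (Suc m) * s > 0" using s by simp
    have "- (1/s) * inverse (real (Suc m)) = - 1 / (real (Suc m) * s)" by (simp add: inverse_eq_divide)
    then show ?thesis using p by (simp only: exp_recip_def if_True power_0 div_by_1)
  qed
  ultimately show ?thesis by simp
qed

lemma bump_tendsto: "(\<lambda>m. bump m a b t) \<longlonglongrightarrow> (if a < t \<and> t < b then 1 else 0)"
proof (cases "a < t \<and> t < b")
  case True
  have "(\<lambda>m. exp_recip 0 (real (Suc m) * (t - a)) * exp_recip 0 (real (Suc m) * (b - t))) \<longlonglongrightarrow> 1 * 1"
    using True by (intro tendsto_mult exp_recip_0_tendsto_1) auto
  then show ?thesis using True by (simp add: bump_alt)
next
  case False
  then show ?thesis unfolding bump_outside[OF False] if_not_P[OF False] by simp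
qed

lemma partial_prod:
  fixes f f' :: "'n::finite \<Rightarrow> real \<Rightarrow> real"
  assumes "\<And>i x. (f i has_real_derivative f' i x) (at x)"
  shows "partial j (\<lambda>x::real^'n. \<Prod>i\<in>UNIV. f i (x $ i)) = (\<lambda>x. \<Prod>i\<in>UNIV. (if i = j then f' i else f i) (x $ i))"
proof
  fix x :: "real^'n"
  let ?P = "\<Prod>i\<in>UNIV - {j}. f i (x $ i)"
  have eq: "(\<Prod>i\<in>UNIV. f i ((x + t *\<^sub>R axis j 1) $ i)) = f j (x $ j + t) * ?P" for t
  proof -
    have "(\<Prod>i\<in>UNIV. f i ((x + t *\<^sub>R axis j 1) $ i)) =
       f j ((x + t *\<^sub>R axis j 1) $ j) * (\<Prod>i\<in>UNIV - {j}. f i ((x + t *\<^sub>R axis j 1) $ i))"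
      by (rule prod.remove) auto
    also have "(\<Prod>i\<in>UNIV - {j}. f i ((x + t *\<^sub>R axis j 1) $ i)) = ?P"
      by (intro prod.cong refl) (auto simp: axis_def)
    finally show ?thesis by (simp add: axis_def)
  qed
  have "((\<lambda>t. f j (x $ j + t)) has_real_derivative f' j (x $ j + 0) * 1) (at 0)"
    by (rule DERIV_chain2[OF assms]) (auto intro!: derivative_eq_intros)
  then have "((\<lambda>t. f j (x $ j + t) * ?P) has_real_derivative (f' j (x $ j) * ?P)) (at 0)"
    by (intro DERIV_cmult_right) simp
  then have "partial j (\<lambda>x. \<Prod>i\<in>UNIV. f i (x $ i)) x = f' j (x $ j) * ?P"
    unfolding partial_def eq by (rule DERIV_imp_deriv)
  also have "\<dots> = (\<Prod>i\<in>UNIV. (if i = j then f' i else f i) (x $ i))"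
    by (subst prod.remove[of _ j]) (auto intro!: prod.cong)
  finally show "partial j (\<lambda>x. \<Prod>i\<in>UNIV. f i (x $ i)) x = (\<Prod>i\<in>UNIV. (if i = j then f' i else f i) (x $ i))" .
qed

lemma Ck_on_prod:
  fixes f :: "'n::finite \<Rightarrow> real \<Rightarrow> real"
  assumes "\<And>i. ck_real k (f i)"
  shows "Ck_on k UNIV (\<lambda>x::real^'n. \<Prod>i\<in>UNIV. f i (x $ i))"
  using assms
proof (induction k arbitrary: f)
  case 0
  have "continuous_on UNIV (\<lambda>x::real^'n. f i (x $ i))" for i
    by (rule continuous_on_compose2[of UNIV "f i"]) (use 0[of i] in \<open>auto intro: continuous_intros\<close>)
  then show ?case by (auto intro!: continuous_on_prod)
next
  case (Suc k)
  have "\<forall>i. \<exists>f'. (\<forall>x. (f i has_real_derivative f' x) (at x)) \<and> ck_real k f'" using Suc.prems by simp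
  then obtain f' where f': "\<forall>i. (\<forall>x. (f i has_real_derivative f' i x) (at x)) \<and> ck_real k (f' i)"
    by (rule choice[THEN exE])
  have p: "partial j (\<lambda>x. \<Prod>i\<in>UNIV. f i (x $ i)) = (\<lambda>x::real^'n. \<Prod>i\<in>UNIV. (if i = j then f' i else f i) (x $ i))" for j
    using f' by (intro partial_prod) simp
  have "(\<lambda>x::real^'n. \<Prod>i\<in>UNIV. f i (x $ i)) differentiable (at x)" for x
  proof -
    have "((\<lambda>x::real^'n. f i (x $ i)) has_derivative (\<lambda>h. f' i (x $ i) * h $ i)) (at x)" for i
    proof -
      have 1: "((\<lambda>x::real^'n. x $ i) has_derivative (\<lambda>h. h $ i)) (at x)"
        by (rule bounded_linear_imp_has_derivative[OF bounded_linear_vec_nth])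
      have 2: "(f i has_derivative (*) (f' i (x $ i))) (at (x $ i))"
        using f' by (simp add: has_field_derivative_def)
      show ?thesis by (rule has_derivative_compose[OF 1 2])
    qed
    then have "((\<lambda>x::real^'n. \<Prod>i\<in>UNIV. f i (x $ i)) has_derivative
      (\<lambda>h. \<Sum>i\<in>UNIV. (f' i (x $ i) * h $ i) * (\<Prod>j\<in>UNIV - {i}. f j (x $ j)))) (at x)"
      by (rule has_derivative_prod)
    then show ?thesis unfolding differentiable_def by blast
  qed
  moreover have "Ck_on k UNIV (partial j (\<lambda>x::real^'n. \<Prod>i\<in>UNIV. f i (x $ i)))" for j
    unfolding p
  proof (rule Suc.IH)
    show "ck_real k (if i = j then f' i else f i)" for i
      using f' ck_real_Suc_imp[OF Suc.prems[of i]] by simp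
  qed
  ultimately show ?case by simp
qed

definition box_bump :: "nat \<Rightarrow> real^'n \<Rightarrow> real^'n \<Rightarrow> real^'n \<Rightarrow> real" where
  "box_bump m p q x = (\<Prod>i\<in>UNIV. bump m (p $ i) (q $ i) (x $ i))"

lemma box_bump_outside: "x \<notin> box p q \<Longrightarrow> box_bump m p q x = 0"
  unfolding box_bump_def mem_box_cart by (auto intro!: prod_zero bump_outside)

lemma box_bump_range: "\<bar>box_bump m p q x\<bar> \<le> 1"
  unfolding box_bump_def abs_prod by (intro prod_le_1) (auto simp: bump_range)

lemma box_bump_tendsto: "(\<lambda>m. box_bump m p q x) \<longlonglongrightarrow> indicator (box p q) x"
proof -
  have "(\<lambda>m. box_bump m p q x) \<longlonglongrightarrow> (\<Prod>i\<in>UNIV. (if p $ i < x $ i \<and> x $ i < q $ i then 1 else 0))"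
    unfolding box_bump_def by (intro tendsto_prod bump_tendsto)
  also have "(\<Prod>i\<in>UNIV. (if p $ i < x $ i \<and> x $ i < q $ i then 1 else 0)) = (indicator (box p q) x :: real)"
    by (cases "x \<in> box p q") (auto simp: mem_box_cart intro!: prod.neutral prod_zero)
  finally show ?thesis .
qed

lemma box_bump_test_function:
  assumes "cbox p q \<subseteq> \<Omega>"
  shows "test_function \<Omega> (box_bump m p q)"
proof -
  have sub: "{x. box_bump m p q x \<noteq> 0} \<subseteq> cbox p q"
    using box_bump_outside[of _ p q m] box_subset_cbox[of p q] by blast
  then have "closure {x. box_bump m p q x \<noteq> 0} \<subseteq> cbox p q" by (intro closure_minimal) auto
  moreover from this have "compact (closure {x. box_bump m p q x \<noteq> 0})"
    by (meson bounded_cbox bounded_subset closed_closure compact_eq_bounded_closed)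
  moreover have "Ck_on k UNIV (box_bump m p q)" for k
    unfolding box_bump_def by (intro Ck_on_prod bump_ck)
  ultimately show ?thesis using assms unfolding test_function_def by auto
qed

text \<open>
  Lebesgue differentiation with cubes that have \<open>x\<close> as a corner;
  \<open>integrable_ccontinuous_explicit\<close> as an existential statement.
\<close>

lemma AE_corner_differentiation:
  fixes f :: "'a::euclidean_space \<Rightarrow> real"
  assumes "\<And>a b. f integrable_on cbox a b"
  shows "\<exists>N. negligible N \<and> (\<forall>x \<epsilon>. x \<notin> N \<and> 0 < \<epsilon> \<longrightarrow>
     (\<exists>\<delta>>0. \<forall>h. 0 < h \<and> h < \<delta> \<longrightarrow> norm(integral (cbox x (x + h *\<^sub>R One)) f /\<^sub>R h ^ DIM('a) - f x) < \<epsilon>))"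
proof (rule integrable_ccontinuous_explicit[OF assms])
  fix N :: "'a set"
  assume N: "negligible N" "\<And>x e. x \<notin> N \<Longrightarrow> 0 < e \<Longrightarrow>
     \<exists>\<delta>>0. \<forall>h. 0 < h \<and> h < \<delta> \<longrightarrow> norm(integral (cbox x (x + h *\<^sub>R One)) f /\<^sub>R h ^ DIM('a) - f x) < e"
  show ?thesis by (intro exI[of _ N] conjI allI impI N; elim conjE)
qed

text \<open>Lebesgue differentiation within each of countably many boxes that exhaust \<open>\<Omega>\<close>.\<close>

lemma integral_boxes_zero_imp_AE_zero:
  fixes d :: "real^'n \<Rightarrow> real"
  assumes \<Omega>: "open \<Omega>" and int: "\<And>K. compact K \<Longrightarrow> K \<subseteq> \<Omega> \<Longrightarrow> set_integrable lebesgue K d"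
    and zero: "\<And>p q. cbox p q \<subseteq> \<Omega> \<Longrightarrow> integral (cbox p q) d = 0"
  shows "AE x in lebesgue. x \<in> \<Omega> \<longrightarrow> d x = 0"
proof -
  have box: "negligible {x \<in> cbox c e. d x \<noteq> 0}" if ce: "cbox c e \<subseteq> \<Omega>" for c e
  proof -
    define D where "D x = (if x \<in> cbox c e then d x else 0)" for x
    have "d integrable_on cbox c e" using set_lebesgue_integral_eq_integral(1)[OF int[OF compact_cbox ce]] .
    then have "D integrable_on UNIV" unfolding D_def by (simp add: integrable_restrict_UNIV)
    then have Dint: "D integrable_on cbox a b" for a b by (rule integrable_on_subcbox) simp
    obtain N where N: "negligible N" and N2: "\<forall>x \<epsilon>. x \<notin> N \<and> 0 < \<epsilon> \<longrightarrow>
               (\<exists>\<delta>>0. \<forall>h. 0 < h \<and> h < \<delta> \<longrightarrow> norm(integral (cbox x (x + h *\<^sub>R One)) D /\<^sub>R h ^ DIM(real^'n) - D x) < \<epsilon>)"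
      using AE_corner_differentiation[OF Dint] by (elim exE conjE)
    have "D x = 0" if x: "x \<in> box c e" "x \<notin> N" for x
    proof (rule ccontr)
      assume "D x \<noteq> 0"
      then have "0 < norm (D x)" by simp
      from N2[rule_format, OF conjI[OF x(2) this]] obtain \<delta> where \<delta>: "\<delta> > 0"
        "\<forall>h. 0 < h \<and> h < \<delta> \<longrightarrow> norm(integral (cbox x (x + h *\<^sub>R One)) D /\<^sub>R h ^ DIM(real^'n) - D x) < norm (D x)"
        by (elim exE conjE)
      obtain r where r: "r > 0" "ball x r \<subseteq> box c e" by (rule openE[OF open_box x(1)])
      define h where "h = min (\<delta>/2) (r / (2 * (norm (One::real^'n) + 1)))"
      have np: "norm (One::real^'n) + 1 > 0" by (simp add: add_nonneg_pos)
      have h: "0 < h" "h < \<delta>" using \<delta>(1) r(1) np by (auto simp: h_def)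
      have "h * norm (One::real^'n) < r"
      proof -
        have "h * norm (One::real^'n) \<le> (r / (2 * (norm (One::real^'n) + 1))) * (norm (One::real^'n) + 1)"
          using h r np by (intro mult_mono) (auto simp: h_def)
        also have "\<dots> = r/2" using np by (simp add: field_simps)
        finally show ?thesis using r by simp
      qed
      then have "x + h *\<^sub>R One \<in> box c e" using r(2) h by (auto simp: dist_norm subset_iff)
      then have sub: "cbox x (x + h *\<^sub>R One) \<subseteq> cbox c e"
        using x(1) by (auto simp: mem_box) (meson less_imp_le order_trans)+
      have "integral (cbox x (x + h *\<^sub>R One)) D = integral (cbox x (x + h *\<^sub>R One)) d"
        using sub by (intro integral_cong) (auto simp: D_def)
      also have "\<dots> = 0" by (rule zero) (use sub ce in blast)
      finally have "norm (D x) < norm (D x)" using \<delta>(2)[rule_format, of h] h by simp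
      then show False by simp
    qed
    then have "{x \<in> cbox c e. d x \<noteq> 0} \<subseteq> N \<union> (cbox c e - box c e)"
      using box_subset_cbox[of c e] by (auto simp: D_def subset_iff)
    moreover have "negligible (N \<union> (cbox c e - box c e))" using N by (simp add: negligible_frontier_interval)
    ultimately show ?thesis by (rule negligible_subset[rotated])
  qed
  have "\<exists>\<D>. countable \<D> \<and> \<D> \<subseteq> Pow \<Omega> \<and> (\<forall>X\<in>\<D>. \<exists>a b. X = cbox a b) \<and> \<Union>\<D> = \<Omega>"
  proof (rule open_countable_Union_open_cbox[OF \<Omega>])
    fix \<D> assume D: "countable \<D>" "\<D> \<subseteq> Pow \<Omega>" "\<And>X. X \<in> \<D> \<Longrightarrow> \<exists>a b. X = cbox a b" "\<Union>\<D> = \<Omega>"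
    show ?thesis by (intro exI[of _ \<D>] conjI ballI D)
  qed
  then obtain \<D> where \<D>: "countable \<D>" "\<D> \<subseteq> Pow \<Omega>" "\<forall>X\<in>\<D>. \<exists>a b. X = cbox a b" "\<Union>\<D> = \<Omega>"
    by (elim exE conjE)
  have "{x \<in> \<Omega>. d x \<noteq> 0} = (\<Union>X\<in>\<D>. {x \<in> X. d x \<noteq> 0})" using \<D>(4) by auto
  moreover have "negligible (\<Union>((\<lambda>X. {x \<in> X. d x \<noteq> 0}) ` \<D>))"
  proof (rule negligible_countable_Union)
    show "countable ((\<lambda>X. {x \<in> X. d x \<noteq> 0}) ` \<D>)" using \<D>(1) by simp
    fix S assume "S \<in> (\<lambda>X. {x \<in> X. d x \<noteq> 0}) ` \<D>"
    then obtain X where X: "X \<in> \<D>" "S = {x \<in> X. d x \<noteq> 0}" by blast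
    obtain a b where ab: "X = cbox a b" using bspec[OF \<D>(3) X(1)] by blast
    have "cbox a b \<subseteq> \<Omega>" using \<D>(2) X(1) ab by blast
    from box[OF this] show "negligible S" using X ab by simp
  qed
  ultimately have "negligible {x \<in> \<Omega>. d x \<noteq> 0}" by simp
  then have "{x \<in> \<Omega>. d x \<noteq> 0} \<in> null_sets lebesgue" by (simp add: negligible_iff_null_sets)
  then have "AE x in lebesgue. x \<notin> {x \<in> \<Omega>. d x \<noteq> 0}" by (rule AE_not_in)
  then show ?thesis by eventually_elim simp
qed

text \<open>
  Testing with bumps that converge boundedly to the indicator of a box shows that \<open>g\<close> and
  \<open>g'\<close> have the same integral over every box in \<open>\<Omega>\<close>.
\<close>

lemma weak_partial_unique:
  fixes u :: "real^'n \<Rightarrow> real"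
  assumes \<Omega>: "open \<Omega>" and g: "has_weak_partial \<Omega> u i g" and g': "has_weak_partial \<Omega> u i g'"
  shows "AE x in lebesgue. x \<in> \<Omega> \<longrightarrow> g x = g' x"
proof -
  have li: "set_integrable lebesgue K g" "set_integrable lebesgue K g'" if "compact K" "K \<subseteq> \<Omega>" for K
    using g g' that unfolding has_weak_partial_def locally_integrable_def by simp_all
  have lid: "set_integrable lebesgue K (\<lambda>x. g x - g' x)" if "compact K" "K \<subseteq> \<Omega>" for K
    by (rule set_integral_diff(1)[OF li[OF that]])
  have "integral (cbox p q) (\<lambda>x. g x - g' x) = 0" if pq: "cbox p q \<subseteq> \<Omega>" for p q
  proof -
    note K = compact_cbox[of p q] pq
    define G where "G x = indicator (cbox p q) x * (g x - g' x)" for x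
    have G: "integrable lebesgue G" using lid[OF K] unfolding set_integrable_def G_def by simp
    have bm: "box_bump m p q \<in> borel_measurable lebesgue" for m
    proof -
      have "Ck_on 0 UNIV (box_bump m p q)" using box_bump_test_function[OF pq, of m] unfolding test_function_def by blast
      then have "box_bump m p q \<in> borel_measurable borel" by (simp add: borel_measurable_continuous_onI)
      then show ?thesis by (simp add: measurable_completion)
    qed
    have step: "(\<integral>x. G x * box_bump m p q x \<partial>lebesgue) = 0" for m
    proof -
      have t: "test_function \<Omega> (box_bump m p q)" by (rule box_bump_test_function[OF pq])
      have eq: "indicator \<Omega> x *\<^sub>R (f x * box_bump m p q x) = indicator (cbox p q) x *\<^sub>R f x * box_bump m p q x" for f :: "_ \<Rightarrow> real" and x
      proof (cases "x \<in> box p q")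
        case True
        then have "x \<in> cbox p q" "x \<in> \<Omega>" using box_subset_cbox pq by blast+
        then show ?thesis by simp
      qed (simp add: box_bump_outside)
      have int: "integrable lebesgue (\<lambda>x. indicator (cbox p q) x *\<^sub>R f x * box_bump m p q x)"
        if "set_integrable lebesgue (cbox p q) f" for f :: "_ \<Rightarrow> real"
      proof (rule Bochner_Integration.integrable_bound)
        show f: "integrable lebesgue (\<lambda>x. indicator (cbox p q) x *\<^sub>R f x)" using that by (simp add: set_integrable_def)
        show "(\<lambda>x. indicator (cbox p q) x *\<^sub>R f x * box_bump m p q x) \<in> borel_measurable lebesgue"
          by (rule borel_measurable_times[OF borel_measurable_integrable[OF f] bm])
        have "\<bar>indicator (cbox p q) x *\<^sub>R f x\<bar> * \<bar>box_bump m p q x\<bar> \<le> \<bar>indicator (cbox p q) x *\<^sub>R f x\<bar> * 1" for x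
          by (rule mult_left_mono[OF box_bump_range]) simp
        then show "AE x in lebesgue. norm (indicator (cbox p q) x *\<^sub>R f x * box_bump m p q x) \<le> norm (indicator (cbox p q) x *\<^sub>R f x)"
          by (simp add: abs_mult)
      qed
      have "(\<integral>x\<in>\<Omega>. g x * box_bump m p q x \<partial>lebesgue) = (\<integral>x\<in>\<Omega>. g' x * box_bump m p q x \<partial>lebesgue)"
        using g g' t unfolding has_weak_partial_def by (metis neg_equal_iff_equal)
      then have "(\<integral>x. indicator (cbox p q) x *\<^sub>R g x * box_bump m p q x \<partial>lebesgue) =
                 (\<integral>x. indicator (cbox p q) x *\<^sub>R g' x * box_bump m p q x \<partial>lebesgue)"
        unfolding set_lebesgue_integral_def eq .
      then have "(\<integral>x. indicator (cbox p q) x *\<^sub>R g x * box_bump m p q x - indicator (cbox p q) x *\<^sub>R g' x * box_bump m p q x \<partial>lebesgue) = 0"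
        by (subst Bochner_Integration.integral_diff[OF int[OF li(1)[OF K]] int[OF li(2)[OF K]]]) simp
      then show ?thesis unfolding G_def by (simp add: algebra_simps)
    qed
    have lim: "(\<lambda>m. \<integral>x. G x * box_bump m p q x \<partial>lebesgue) \<longlonglongrightarrow> (\<integral>x. G x * indicator (box p q) x \<partial>lebesgue)"
    proof (rule integral_dominated_convergence)
      show "integrable lebesgue (\<lambda>x. \<bar>G x\<bar>)" using G by simp
      show "(\<lambda>x. G x * box_bump m p q x) \<in> borel_measurable lebesgue" for m
        by (rule borel_measurable_times[OF borel_measurable_integrable[OF G] bm])
      show "(\<lambda>x. G x * indicator (box p q) x) \<in> borel_measurable lebesgue"
        by (rule borel_measurable_times[OF borel_measurable_integrable[OF G] borel_measurable_indicator]) simp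
      show "AE x in lebesgue. (\<lambda>m. G x * box_bump m p q x) \<longlonglongrightarrow> G x * indicator (box p q) x"
        by (intro AE_I2 tendsto_mult tendsto_const box_bump_tendsto)
      show "AE x in lebesgue. norm (G x * box_bump m p q x) \<le> \<bar>G x\<bar>" for m
      proof (intro AE_I2)
        fix x
        have "\<bar>G x\<bar> * \<bar>box_bump m p q x\<bar> \<le> \<bar>G x\<bar> * 1" by (rule mult_left_mono[OF box_bump_range]) simp
        then show "norm (G x * box_bump m p q x) \<le> \<bar>G x\<bar>" by (simp add: abs_mult)
      qed
    qed
    then have "(\<integral>x. G x * indicator (box p q) x \<partial>lebesgue) = 0"
      unfolding step using LIMSEQ_unique[OF _ tendsto_const] by metis
    moreover have "(\<integral>x. G x * indicator (box p q) x \<partial>lebesgue) = (\<integral>x. G x \<partial>lebesgue)"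
    proof (rule integral_cong_AE)
      show "(\<lambda>x. G x * indicator (box p q) x) \<in> borel_measurable lebesgue"
        by (rule borel_measurable_times[OF borel_measurable_integrable[OF G] borel_measurable_indicator]) simp
      show "G \<in> borel_measurable lebesgue" by (rule borel_measurable_integrable[OF G])
      have "negligible (cbox p q - box p q)" by (rule negligible_frontier_interval)
      then have "AE x in lebesgue. x \<notin> cbox p q - box p q" by (intro AE_not_in) (simp add: negligible_iff_null_sets)
      then show "AE x in lebesgue. G x * indicator (box p q) x = G x"
        by eventually_elim (auto simp: G_def indicator_def)
    qed
    moreover have "(\<integral>x. G x \<partial>lebesgue) = integral (cbox p q) (\<lambda>x. g x - g' x)"
      using set_lebesgue_integral_eq_integral(2)[OF lid[OF K]] unfolding set_lebesgue_integral_def G_def by simp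
    ultimately show ?thesis by simp
  qed
  from integral_boxes_zero_imp_AE_zero[OF \<Omega> lid this] have "AE x in lebesgue. x \<in> \<Omega> \<longrightarrow> g x - g' x = 0" .
  then show ?thesis by eventually_elim simp
qed

section \<open>From absolute continuity on lines to weak derivatives\<close>

lemma has_derivative_classical_grad:
  fixes f :: "real^'n \<Rightarrow> real"
  assumes "f differentiable (at y)"
  shows "(f has_derivative (\<lambda>h. classical_grad f y \<bullet> h)) (at y)"
proof -
  obtain f' where f': "(f has_derivative f') (at y)" using assms unfolding differentiable_def by blast
  interpret bounded_linear f' by (rule has_derivative_bounded_linear[OF f'])
  have part: "partial i f y = f' (axis i 1)" for i
  proof -
    have "((\<lambda>t. y + t *\<^sub>R axis i 1) has_derivative (\<lambda>t. t *\<^sub>R axis i 1)) (at 0)"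
      by (auto intro!: derivative_eq_intros)
    moreover have "(f has_derivative f') (at (y + 0 *\<^sub>R axis i 1))" using f' by simp
    ultimately have "((\<lambda>t. f (y + t *\<^sub>R axis i 1)) has_derivative (\<lambda>t. f' (t *\<^sub>R axis i 1))) (at 0)"
      by (rule has_derivative_compose)
    then have "((\<lambda>t. f (y + t *\<^sub>R axis i 1)) has_real_derivative f' (axis i 1)) (at 0)"
      unfolding has_field_derivative_def by (simp add: scaleR mult_commute_abs)
    then show ?thesis unfolding partial_def by (rule DERIV_imp_deriv)
  qed
  have "f' h = classical_grad f y \<bullet> h" for h
  proof -
    have "h = (\<Sum>i\<in>UNIV. (h $ i) *\<^sub>R axis i 1)"
      by (simp add: vec_eq_iff axis_def if_distrib[where f="\<lambda>x. _ * x"] sum.delta cong: if_cong)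
    then have "f' h = f' (\<Sum>i\<in>UNIV. (h $ i) *\<^sub>R axis i 1)" by simp
    also have "\<dots> = (\<Sum>i\<in>UNIV. (h $ i) * f' (axis i 1))" by (simp add: sum scaleR)
    also have "\<dots> = classical_grad f y \<bullet> h"
      by (simp add: inner_vec_def classical_grad_def part mult.commute)
    finally show ?thesis .
  qed
  then have "f' = (\<lambda>h. classical_grad f y \<bullet> h)" by (rule ext)
  then show ?thesis using f' by simp
qed

lemma partial_on_line:
  fixes f :: "real^'n \<Rightarrow> real"
  assumes "f differentiable (at (x + t *\<^sub>R axis i 1))"
  shows "((\<lambda>s. f (x + s *\<^sub>R axis i 1)) has_real_derivative partial i f (x + t *\<^sub>R axis i 1)) (at t)"
proof -
  let ?y = "x + t *\<^sub>R axis i 1 :: real^'n"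
  have "((\<lambda>s. x + s *\<^sub>R axis i 1) has_derivative (\<lambda>s. s *\<^sub>R axis i 1)) (at t)"
    by (auto intro!: derivative_eq_intros)
  from has_derivative_compose[OF this has_derivative_classical_grad[OF assms]]
  have "((\<lambda>s. f (x + s *\<^sub>R axis i 1)) has_derivative (\<lambda>s. classical_grad f ?y \<bullet> (s *\<^sub>R axis i 1))) (at t)" .
  moreover have "(\<lambda>s. classical_grad f ?y \<bullet> (s *\<^sub>R axis i 1)) = (*) (partial i f ?y)"
    by (rule ext) (simp add: inner_axis classical_grad_def)
  ultimately show ?thesis unfolding has_field_derivative_def by simp
qed

lemma AC_if_Lipschitz:
  fixes f :: "real \<Rightarrow> real"
  assumes "\<And>x y. x \<in> {a..b} \<Longrightarrow> y \<in> {a..b} \<Longrightarrow> \<bar>f y - f x\<bar> \<le> L * \<bar>y - x\<bar>" "0 \<le> L"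
  shows "abs_continuous_on_interval a b f"
proof -
  have c: "abs_continuous_on_interval a b (\<lambda>x. 1)"
    unfolding abs_continuous_on_interval_def by (auto intro: exI[of _ 1])
  have fb: "\<bar>f x\<bar> \<le> \<bar>f a\<bar> + L * (b - a)" if "x \<in> {a..b}" for x
  proof -
    have "\<bar>f x - f a\<bar> \<le> L * \<bar>x - a\<bar>" using that by (intro assms(1)) auto
    also have "\<dots> \<le> L * (b - a)" using that assms(2) by (intro mult_left_mono) auto
    finally show ?thesis by linarith
  qed
  have "abs_continuous_on_interval a b (\<lambda>x. 1 * f x)"
  proof (cases "a \<le> b")
    case True
    then have "0 \<le> \<bar>f a\<bar> + L * (b - a)" using assms(2) by simp
    from AC_mult_Lipschitz[OF c _ fb assms(1) zero_le_one this assms(2)] show ?thesis by simp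
  next
    case False
    then show ?thesis by (intro AC_mult_Lipschitz[OF c, of 1 f 0 0]) auto
  qed
  then show ?thesis by simp
qed

lemma test_function_bounds:
  fixes \<psi> :: "real^'n \<Rightarrow> real"
  assumes "test_function \<Omega> \<psi>"
  shows "\<exists>K B. compact K \<and> K \<subseteq> \<Omega> \<and> (\<forall>x. x \<notin> K \<longrightarrow> \<psi> x = 0 \<and> partial i \<psi> x = 0) \<and>
    0 \<le> B \<and> (\<forall>x. \<bar>\<psi> x\<bar> \<le> B) \<and> (\<forall>x. \<bar>partial i \<psi> x\<bar> \<le> B) \<and> continuous_on UNIV \<psi> \<and>
    continuous_on UNIV (partial i \<psi>) \<and> (\<forall>x. \<psi> differentiable (at x))"
proof -
  define K where "K = closure {x. \<psi> x \<noteq> 0}"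
  have K: "compact K" "K \<subseteq> \<Omega>" using assms unfolding test_function_def K_def by blast+
  have "Ck_on (Suc 0) UNIV \<psi>" "Ck_on 0 UNIV \<psi>" using assms unfolding test_function_def by blast+
  then have c: "continuous_on UNIV \<psi>" "continuous_on UNIV (partial i \<psi>)" and d: "\<And>x. \<psi> differentiable (at x)" by simp_all
  have z: "\<psi> x = 0" if "x \<notin> K" for x using that closure_subset[of "{x. \<psi> x \<noteq> 0}"] unfolding K_def by blast
  have pz: "partial i \<psi> x = 0" if x: "x \<notin> K" for x
  proof -
    have "open (- K)" using K(1) by (simp add: compact_imp_closed open_Compl)
    have "((\<lambda>t. 0) has_real_derivative 0) (at (0::real))" by simp
    then have "((\<lambda>t. \<psi> (x + t *\<^sub>R axis i 1)) has_real_derivative 0) (at 0)"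
    proof (rule has_field_derivative_transform_within_open[of _ _ _ "(\<lambda>t. x + t *\<^sub>R axis i 1) -` (- K)"])
      show "open ((\<lambda>t::real. x + t *\<^sub>R axis i 1) -` (- K))"
        by (rule open_vimage[OF \<open>open (- K)\<close>]) (intro continuous_intros)
      show "0 \<in> (\<lambda>t::real. x + t *\<^sub>R axis i 1) -` (- K)" using x by simp
      show "0 = \<psi> (x + t *\<^sub>R axis i 1)" if "t \<in> (\<lambda>t::real. x + t *\<^sub>R axis i 1) -` (- K)" for t
        using z that by simp
    qed
    then show ?thesis unfolding partial_def by (rule DERIV_imp_deriv)
  qed
  have bd: "\<exists>B\<ge>0. \<forall>x. \<bar>f x\<bar> \<le> B" if f: "continuous_on UNIV f" "\<And>x. x \<notin> K \<Longrightarrow> f x = 0" for f :: "real^'n \<Rightarrow> real"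
  proof -
    have "compact (f ` K)" by (rule compact_continuous_image[OF continuous_on_subset[OF f(1)] K(1)]) simp
    then have "bounded (f ` K)" by (rule compact_imp_bounded)
    then obtain B where B: "\<forall>y\<in>f ` K. norm y \<le> B" unfolding bounded_iff by blast
    have "\<bar>f x\<bar> \<le> max B 0" for x
    proof (cases "x \<in> K")
      case True
      then have "norm (f x) \<le> B" using B by blast
      then show ?thesis by simp
    qed (simp add: f(2))
    then show ?thesis by (intro exI[of _ "max B 0"]) simp
  qed
  obtain B1 where B1: "B1 \<ge> 0" "\<forall>x. \<bar>\<psi> x\<bar> \<le> B1" using bd[OF c(1) z] by blast
  obtain B2 where B2: "B2 \<ge> 0" "\<forall>x. \<bar>partial i \<psi> x\<bar> \<le> B2" using bd[OF c(2) pz] by blast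
  show ?thesis
  proof (intro exI[of _ K] exI[of _ "max B1 B2"] conjI allI impI)
    show "0 \<le> max B1 B2" using B1 by simp
    show "\<bar>\<psi> x\<bar> \<le> max B1 B2" for x using spec[OF B1(2), of x] by (rule order_trans) simp
    show "\<bar>partial i \<psi> x\<bar> \<le> max B1 B2" for x using spec[OF B2(2), of x] by (rule order_trans) simp
  qed (use K z pz c d in simp_all)
qed

lemma set_integrable_mult_bounded:
  fixes f \<psi> :: "real^'n \<Rightarrow> real"
  assumes f: "set_integrable lebesgue K f" and "K \<subseteq> \<Omega>" and \<psi>: "continuous_on UNIV \<psi>"
    and B: "\<And>x. \<bar>\<psi> x\<bar> \<le> B" and z: "\<And>x. x \<notin> K \<Longrightarrow> \<psi> x = 0"
  shows "set_integrable lebesgue \<Omega> (\<lambda>x. f x * \<psi> x)"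
proof -
  let ?f = "\<lambda>x. indicator K x *\<^sub>R f x"
  have fi: "integrable lebesgue ?f" using f unfolding set_integrable_def .
  have bm: "\<psi> \<in> borel_measurable lebesgue"
    using \<psi> by (intro measurable_completion) (simp add: borel_measurable_continuous_onI)
  have "integrable lebesgue (\<lambda>x. ?f x * \<psi> x)"
  proof (rule Bochner_Integration.integrable_bound)
    show "integrable lebesgue (\<lambda>x. B * ?f x)" using fi by simp
    show "(\<lambda>x. ?f x * \<psi> x) \<in> borel_measurable lebesgue"
      by (rule borel_measurable_times[OF borel_measurable_integrable[OF fi] bm])
    have B0: "0 \<le> B" using B[of 0] by linarith
    have "\<bar>?f x\<bar> * \<bar>\<psi> x\<bar> \<le> \<bar>?f x\<bar> * B" for x by (rule mult_left_mono[OF B]) simp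
    then show "AE x in lebesgue. norm (?f x * \<psi> x) \<le> norm (B * ?f x)"
      using B0 by (simp add: abs_mult mult.commute)
  qed
  moreover have "(\<lambda>x. ?f x * \<psi> x) = (\<lambda>x. indicator \<Omega> x *\<^sub>R (f x * \<psi> x))"
  proof
    fix x show "?f x * \<psi> x = indicator \<Omega> x *\<^sub>R (f x * \<psi> x)"
      using z[of x] assms(2) by (auto simp: indicator_def)
  qed
  ultimately show ?thesis unfolding set_integrable_def by (simp only:)
qed

text \<open>
  The product rule turns the claim into \<open>\<integral> \<partial>\<^sub>i(v \<psi>) = 0\<close>, where \<open>v \<psi>\<close> is extended by zero,
  and \<open>integral_zero_if_lines_FTC\<close> reduces this to the fundamental theorem on unit segments.
  Such a segment may leave \<open>\<Omega>\<close> and return. The fundamental theorem is therefore proved near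
  each of its points, from absolute continuity inside \<open>\<Omega>\<close> and from the vanishing of all
  terms outside the support of \<open>\<psi>\<close>, and then follows for the whole segment by bisection.
\<close>

lemma weak_partial_if_AC_on_lines:
  fixes v g :: "real^'n \<Rightarrow> real"
  assumes \<Omega>: "open \<Omega>" and v: "locally_integrable \<Omega> v" and g: "locally_integrable \<Omega> g"
    and ac: "AE x in lborel. \<forall>a b. a \<le> b \<longrightarrow> (\<forall>t\<in>{a..b}. x + t *\<^sub>R axis i 1 \<in> \<Omega>) \<longrightarrow>
       abs_continuous_on_interval a b (\<lambda>t. v (x + t *\<^sub>R axis i 1))"
    and der: "AE x in lborel. AE t in lborel. x + t *\<^sub>R axis i 1 \<in> \<Omega> \<longrightarrow>
       ((\<lambda>s. v (x + s *\<^sub>R axis i 1)) has_real_derivative g (x + t *\<^sub>R axis i 1)) (at t)"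
  shows "has_weak_partial \<Omega> v i g"
  unfolding has_weak_partial_def
proof (intro conjI v g allI impI)
  fix \<psi> assume \<psi>: "test_function \<Omega> \<psi>"
  obtain K B where K: "compact K" "K \<subseteq> \<Omega>" and zz: "\<forall>x. x \<notin> K \<longrightarrow> \<psi> x = 0 \<and> partial i \<psi> x = 0"
    and B0: "0 \<le> B" and BB: "\<forall>x. \<bar>\<psi> x\<bar> \<le> B" "\<forall>x. \<bar>partial i \<psi> x\<bar> \<le> B"
    and c: "continuous_on UNIV \<psi>" "continuous_on UNIV (partial i \<psi>)" and dd: "\<forall>x. \<psi> differentiable (at x)"
    using test_function_bounds[OF \<psi>, of i] by (elim exE conjE)
  have z: "\<psi> x = 0" and pz: "partial i \<psi> x = 0" if "x \<notin> K" for x using zz that by simp_all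
  note B = B0 BB[rule_format] and d = dd[rule_format]
  have li: "set_integrable lebesgue K v" "set_integrable lebesgue K g"
    using v g K unfolding locally_integrable_def by simp_all
  let ?e = "axis i 1 :: real^'n"
  define w where "w x = indicator \<Omega> x *\<^sub>R (v x * \<psi> x)" for x
  define F where "F x = indicator \<Omega> x *\<^sub>R (v x * partial i \<psi> x) + indicator \<Omega> x *\<^sub>R (g x * \<psi> x)" for x
  note i1 = set_integrable_mult_bounded[OF li(1) K(2) c(1) B(2) z]
  note i2 = set_integrable_mult_bounded[OF li(1) K(2) c(2) B(3) pz]
  note i3 = set_integrable_mult_bounded[OF li(2) K(2) c(1) B(2) z]
  have wint: "integrable lebesgue w" using i1 unfolding set_integrable_def w_def .
  have Fint: "integrable lebesgue F" using i2 i3 unfolding set_integrable_def F_def by simp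
  have "AE x in lborel. ((\<lambda>t. F (x + t *\<^sub>R ?e)) has_integral (w (x + ?e) - w x)) {0..1}"
    using ac der
  proof eventually_elim
    case (elim x)
    obtain N where N: "negligible N" and N2: "\<And>t. t \<notin> N \<Longrightarrow> x + t *\<^sub>R ?e \<in> \<Omega> \<Longrightarrow>
       ((\<lambda>s. v (x + s *\<^sub>R ?e)) has_real_derivative g (x + t *\<^sub>R ?e)) (at t)"
    proof -
      obtain N where N: "{t \<in> space lborel. \<not> (x + t *\<^sub>R ?e \<in> \<Omega> \<longrightarrow>
       ((\<lambda>s. v (x + s *\<^sub>R ?e)) has_real_derivative g (x + t *\<^sub>R ?e)) (at t))} \<subseteq> N" "emeasure lborel N = 0" "N \<in> sets lborel"
        by (rule AE_E[OF elim(2)])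
      have "N \<in> null_sets lborel" using N(2,3) by (simp add: null_sets_def)
      then have "negligible N" by (simp add: negligible_iff_null_sets null_sets_completionI)
      moreover have "((\<lambda>s. v (x + s *\<^sub>R ?e)) has_real_derivative g (x + t *\<^sub>R ?e)) (at t)"
        if "t \<notin> N" "x + t *\<^sub>R ?e \<in> \<Omega>" for t
      proof (rule ccontr)
        assume "\<not> ((\<lambda>s. v (x + s *\<^sub>R ?e)) has_real_derivative g (x + t *\<^sub>R ?e)) (at t)"
        then have "t \<in> N" using that(2) by (intro subsetD[OF N(1)]) simp
        then show False using that(1) by simp
      qed
      ultimately show thesis by (rule that)
    qed
    let ?P = "\<lambda>a b. ((\<lambda>t. F (x + t *\<^sub>R ?e)) has_integral (w (x + b *\<^sub>R ?e) - w (x + a *\<^sub>R ?e))) {a..b}"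
    have "?P 0 1"
    proof (rule Bolzano[of 0 1 ?P])
      show "(0::real) \<le> 1" by simp
      show "?P a c" if "?P a b" "?P b c" "a \<le> b" "b \<le> c" for a b c
        using has_integral_combine[OF that(3,4) that(1,2)] by simp
    next
      fix t :: real assume "0 \<le> t" "t \<le> 1"
      have line: "open ((\<lambda>s::real. x + s *\<^sub>R ?e) -` U)" if "open U" for U
        by (rule open_vimage[OF that]) (intro continuous_intros)
      show "\<exists>\<delta>>0. \<forall>a b. a \<le> t \<and> t \<le> b \<and> b - a < \<delta> \<longrightarrow> ?P a b"
      proof (cases "x + t *\<^sub>R ?e \<in> \<Omega>")
        case True
        then have "t \<in> (\<lambda>s::real. x + s *\<^sub>R ?e) -` \<Omega>" by simp
        then obtain \<delta> where \<delta>: "\<delta> > 0" "ball t \<delta> \<subseteq> (\<lambda>s::real. x + s *\<^sub>R ?e) -` \<Omega>" by (rule openE[OF line[OF \<Omega>]])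
        have P: "?P a b" if ab: "a \<le> t \<and> t \<le> b \<and> b - a < \<delta>" for a b
        proof -
          have le: "a \<le> b" using ab by simp
          have "{a..b} \<subseteq> ball t \<delta>" using ab by (auto simp: dist_real_def)
          then have seg: "\<forall>s\<in>{a..b}. x + s *\<^sub>R ?e \<in> \<Omega>" using \<delta>(2) by blast
          let ?v = "\<lambda>s. v (x + s *\<^sub>R ?e)" and ?p = "\<lambda>s. \<psi> (x + s *\<^sub>R ?e)"
          have acv: "abs_continuous_on_interval a b ?v" using elim(1)[rule_format, OF le seg[rule_format]] by simp
          have "compact (?v ` {a..b})"
            by (rule compact_continuous_image[OF AC_imp_continuous_on[OF acv]]) simp
          then have "bounded (?v ` {a..b})" by (rule compact_imp_bounded)
          then obtain M where M: "\<forall>y\<in>?v ` {a..b}. norm y \<le> M" unfolding bounded_iff by blast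
          have M': "\<bar>?v s\<bar> \<le> M" if "s \<in> {a..b}" for s using M that by force
          have M0: "0 \<le> M" using M'[of a] le by (simp add: order_trans[OF abs_ge_zero])
          have pd: "(?p has_real_derivative partial i \<psi> (x + s *\<^sub>R ?e)) (at s)" for s by (rule partial_on_line[OF d])
          have lip: "\<bar>?p r - ?p s\<bar> \<le> B * \<bar>r - s\<bar>" for r s
            using field_differentiable_bound[of UNIV ?p "\<lambda>s. partial i \<psi> (x + s *\<^sub>R ?e)" B r s] pd B(3) by simp
          have AC: "abs_continuous_on_interval a b (\<lambda>s. ?v s * ?p s)"
            by (rule AC_mult_Lipschitz[OF acv M' B(2) lip M0 B(1) B(1)])
          have "((\<lambda>t. F (x + t *\<^sub>R ?e)) has_integral (?v b * ?p b - ?v a * ?p a)) {a..b}"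
          proof (rule AC_has_integral[OF le AC N])
            fix s assume s: "s \<in> {a..b} - N"
            then have so: "x + s *\<^sub>R ?e \<in> \<Omega>" using seg by blast
            have "((\<lambda>s. ?v s * ?p s) has_real_derivative (g (x + s *\<^sub>R ?e) * ?p s + partial i \<psi> (x + s *\<^sub>R ?e) * ?v s)) (at s)"
              using s by (intro DERIV_mult N2[OF _ so] pd) simp
            moreover have "g (x + s *\<^sub>R ?e) * ?p s + partial i \<psi> (x + s *\<^sub>R ?e) * ?v s = F (x + s *\<^sub>R ?e)"
              using so by (simp add: F_def)
            ultimately have "((\<lambda>s. ?v s * ?p s) has_real_derivative F (x + s *\<^sub>R ?e)) (at s)" by (simp only:)
            then show "((\<lambda>s. ?v s * ?p s) has_real_derivative F (x + s *\<^sub>R ?e)) (at s within {a..b})"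
              by (rule has_field_derivative_at_within)
          qed
          then show ?thesis using seg le by (simp add: w_def)
        qed
        show ?thesis by (intro exI[of _ \<delta>] conjI[OF \<delta>(1)] allI impI, rule P)
      next
        case False
        then have "t \<in> (\<lambda>s::real. x + s *\<^sub>R ?e) -` (- K)" using K(2) by blast
        moreover have "open (- K)" using K(1) by (simp add: compact_imp_closed open_Compl)
        ultimately obtain \<delta> where \<delta>: "\<delta> > 0" "ball t \<delta> \<subseteq> (\<lambda>s::real. x + s *\<^sub>R ?e) -` (- K)"
          using openE[OF line[of "- K"]] by auto
        have P: "?P a b" if ab: "a \<le> t \<and> t \<le> b \<and> b - a < \<delta>" for a b
        proof -
          have "{a..b} \<subseteq> ball t \<delta>" using ab by (auto simp: dist_real_def)
          then have seg: "x + s *\<^sub>R ?e \<notin> K" if "s \<in> {a..b}" for s using \<delta>(2) that by blast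
          have "((\<lambda>t. F (x + t *\<^sub>R ?e)) has_integral 0) {a..b}"
            by (rule has_integral_is_0) (simp add: F_def z[OF seg] pz[OF seg])
          moreover have "w (x + b *\<^sub>R ?e) - w (x + a *\<^sub>R ?e) = 0"
            using ab seg[of a] seg[of b] by (simp add: w_def z)
          ultimately show ?thesis by simp
        qed
        show ?thesis by (intro exI[of _ \<delta>] conjI[OF \<delta>(1)] allI impI, rule P)
      qed
    qed
    then show ?case by simp
  qed
  from integral_zero_if_lines_FTC[OF Fint wint this] have "integral\<^sup>L lebesgue F = 0" .
  moreover have "integral\<^sup>L lebesgue F = (\<integral>x\<in>\<Omega>. v x * partial i \<psi> x \<partial>lebesgue) + (\<integral>x\<in>\<Omega>. g x * \<psi> x \<partial>lebesgue)"
    unfolding F_def set_lebesgue_integral_def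
    using i2 i3 unfolding set_integrable_def by (rule Bochner_Integration.integral_add)
  ultimately show "(\<integral>x\<in>\<Omega>. v x * partial i \<psi> x \<partial>lebesgue) = - (\<integral>x\<in>\<Omega>. g x * \<psi> x \<partial>lebesgue)" by simp
qed

lemma locally_integrable_continuous:
  fixes f :: "real^'n \<Rightarrow> real"
  assumes "continuous_on \<Omega> f"
  shows "locally_integrable \<Omega> f"
  unfolding locally_integrable_def
proof (intro allI impI; elim conjE)
  fix K assume K: "compact K" "K \<subseteq> \<Omega>"
  have "integrable lborel (\<lambda>x. indicator K x *\<^sub>R f x)"
    by (rule borel_integrable_compact[OF K(1) continuous_on_subset[OF assms K(2)]])
  moreover from this have "(\<lambda>x. indicator K x *\<^sub>R f x) \<in> borel_measurable lborel" by (rule borel_measurable_integrable)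
  ultimately show "set_integrable lebesgue K f" unfolding set_integrable_def by (simp only: integrable_completion)
qed

lemma C1_weak_partial:
  fixes f :: "real^'n \<Rightarrow> real"
  assumes \<Omega>: "open \<Omega>" and f: "Ck_on 1 \<Omega> f"
  shows "has_weak_partial \<Omega> f i (partial i f)"
proof -
  have d: "f differentiable (at x)" if "x \<in> \<Omega>" for x using f that by simp
  have pc: "continuous_on \<Omega> (partial i f)" using f by simp
  have fc: "continuous_on \<Omega> f"
    by (intro continuous_at_imp_continuous_on ballI differentiable_imp_continuous_within d)
  show ?thesis
  proof (rule weak_partial_if_AC_on_lines[OF \<Omega> locally_integrable_continuous[OF fc] locally_integrable_continuous[OF pc]])
    show "AE x in lborel. AE t in lborel. x + t *\<^sub>R axis i 1 \<in> \<Omega> \<longrightarrow>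
       ((\<lambda>s. f (x + s *\<^sub>R axis i 1)) has_real_derivative partial i f (x + t *\<^sub>R axis i 1)) (at t)"
      by (intro AE_I2 impI partial_on_line d)
    show "AE x in lborel. \<forall>a b. a \<le> b \<longrightarrow> (\<forall>t\<in>{a..b}. x + t *\<^sub>R axis i 1 \<in> \<Omega>) \<longrightarrow>
       abs_continuous_on_interval a b (\<lambda>t. f (x + t *\<^sub>R axis i 1))"
    proof (intro AE_I2 allI impI)
      fix x and a b :: real assume ab: "a \<le> b" and seg: "\<forall>t\<in>{a..b}. x + t *\<^sub>R axis i 1 \<in> \<Omega>"
      let ?p = "\<lambda>t. partial i f (x + t *\<^sub>R axis i 1)"
      have "continuous_on {a..b} ?p"
        by (rule continuous_on_compose2[OF pc]) (use seg in \<open>auto intro!: continuous_intros\<close>)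
      then have "bounded (?p ` {a..b})" by (intro compact_imp_bounded compact_continuous_image) auto
      then obtain M where M: "\<forall>y\<in>?p ` {a..b}. norm y \<le> M" unfolding bounded_iff by blast
      have M': "norm (?p s) \<le> M" if "s \<in> {a..b}" for s using M that by blast
      show "abs_continuous_on_interval a b (\<lambda>t. f (x + t *\<^sub>R axis i 1))"
      proof (rule AC_if_Lipschitz)
        fix s r assume sr: "s \<in> {a..b}" "r \<in> {a..b}"
        have "norm (f (x + r *\<^sub>R axis i 1) - f (x + s *\<^sub>R axis i 1)) \<le> M * norm (r - s)"
        proof (rule field_differentiable_bound[OF _ _ M' sr(2) sr(1)])
          show "convex {a..b}" by simp
          show "((\<lambda>t. f (x + t *\<^sub>R axis i 1)) has_field_derivative ?p t) (at t within {a..b})" if "t \<in> {a..b}" for t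
            by (rule has_field_derivative_at_within[OF partial_on_line[OF d[OF bspec[OF seg that]]]])
        qed
        then show "\<bar>f (x + r *\<^sub>R axis i 1) - f (x + s *\<^sub>R axis i 1)\<bar> \<le> M * \<bar>r - s\<bar>" by simp
        next show "0 \<le> M" using order_trans[OF norm_ge_zero M'[of a]] ab by simp
      qed
    qed
  qed
qed

section \<open>Rectifiable curves and the modulus\<close>

text \<open>
  A partition of \<open>{0..s}\<close> together with the interval \<open>{s..t}\<close> is a partition of \<open>{0..t}\<close>,
  and the lengths of \<open>\<gamma>\<close> over \<open>{0..s}\<close> and \<open>{0..t}\<close> differ by \<open>t - s\<close>.
\<close>

lemma rect_curve_Lipschitz:
  assumes c: "(l, \<gamma>) \<in> rect_curves \<Omega>" and st: "0 \<le> s" "s \<le> t" "t \<le> l"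
  shows "dist (\<gamma> s) (\<gamma> t) \<le> t - s"
proof (cases "s = t")
  case False
  then have lt: "s < t" using st by simp
  have len: "curve_length \<gamma> 0 s = ennreal s" "curve_length \<gamma> 0 t = ennreal t"
    using c st by (auto simp: rect_curves_def)
  have le: "(\<Sum>k\<in>D. dist (\<gamma> (Inf k)) (\<gamma> (Sup k))) + dist (\<gamma> s) (\<gamma> t) \<le> t" if D: "D division_of {0..s}" for D
  proof -
    have "{{s..t}} division_of {s..t}" using division_of_self[of s t] lt by simp
    from division_disjoint_union[OF D this]
    have D': "D \<union> {{s..t}} division_of {0..s} \<union> {s..t}" by (simp add: interior_atLeastAtMost_real)
    have "{0..s} \<union> {s..t} = {0..t}" using st by auto
    with D' have D'': "D \<union> {{s..t}} \<in> {D. D division_of {0..t}}" by simp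
    have nin: "{s..t} \<notin> D"
    proof
      assume "{s..t} \<in> D"
      then have "{s..t} \<subseteq> {0..s}" by (rule division_ofD(2)[OF D])
      then show False using lt by auto
    qed
    have "ennreal (\<Sum>k\<in>D \<union> {{s..t}}. dist (\<gamma> (Inf k)) (\<gamma> (Sup k))) \<le> ennreal t"
      unfolding len(2)[symmetric] curve_length_def by (rule SUP_upper[OF D''])
    moreover have "(\<Sum>k\<in>D \<union> {{s..t}}. dist (\<gamma> (Inf k)) (\<gamma> (Sup k))) = (\<Sum>k\<in>D. dist (\<gamma> (Inf k)) (\<gamma> (Sup k))) + dist (\<gamma> s) (\<gamma> t)"
      using nin division_ofD(1)[OF D] lt by simp
    ultimately show ?thesis using st by (simp add: ennreal_le_iff)
  qed
  have "{{0..s}} division_of {0..s}" using division_of_self[of 0 s] st by simp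
  from le[OF this] have "dist (\<gamma> s) (\<gamma> t) \<le> t" by (smt (verit) sum_nonneg zero_le_dist)
  then have nn: "0 \<le> t - dist (\<gamma> s) (\<gamma> t)" by simp
  have "curve_length \<gamma> 0 s \<le> ennreal (t - dist (\<gamma> s) (\<gamma> t))"
    unfolding curve_length_def
  proof (rule SUP_least)
    fix D assume "D \<in> {D. D division_of {0..s}}"
    then have "D division_of {0..s}" by simp
    from le[OF this] show "ennreal (\<Sum>k\<in>D. dist (\<gamma> (Inf k)) (\<gamma> (Sup k))) \<le> ennreal (t - dist (\<gamma> s) (\<gamma> t))"
      by (intro ennreal_leI) simp
  qed
  then show ?thesis using len nn by (simp add: ennreal_le_iff)
qed simp

lemma segment_rect_curve:
  fixes e :: "real^'n"
  assumes e: "norm e = 1" and ab: "a < b" and seg: "\<And>t. t \<in> {a..b} \<Longrightarrow> x + t *\<^sub>R e \<in> \<Omega>"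
  shows "(b - a, \<lambda>s. x + (a + s) *\<^sub>R e) \<in> rect_curves \<Omega>"
proof -
  let ?g = "\<lambda>s. x + (a + s) *\<^sub>R e"
  have dist: "dist (?g s) (?g t) = \<bar>s - t\<bar>" for s t
  proof -
    have "?g s - ?g t = (s - t) *\<^sub>R e" by (simp add: algebra_simps)
    then show ?thesis using e by (simp add: dist_norm)
  qed
  have "curve_length ?g 0 t = ennreal t" if t: "0 \<le> t" for t
  proof -
    have "ennreal (\<Sum>k\<in>D. dist (?g (Inf k)) (?g (Sup k))) = ennreal t" if "D \<in> {D. D division_of {0..t}}" for D
    proof -
      have D: "D division_of {0..t}" using that by simp
      have "(\<Sum>k\<in>D. dist (?g (Inf k)) (?g (Sup k))) = (\<Sum>k\<in>D. Sup k - Inf k)"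
      proof (rule sum.cong[OF refl])
        fix k assume k: "k \<in> D"
        obtain u v where uv: "k = cbox u v" using division_ofD(4)[OF D k] by (elim exE)
        then have "u \<le> v" using division_ofD(3)[OF D k] by simp
        then show "dist (?g (Inf k)) (?g (Sup k)) = Sup k - Inf k" unfolding dist uv by simp
      qed
      also have "\<dots> = t - 0" using sum_increments_division[OF D t, of "\<lambda>x. x"] .
      finally show ?thesis by simp
    qed
    moreover have "{D. D division_of {0..t}} \<noteq> {}" using division_of_self[of 0 t] t by auto
    ultimately show ?thesis unfolding curve_length_def by (simp add: SUP_eq_const)
  qed
  moreover have "continuous_on {0..b-a} ?g" by (intro continuous_intros)
  moreover have "?g ` {0..b-a} \<subseteq> \<Omega>" using seg by auto
  ultimately show ?thesis using ab unfolding rect_curves_def by auto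
qed

text \<open>
  As \<open>\<gamma>\<close> is only Lipschitz, there is no chain rule for \<open>f \<circ> \<gamma>\<close> at every point. Up to an
  error \<open>\<epsilon> (b - a)\<close>, however, the estimate holds on short intervals \<open>{a..b}\<close>, by the
  differentiability of \<open>f\<close> and the continuity of \<open>\<bar>\<nabla>f\<bar> \<circ> \<gamma>\<close>, and it extends to long
  intervals by bisection.
\<close>

lemma C1_increment_along_curve:
  fixes f :: "real^'n \<Rightarrow> real"
  assumes f: "Ck_on 1 \<Omega> f" and c: "(l, \<gamma>) \<in> rect_curves \<Omega>" and st: "0 \<le> s" "s \<le> t" "t \<le> l"
  shows "continuous_on {0..l} (\<lambda>r. norm (classical_grad f (\<gamma> r)))"
    and "\<bar>f (\<gamma> t) - f (\<gamma> s)\<bar> \<le> integral {s..t} (\<lambda>r. norm (classical_grad f (\<gamma> r)))"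
proof -
  have \<gamma>: "continuous_on {0..l} \<gamma>" "\<gamma> ` {0..l} \<subseteq> \<Omega>" using c by (auto simp: rect_curves_def)
  have pc: "continuous_on \<Omega> (partial i f)" for i using f by simp
  have "continuous_on \<Omega> (classical_grad f)"
    unfolding classical_grad_def by (intro continuous_on_vec_lambda pc)
  from continuous_on_compose2[OF this \<gamma>]
  show cont: "continuous_on {0..l} (\<lambda>r. norm (classical_grad f (\<gamma> r)))"
    by (intro continuous_on_norm)
  let ?p = "\<lambda>r. norm (classical_grad f (\<gamma> r))"
  have pint: "?p integrable_on {a..b}" if "{a..b} \<subseteq> {0..l}" for a b
    by (rule integrable_continuous_interval[OF continuous_on_subset[OF cont that]])
  have main: "\<bar>f (\<gamma> t) - f (\<gamma> s)\<bar> \<le> integral {s..t} ?p + \<epsilon> * (t - s)" if \<epsilon>: "\<epsilon> > 0" for \<epsilon>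
  proof -
    let ?P = "\<lambda>a b. s \<le> a \<longrightarrow> b \<le> t \<longrightarrow> \<bar>f (\<gamma> b) - f (\<gamma> a)\<bar> \<le> integral {a..b} ?p + \<epsilon> * (b - a)"
    have "?P s t"
    proof (rule Bolzano[of s t ?P, OF st(2)])
      fix a b c assume P: "?P a b" "?P b c" and ab: "a \<le> b" "b \<le> c"
      show "?P a c"
      proof (intro impI)
        assume ac: "s \<le> a" "c \<le> t"
        have "integral {a..b} ?p + integral {b..c} ?p = integral {a..c} ?p"
          using ac ab st by (intro Henstock_Kurzweil_Integration.integral_combine pint) auto
        moreover have "\<bar>f (\<gamma> b) - f (\<gamma> a)\<bar> \<le> integral {a..b} ?p + \<epsilon> * (b - a)" using P(1) ac ab by simp
        moreover have "\<bar>f (\<gamma> c) - f (\<gamma> b)\<bar> \<le> integral {b..c} ?p + \<epsilon> * (c - b)" using P(2) ac ab by simp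
        moreover have "\<epsilon> * (b - a) + \<epsilon> * (c - b) = \<epsilon> * (c - a)" by (simp add: algebra_simps)
        ultimately show "\<bar>f (\<gamma> c) - f (\<gamma> a)\<bar> \<le> integral {a..c} ?p + \<epsilon> * (c - a)" by linarith
      qed
    next
      fix r assume r: "s \<le> r" "r \<le> t"
      then have r0l: "r \<in> {0..l}" using st by simp
      then have "\<gamma> r \<in> \<Omega>" using \<gamma>(2) by blast
      then have "f differentiable (at (\<gamma> r))" using f by simp
      from has_derivative_classical_grad[OF this, unfolded has_derivative_at_alt] half_gt_zero[OF \<epsilon>]
      obtain d where d: "d > 0" "\<forall>y. norm (y - \<gamma> r) < d \<longrightarrow>
          norm (f y - f (\<gamma> r) - classical_grad f (\<gamma> r) \<bullet> (y - \<gamma> r)) \<le> \<epsilon>/2 * norm (y - \<gamma> r)"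
        by blast
      obtain d' where d': "d' > 0" "\<forall>y\<in>{0..l}. dist y r < d' \<longrightarrow> dist (?p y) (?p r) < \<epsilon>/2"
        using cont[unfolded continuous_on_iff] r0l half_gt_zero[OF \<epsilon>] by blast
      have inc: "\<bar>f (\<gamma> y) - f (\<gamma> r)\<bar> \<le> (?p r + \<epsilon>/2) * \<bar>y - r\<bar>" if y: "y \<in> {0..l}" "\<bar>y - r\<bar> < d" for y
      proof -
        have lip: "norm (\<gamma> y - \<gamma> r) \<le> \<bar>y - r\<bar>"
        proof (cases "y \<le> r")
          case True
          have "dist (\<gamma> y) (\<gamma> r) \<le> r - y" by (rule rect_curve_Lipschitz[OF c _ True]) (use y r0l in auto)
          then show ?thesis using True by (simp add: dist_norm)
        next
          case False
          then have "dist (\<gamma> r) (\<gamma> y) \<le> y - r" by (intro rect_curve_Lipschitz[OF c]) (use y r0l in auto)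
          then show ?thesis using False by (simp add: dist_norm norm_minus_commute)
        qed
        have "norm (f (\<gamma> y) - f (\<gamma> r) - classical_grad f (\<gamma> r) \<bullet> (\<gamma> y - \<gamma> r)) \<le> \<epsilon>/2 * norm (\<gamma> y - \<gamma> r)"
          using d(2) lip y(2) by (meson le_less_trans)
        moreover have "\<bar>classical_grad f (\<gamma> r) \<bullet> (\<gamma> y - \<gamma> r)\<bar> \<le> ?p r * norm (\<gamma> y - \<gamma> r)" by (rule Cauchy_Schwarz_ineq2)
        ultimately have "\<bar>f (\<gamma> y) - f (\<gamma> r)\<bar> \<le> \<epsilon>/2 * norm (\<gamma> y - \<gamma> r) + ?p r * norm (\<gamma> y - \<gamma> r)"
          unfolding real_norm_def by linarith
        also have "\<dots> = (?p r + \<epsilon>/2) * norm (\<gamma> y - \<gamma> r)" by (simp add: algebra_simps)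
        also have "\<dots> \<le> (?p r + \<epsilon>/2) * \<bar>y - r\<bar>" using \<epsilon> by (intro mult_left_mono[OF lip]) simp
        finally show ?thesis .
      qed
      show "\<exists>\<delta>>0. \<forall>a b. a \<le> r \<and> r \<le> b \<and> b - a < \<delta> \<longrightarrow> ?P a b"
      proof (intro exI[of _ "min d d'"] conjI allI impI)
        show "0 < min d d'" using d(1) d'(1) by simp
        fix a b assume ab: "a \<le> r \<and> r \<le> b \<and> b - a < min d d'" and ab': "s \<le> a" "b \<le> t"
        have m: "a \<in> {0..l}" "b \<in> {0..l}" using ab ab' st by auto
        have 1: "\<bar>f (\<gamma> a) - f (\<gamma> r)\<bar> \<le> (?p r + \<epsilon>/2) * (r - a)" using inc[OF m(1)] ab by simp
        have 2: "\<bar>f (\<gamma> b) - f (\<gamma> r)\<bar> \<le> (?p r + \<epsilon>/2) * (b - r)" using inc[OF m(2)] ab by simp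
        have 3: "(?p r + \<epsilon>/2) * (r - a) + (?p r + \<epsilon>/2) * (b - r) = (?p r - \<epsilon>/2) * (b - a) + \<epsilon> * (b - a)"
          by (simp add: field_simps)
        have "((\<lambda>_. ?p r - \<epsilon>/2) has_integral (b - a) *\<^sub>R (?p r - \<epsilon>/2)) {a..b}"
          using has_integral_const_real[of "?p r - \<epsilon>/2" a b] ab by simp
        moreover have "(?p has_integral integral {a..b} ?p) {a..b}"
          using m by (intro integrable_integral pint) auto
        ultimately have "(b - a) *\<^sub>R (?p r - \<epsilon>/2) \<le> integral {a..b} ?p"
        proof (rule has_integral_le)
          fix y assume y: "y \<in> {a..b}"
          then have "y \<in> {0..l}" "dist y r < d'" using m ab by (auto simp: dist_real_def)
          then have "dist (?p y) (?p r) < \<epsilon>/2" using d'(2) by blast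
          then show "?p r - \<epsilon>/2 \<le> ?p y" unfolding dist_real_def by linarith
        qed
        then have 4: "(?p r - \<epsilon>/2) * (b - a) \<le> integral {a..b} ?p" by (simp add: mult.commute)
        show "\<bar>f (\<gamma> b) - f (\<gamma> a)\<bar> \<le> integral {a..b} ?p + \<epsilon> * (b - a)" using 1 2 3 4 by linarith
      qed
    qed
    then show ?thesis by simp
  qed
  show "\<bar>f (\<gamma> t) - f (\<gamma> s)\<bar> \<le> integral {s..t} ?p"
  proof (rule field_le_epsilon)
    fix e :: real assume e: "e > 0"
    have tp: "t - s + 1 > 0" using st by simp
    have "\<bar>f (\<gamma> t) - f (\<gamma> s)\<bar> \<le> integral {s..t} ?p + e / (t - s + 1) * (t - s)"
      using e tp by (intro main) simp
    also have "e / (t - s + 1) * (t - s) \<le> e / (t - s + 1) * (t - s + 1)" using e tp by (intro mult_left_mono) auto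
    also have "\<dots> = e" using tp by simp
    finally show "\<bar>f (\<gamma> t) - f (\<gamma> s)\<bar> \<le> integral {s..t} ?p + e" by simp
  qed
qed

lemma nn_integral_continuous_interval:
  fixes p :: "real \<Rightarrow> real"
  assumes p: "continuous_on {s..t} p" and nn: "\<And>r. r \<in> {s..t} \<Longrightarrow> 0 \<le> p r"
  shows "(\<integral>\<^sup>+r. ennreal (p r) * indicator {s..t} r \<partial>lborel) = ennreal (integral {s..t} p)"
proof -
  have i: "set_integrable lborel {s..t} p" by (rule borel_integrable_atLeastAtMost'[OF p])
  have "(\<integral>\<^sup>+r. ennreal (p r) * indicator {s..t} r \<partial>lborel) = (\<integral>\<^sup>+r. ennreal (indicator {s..t} r *\<^sub>R p r) \<partial>lborel)"
    by (intro nn_integral_cong) (auto simp: indicator_def)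
  also have "\<dots> = ennreal (\<integral>r. indicator {s..t} r *\<^sub>R p r \<partial>lborel)"
  proof (rule nn_integral_eq_integral)
    show "integrable lborel (\<lambda>r. indicator {s..t} r *\<^sub>R p r)" using i unfolding set_integrable_def .
    show "AE r in lborel. 0 \<le> indicator {s..t} r *\<^sub>R p r" using nn by (intro AE_I2) (simp add: indicator_def)
  qed
  also have "(\<integral>r. indicator {s..t} r *\<^sub>R p r \<partial>lborel) = integral {s..t} p"
    using set_borel_integral_eq_integral(2)[OF i] unfolding set_lebesgue_integral_def .
  finally show ?thesis .
qed

text \<open>
  The truncation of \<open>G\<close> at a large height \<open>N\<close> loses little of the integral, and what remains
  contributes at most \<open>N\<close> times the measure of \<open>A\<close>.
\<close>

lemma nn_integral_absolutely_continuous: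
  fixes G :: "'a \<Rightarrow> ennreal"
  assumes G[measurable]: "G \<in> borel_measurable M" and fin: "(\<integral>\<^sup>+x. G x \<partial>M) < \<infinity>" and \<epsilon>: "(\<epsilon>::real) > 0"
  shows "\<exists>\<delta>>0. \<forall>A\<in>sets M. emeasure M A < ennreal \<delta> \<longrightarrow> (\<integral>\<^sup>+x. G x * indicator A x \<partial>M) < ennreal \<epsilon>"
proof -
  define m where "m N x = min (G x) (of_nat N)" for N :: nat and x
  have [measurable]: "m N \<in> borel_measurable M" for N unfolding m_def by measurable
  have inc: "incseq m" unfolding m_def incseq_def le_fun_def by (auto intro: order_trans[OF min.cobounded2 of_nat_mono])
  have sup: "(SUP N. m N x) = G x" for x
  proof (rule antisym)
    show "(SUP N. m N x) \<le> G x" by (rule SUP_least) (simp add: m_def)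
    show "G x \<le> (SUP N. m N x)"
    proof (rule dense_le)
      fix y assume y: "y < G x"
      then have "y < \<infinity>" by (simp add: less_top order_less_le_trans[OF _ top_greatest])
      then obtain N :: nat where "y < of_nat N" using ennreal_Ex_less_of_nat[of y] by auto
      then have "y \<le> m N x" using y by (simp add: m_def less_imp_le)
      also have "\<dots> \<le> (SUP N. m N x)" by (rule SUP_upper) simp
      finally show "y \<le> (SUP N. m N x)" .
    qed
  qed
  have lim: "(SUP N. \<integral>\<^sup>+x. m N x \<partial>M) = (\<integral>\<^sup>+x. G x \<partial>M)"
    using nn_integral_monotone_convergence_SUP[OF inc, of M] sup by simp
  obtain I where I: "(\<integral>\<^sup>+x. G x \<partial>M) = ennreal I" "I \<ge> 0" using fin by (cases "\<integral>\<^sup>+x. G x \<partial>M") auto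
  have "\<exists>N. ennreal I < (\<integral>\<^sup>+x. m N x \<partial>M) + ennreal (\<epsilon>/2)"
  proof (rule ccontr)
    assume "\<not> ?thesis"
    then have le: "(\<integral>\<^sup>+x. m N x \<partial>M) + ennreal (\<epsilon>/2) \<le> ennreal I" for N by (simp add: not_less)
    have "ennreal (\<epsilon>/2) \<le> ennreal I" using order_trans[OF _ le[of 0]] by (simp add: add_increasing)
    then have eI: "\<epsilon>/2 \<le> I" using I(2) by (simp add: ennreal_le_iff)
    have "(\<integral>\<^sup>+x. m N x \<partial>M) \<le> ennreal (I - \<epsilon>/2)" for N
    proof -
      have "ennreal (\<epsilon>/2) + (\<integral>\<^sup>+x. m N x \<partial>M) \<le> ennreal (\<epsilon>/2) + ennreal (I - \<epsilon>/2)"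
        using le[of N] eI \<epsilon> by (simp add: ennreal_plus[symmetric] add.commute del: ennreal_plus)
      then show ?thesis by (simp add: ennreal_add_left_cancel_le)
    qed
    then have "(SUP N. \<integral>\<^sup>+x. m N x \<partial>M) \<le> ennreal (I - \<epsilon>/2)" by (rule SUP_least)
    then show False using lim I eI \<epsilon> by (simp add: ennreal_le_iff)
  qed
  then obtain N where N: "ennreal I < (\<integral>\<^sup>+x. m N x \<partial>M) + ennreal (\<epsilon>/2)" by blast
  have mfin: "(\<integral>\<^sup>+x. m N x \<partial>M) \<noteq> \<infinity>"
  proof -
    have "(\<integral>\<^sup>+x. m N x \<partial>M) \<le> (\<integral>\<^sup>+x. G x \<partial>M)" by (rule nn_integral_mono) (simp add: m_def)
    then show ?thesis using fin by (auto simp: top_unique)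
  qed
  have rest: "(\<integral>\<^sup>+x. G x - m N x \<partial>M) \<le> ennreal (\<epsilon>/2)"
  proof -
    have "(\<integral>\<^sup>+x. G x - m N x \<partial>M) = (\<integral>\<^sup>+x. G x \<partial>M) - (\<integral>\<^sup>+x. m N x \<partial>M)"
      by (rule nn_integral_diff) (use mfin in \<open>auto simp: m_def\<close>)
    then show ?thesis using N I(1) by (simp add: ennreal_minus_le_iff less_imp_le add.commute mfin)
  qed
  show ?thesis
  proof (intro exI[of _ "\<epsilon> / (2 * (real N + 1))"] conjI ballI impI)
    show "0 < \<epsilon> / (2 * (real N + 1))" using \<epsilon> by simp
    fix A assume A[measurable]: "A \<in> sets M" and less: "emeasure M A < ennreal (\<epsilon> / (2 * (real N + 1)))"
    have "(\<integral>\<^sup>+x. G x * indicator A x \<partial>M) \<le> (\<integral>\<^sup>+x. of_nat N * indicator A x + (G x - m N x) \<partial>M)"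
    proof (rule nn_integral_mono)
      fix x
      have "G x \<le> m N x + (G x - m N x)" by (simp add: m_def add_diff_inverse_ennreal)
      moreover have "m N x \<le> of_nat N" by (simp add: m_def)
      ultimately have "G x \<le> of_nat N + (G x - m N x)" by (meson add_right_mono order_trans)
      then show "G x * indicator A x \<le> of_nat N * indicator A x + (G x - m N x)"
        by (simp add: indicator_def)
    qed
    also have "\<dots> = of_nat N * emeasure M A + (\<integral>\<^sup>+x. G x - m N x \<partial>M)"
      by (subst nn_integral_add) (auto simp: nn_integral_cmult_indicator)
    also have "\<dots> \<le> of_nat N * ennreal (\<epsilon> / (2 * (real N + 1))) + ennreal (\<epsilon>/2)"
      using less rest by (intro add_mono mult_left_mono) auto
    also have "\<dots> = ennreal (real N * (\<epsilon> / (2 * (real N + 1))) + \<epsilon>/2)"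
      using \<epsilon> by (simp add: ennreal_of_nat_eq_real_of_nat ennreal_mult' [symmetric] ennreal_plus[symmetric] del: ennreal_plus)
    also have "\<dots> < ennreal \<epsilon>"
    proof (rule ennreal_lessI[OF \<epsilon>])
      have "real N * \<epsilon> < (real N + 1) * \<epsilon>" using \<epsilon> by simp
      then have "real N * (\<epsilon> / (2 * (real N + 1))) < \<epsilon>/2" by (simp add: divide_simps algebra_simps)
      then show "real N * (\<epsilon> / (2 * (real N + 1))) + \<epsilon>/2 < \<epsilon>" by linarith
    qed
    finally show "(\<integral>\<^sup>+x. G x * indicator A x \<partial>M) < ennreal \<epsilon>" .
  qed
qed

text \<open>
  Over non-overlapping intervals the increments are bounded by the integral of \<open>G\<close> over the
  union, which is small if the total length is.
\<close>

lemma AC_if_increment_bound: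
  fixes F :: "real \<Rightarrow> real" and G :: "real \<Rightarrow> ennreal"
  assumes G: "(\<lambda>r. G r * indicator {a..b} r) \<in> borel_measurable borel"
    and fin: "(\<integral>\<^sup>+r. G r * indicator {a..b} r \<partial>lborel) < \<infinity>"
    and F: "\<And>s t. a \<le> s \<Longrightarrow> s \<le> t \<Longrightarrow> t \<le> b \<Longrightarrow> ennreal \<bar>F t - F s\<bar> \<le> (\<integral>\<^sup>+r. G r * indicator {s..t} r \<partial>lborel)"
  shows "abs_continuous_on_interval a b F"
  unfolding abs_continuous_on_interval_def
proof (intro allI impI)
  fix \<epsilon> :: real assume \<epsilon>: "\<epsilon> > 0"
  let ?G = "\<lambda>r. G r * indicator {a..b} r"
  have Gl[measurable]: "?G \<in> borel_measurable lborel" using G by simp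
  obtain \<delta> where \<delta>: "\<delta> > 0" "\<forall>A\<in>sets lborel. emeasure lborel A < ennreal \<delta> \<longrightarrow> (\<integral>\<^sup>+x. ?G x * indicator A x \<partial>lborel) < ennreal \<epsilon>"
    using nn_integral_absolutely_continuous[OF Gl fin \<epsilon>] by (elim exE conjE)
  show "\<exists>\<delta>>0. \<forall>D S. D division_of S \<and> S \<subseteq> {a..b} \<and> (\<Sum>k\<in>D. Sup k - Inf k) < \<delta> \<longrightarrow> (\<Sum>k\<in>D. \<bar>F (Sup k) - F (Inf k)\<bar>) < \<epsilon>"
  proof (intro exI[of _ \<delta>] conjI[OF \<delta>(1)] allI impI; elim conjE)
    fix D S assume D: "D division_of S" and S: "S \<subseteq> {a..b}" and len: "(\<Sum>k\<in>D. Sup k - Inf k) < \<delta>"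
    note fD = division_ofD(1)[OF D]
    have k: "\<exists>u v. k = {u..v} \<and> u \<le> v \<and> a \<le> u \<and> v \<le> b" if kD: "k \<in> D" for k
    proof -
      obtain u v where uv: "k = cbox u v" using division_ofD(4)[OF D kD] by (elim exE)
      have "u \<le> v" using division_ofD(3)[OF D kD] uv by simp
      moreover have "k \<subseteq> {a..b}" using division_ofD(2)[OF D kD] S by (rule subset_trans)
      ultimately show ?thesis using uv by (intro exI[of _ u] exI[of _ v]) auto
    qed
    let ?A = "\<Union>k\<in>D. interior k"
    have disj: "disjoint_family_on interior D"
      unfolding disjoint_family_on_def using division_ofD(5)[OF D] by blast
    have Am: "?A \<in> sets lborel" by (simp add: open_UN)
    have "emeasure lborel ?A = (\<Sum>k\<in>D. emeasure lborel (interior k))"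
      by (rule sum_emeasure[symmetric, OF _ disj fD]) auto
    also have "\<dots> = (\<Sum>k\<in>D. ennreal (Sup k - Inf k))"
    proof (rule sum.cong[OF refl])
      fix k assume "k \<in> D"
      from k[OF this] obtain u v where "k = {u..v}" "u \<le> v" by (elim exE conjE)
      then show "emeasure lborel (interior k) = ennreal (Sup k - Inf k)" by (simp add: interior_atLeastAtMost_real)
    qed
    also have "\<dots> = ennreal (\<Sum>k\<in>D. Sup k - Inf k)"
    proof (rule sum_ennreal)
      fix k assume "k \<in> D"
      from k[OF this] obtain u v where "k = {u..v}" "u \<le> v" by (elim exE conjE)
      then show "0 \<le> Sup k - Inf k" by simp
    qed
    also have "\<dots> < ennreal \<delta>" using len \<delta>(1) by (rule ennreal_lessI[rotated])
    finally have small: "(\<integral>\<^sup>+x. ?G x * indicator ?A x \<partial>lborel) < ennreal \<epsilon>" using \<delta>(2) Am by blast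
    have "ennreal (\<Sum>k\<in>D. \<bar>F (Sup k) - F (Inf k)\<bar>) = (\<Sum>k\<in>D. ennreal \<bar>F (Sup k) - F (Inf k)\<bar>)"
      by (rule sum_ennreal[symmetric]) simp
    also have "\<dots> \<le> (\<Sum>k\<in>D. \<integral>\<^sup>+x. ?G x * indicator (interior k) x \<partial>lborel)"
    proof (rule sum_mono)
      fix k assume "k \<in> D"
      from k[OF this] obtain u v where uv: "k = {u..v}" "u \<le> v" "a \<le> u" "v \<le> b" by (elim exE conjE)
      have "ennreal \<bar>F (Sup k) - F (Inf k)\<bar> \<le> (\<integral>\<^sup>+r. G r * indicator {u..v} r \<partial>lborel)"
        using F[OF uv(3,2,4)] uv by simp
      also have "\<dots> = (\<integral>\<^sup>+x. ?G x * indicator (interior k) x \<partial>lborel)"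
      proof (rule nn_integral_cong_AE)
        have "AE x in lborel. x \<noteq> u" "AE x in lborel. x \<noteq> v" by (rule AE_lborel_singleton)+
        then show "AE x in lborel. G x * indicator {u..v} x = ?G x * indicator (interior k) x"
          by eventually_elim (use uv in \<open>auto simp: indicator_def interior_atLeastAtMost_real\<close>)
      qed
      finally show "ennreal \<bar>F (Sup k) - F (Inf k)\<bar> \<le> (\<integral>\<^sup>+x. ?G x * indicator (interior k) x \<partial>lborel)" .
    qed
    also have "\<dots> = (\<integral>\<^sup>+x. (\<Sum>k\<in>D. ?G x * indicator (interior k) x) \<partial>lborel)"
      by (rule nn_integral_sum[symmetric]) (intro borel_measurable_times_ennreal Gl borel_measurable_indicator, simp)
    also have "\<dots> = (\<integral>\<^sup>+x. ?G x * indicator ?A x \<partial>lborel)"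
      by (simp only: sum_distrib_left[symmetric] indicator_UN_disjoint[OF fD disj])
    also have "\<dots> < ennreal \<epsilon>" by (rule small)
    finally show "(\<Sum>k\<in>D. \<bar>F (Sup k) - F (Inf k)\<bar>) < \<epsilon>"
      by (simp add: ennreal_less_iff sum_nonneg)
  qed
qed

lemma curve_measurable:
  assumes c: "(l, \<gamma>) \<in> rect_curves \<Omega>" and h: "h \<in> borel_measurable (restrict_space borel \<Omega>)"
  shows "(\<lambda>t. (h (\<gamma> t) :: ennreal) * indicator {0..l} t) \<in> borel_measurable borel"
proof -
  have \<gamma>: "continuous_on {0..l} \<gamma>" "\<gamma> ` {0..l} \<subseteq> \<Omega>" using c by (auto simp: rect_curves_def)
  have "\<gamma> \<in> measurable (restrict_space borel {0..l}) (restrict_space borel \<Omega>)"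
    by (rule measurable_restrict_space2[OF _ borel_measurable_continuous_on_restrict[OF \<gamma>(1)]])
      (use \<gamma>(2) in \<open>auto simp: space_restrict_space\<close>)
  from measurable_compose[OF this h]
  show ?thesis by (subst (asm) borel_measurable_restrict_space_iff_ennreal) auto
qed

lemma borel_imp_lebesgue_on:
  fixes h :: "real^'n \<Rightarrow> ennreal"
  assumes \<Omega>: "\<Omega> \<in> sets borel" and h: "h \<in> borel_measurable (restrict_space borel \<Omega>)"
  shows "(\<lambda>x. h x * indicator \<Omega> x) \<in> borel_measurable borel" "h \<in> borel_measurable (lebesgue_on \<Omega>)"
proof -
  show b: "(\<lambda>x. h x * indicator \<Omega> x) \<in> borel_measurable borel"
    using h \<Omega> by (subst (asm) borel_measurable_restrict_space_iff_ennreal) auto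
  then have "(\<lambda>x. h x * indicator \<Omega> x) \<in> borel_measurable lebesgue" by (intro measurable_completion) simp
  then show "h \<in> borel_measurable (lebesgue_on \<Omega>)"
    using \<Omega> by (subst borel_measurable_restrict_space_iff_ennreal) auto
qed

text \<open>
  Every multiple \<open>k h\<close> with \<open>k > 0\<close> is admissible, and its norm tends to zero with \<open>k\<close>.
\<close>

lemma phi_modulus_zeroI:
  fixes h :: "real^'n \<Rightarrow> ennreal"
  assumes \<phi>: "weak_Phi \<Omega> \<phi>" and \<Gamma>: "\<Gamma> \<subseteq> rect_curves \<Omega>"
    and h: "h \<in> borel_measurable (restrict_space borel \<Omega>)" and hL: "(\<lambda>x. enn2ereal (h x)) \<in> Lphi \<phi> \<Omega>"
    and inf: "\<And>c. c \<in> \<Gamma> \<Longrightarrow> curve_integral c h = \<infinity>"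
  shows "phi_modulus \<phi> \<Omega> \<Gamma> = 0"
proof -
  have le: "phi_modulus \<phi> \<Omega> \<Gamma> \<le> 0 + ennreal \<epsilon>" if \<epsilon>: "\<epsilon> > 0" for \<epsilon>
  proof -
    obtain k where k: "k > 0" "phi_norm \<phi> \<Omega> (\<lambda>x. ereal k * enn2ereal (h x)) \<le> ennreal \<epsilon>"
      using phi_norm_scale_small[OF \<phi> hL \<epsilon>] by blast
    let ?v = "\<lambda>x. ennreal k * h x"
    have "?v \<in> F_adm \<Omega> \<Gamma>" unfolding F_adm_def
    proof (intro CollectI conjI ballI)
      show "?v \<in> borel_measurable (restrict_space borel \<Omega>)" using h by measurable
      fix c assume c: "c \<in> \<Gamma>"
      obtain l \<gamma> where lg: "c = (l, \<gamma>)" by (cases c)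
      have r: "(l, \<gamma>) \<in> rect_curves \<Omega>" using c \<Gamma> lg by auto
      have "curve_integral c ?v = (\<integral>\<^sup>+t. ennreal k * (h (\<gamma> t) * indicator {0..l} t) \<partial>lborel)"
        by (simp add: lg curve_integral_def mult.assoc)
      also have "\<dots> = ennreal k * curve_integral c h"
        using curve_measurable[OF r h] by (subst nn_integral_cmult) (simp_all add: lg curve_integral_def)
      also have "\<dots> = \<infinity>" using inf[OF c] k by (simp add: ennreal_mult_top)
      finally show "1 \<le> curve_integral c ?v" by simp
    qed
    then have "phi_modulus \<phi> \<Omega> \<Gamma> \<le> phi_norm \<phi> \<Omega> (\<lambda>x. enn2ereal (?v x))"
      unfolding phi_modulus_def by (rule INF_lower)
    also have "\<dots> = phi_norm \<phi> \<Omega> (\<lambda>x. ereal k * enn2ereal (h x))"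
      using k by (simp add: times_ennreal.rep_eq enn2ereal_ennreal)
    finally show ?thesis using k(2) by simp
  qed
  have "phi_modulus \<phi> \<Omega> \<Gamma> \<le> 0"
  proof (rule ennreal_le_epsilon)
    fix e :: real assume "0 < e"
    then show "phi_modulus \<phi> \<Omega> \<Gamma> \<le> 0 + ennreal e" by (rule le)
  qed
  then show ?thesis by simp
qed

text \<open>
  Each of the admissible functions that are added up contributes at least \<open>1\<close> to the
  integral over a curve in \<open>\<Gamma>\<close>.
\<close>

lemma phi_modulus_zeroD:
  fixes \<Omega> :: "(real^'n) set"
  assumes \<phi>: "weak_Phi \<Omega> \<phi>" and \<Omega>: "\<Omega> \<in> sets borel" and \<Gamma>: "\<Gamma> \<subseteq> rect_curves \<Omega>" and 0: "phi_modulus \<phi> \<Omega> \<Gamma> = 0"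
  obtains h where "h \<in> borel_measurable (restrict_space borel \<Omega>)" "(\<lambda>x. enn2ereal (h x)) \<in> Lphi \<phi> \<Omega>"
    "\<forall>c\<in>\<Gamma>. curve_integral c h = \<infinity>"
proof -
  have "\<exists>v. v \<in> F_adm \<Omega> \<Gamma> \<and> phi_norm \<phi> \<Omega> (\<lambda>x. enn2ereal (v x)) < ennreal (1 / 4^(k+1))" for k :: nat
  proof -
    have "phi_modulus \<phi> \<Omega> \<Gamma> < ennreal (1 / 4^(k+1))" using 0 by simp
    then show ?thesis unfolding phi_modulus_def INF_less_iff by blast
  qed
  then have "\<forall>k. \<exists>v. v \<in> F_adm \<Omega> \<Gamma> \<and> phi_norm \<phi> \<Omega> (\<lambda>x. enn2ereal (v x)) < ennreal (1 / 4^(k+1))" by blast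
  then obtain v where v: "\<forall>k. v k \<in> F_adm \<Omega> \<Gamma> \<and> phi_norm \<phi> \<Omega> (\<lambda>x. enn2ereal (v k x)) < ennreal (1 / 4^(k+1))"
    by (rule choice[THEN exE])
  have vm: "v k \<in> borel_measurable (restrict_space borel \<Omega>)" for k using v by (auto simp: F_adm_def)
  show thesis
  proof (rule that)
    show "(\<lambda>x. \<Sum>k. v k x) \<in> borel_measurable (restrict_space borel \<Omega>)" using vm by measurable
    show "(\<lambda>x. enn2ereal (\<Sum>k. v k x)) \<in> Lphi \<phi> \<Omega>"
      using v borel_imp_lebesgue_on(2)[OF \<Omega> vm] by (intro Lphi_suminf[OF \<phi>]) auto
    show "\<forall>c\<in>\<Gamma>. curve_integral c (\<lambda>x. \<Sum>k. v k x) = \<infinity>"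
    proof
      fix c assume c: "c \<in> \<Gamma>"
      obtain l \<gamma> where lg: "c = (l, \<gamma>)" by (cases c)
      have r: "(l, \<gamma>) \<in> rect_curves \<Omega>" using c \<Gamma> lg by auto
      have "curve_integral c (\<lambda>x. \<Sum>k. v k x) = (\<integral>\<^sup>+t. (\<Sum>k. v k (\<gamma> t) * indicator {0..l} t) \<partial>lborel)"
        by (simp add: lg curve_integral_def ennreal_suminf_multc)
      also have "\<dots> = (\<Sum>k. \<integral>\<^sup>+t. v k (\<gamma> t) * indicator {0..l} t \<partial>lborel)"
        using curve_measurable[OF r vm] by (intro nn_integral_suminf) simp
      also have "\<dots> = (\<Sum>k. curve_integral c (v k))" by (simp add: lg curve_integral_def)
      also have "\<dots> \<ge> (\<Sum>k::nat. 1 :: ennreal)"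
        using v c by (intro suminf_le) (auto simp: F_adm_def)
      moreover have "(\<Sum>k::nat. 1 :: ennreal) = \<infinity>"
      proof -
        have "of_nat n \<le> (\<Sum>k::nat. 1 :: ennreal)" for n :: nat
          using sum_le_suminf[OF summableI, of "{..<n}" "\<lambda>_::nat. 1 :: ennreal"] by simp
        then have "\<not> (\<Sum>k::nat. 1 :: ennreal) < of_nat n" for n :: nat by (simp add: not_less)
        then have "\<not> (\<Sum>k::nat. 1 :: ennreal) < top" using ennreal_Ex_less_of_nat by blast
        then show ?thesis by (simp add: less_top[symmetric])
      qed
      ultimately show "curve_integral c (\<lambda>x. \<Sum>k. v k x) = \<infinity>" by (simp add: top_unique)
    qed
  qed
qed

section \<open>Functions that are absolutely continuous on curves are Sobolev functions\<close>

lemma AE_lebesgue_on_iff: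
  assumes "\<Omega> \<in> sets lebesgue"
  shows "(AE x in lebesgue_on \<Omega>. P x) \<longleftrightarrow> (AE x in lborel. x \<in> \<Omega> \<longrightarrow> P x)"
  using assms by (subst AE_restrict_space_iff) (simp_all add: AE_completion_iff)

lemma borel_measurable_lebesgue_on_AE:
  fixes f g :: "real^'n \<Rightarrow> real"
  assumes \<Omega>: "\<Omega> \<in> sets lebesgue" and f: "f \<in> borel_measurable (lebesgue_on \<Omega>)"
    and ae: "AE x in lebesgue_on \<Omega>. f x = g x"
  shows "g \<in> borel_measurable (lebesgue_on \<Omega>)"
proof -
  have "(\<lambda>x. if x \<in> \<Omega> then f x else 0) \<in> borel_measurable lebesgue" by (rule borel_measurable_if_I[OF f \<Omega>])
  moreover have "AE x in lebesgue. (if x \<in> \<Omega> then f x else 0) = (if x \<in> \<Omega> then g x else 0)"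
    using ae unfolding AE_lebesgue_on_iff[OF \<Omega>] AE_completion_iff by eventually_elim simp
  ultimately have "(\<lambda>x. if x \<in> \<Omega> then g x else 0) \<in> borel_measurable lebesgue" by (rule borel_measurable_AE)
  then show ?thesis by (rule borel_measurable_if_D)
qed

lemma AC_translate:
  assumes AC: "abs_continuous_on_interval 0 (b - a) (\<lambda>s. f (a + s))"
  shows "abs_continuous_on_interval a b f"
  unfolding abs_continuous_on_interval_def
proof (intro allI impI)
  fix e :: real assume e: "e > 0"
  obtain \<delta> where \<delta>: "\<delta> > 0" and \<delta>2: "\<forall>D. D division_of \<Union>D \<longrightarrow> \<Union>D \<subseteq> {0..b - a} \<longrightarrow> (\<Sum>k\<in>D. Sup k - Inf k) < \<delta> \<longrightarrow>
     (\<Sum>k\<in>D. \<bar>f (a + Sup k) - f (a + Inf k)\<bar>) < e"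
    using AC_sum_increments[OF AC e] by (elim exE conjE)
  show "\<exists>\<delta>>0. \<forall>D S. D division_of S \<and> S \<subseteq> {a..b} \<and> (\<Sum>k\<in>D. Sup k - Inf k) < \<delta> \<longrightarrow> (\<Sum>k\<in>D. \<bar>f (Sup k) - f (Inf k)\<bar>) < e"
  proof (intro exI[of _ \<delta>] conjI[OF \<delta>] allI impI; elim conjE)
    fix D S assume D: "D division_of S" and S: "S \<subseteq> {a..b}" and len: "(\<Sum>k\<in>D. Sup k - Inf k) < \<delta>"
    let ?T = "(`) (\<lambda>x::real. x - a)"
    have k: "\<exists>u v. k = {u..v} \<and> u \<le> v \<and> a \<le> u \<and> v \<le> b" if kD: "k \<in> D" for k
    proof -
      obtain u v where uv: "k = cbox u v" using division_ofD(4)[OF D kD] by (elim exE)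
      have "u \<le> v" using division_ofD(3)[OF D kD] uv by simp
      moreover have "k \<subseteq> {a..b}" using division_ofD(2)[OF D kD] S by (rule subset_trans)
      ultimately show ?thesis using uv by (intro exI[of _ u] exI[of _ v]) auto
    qed
    have Tk: "\<exists>u v. ?T k = {u..v} \<and> u \<le> v \<and> 0 \<le> u \<and> v \<le> b - a \<and> Sup k = a + Sup (?T k) \<and> Inf k = a + Inf (?T k)"
      if "k \<in> D" for k
    proof -
      obtain u v where uv: "k = {u..v}" "u \<le> v" "a \<le> u" "v \<le> b" using k[OF \<open>k \<in> D\<close>] by (elim exE conjE)
      then show ?thesis by (intro exI[of _ "u - a"] exI[of _ "v - a"]) simp
    qed
    have TS: "Sup k = a + Sup (?T k) \<and> Inf k = a + Inf (?T k)" if "k \<in> D" for k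
    proof -
      obtain u v where uv: "k = {u..v}" "u \<le> v" "a \<le> u" "v \<le> b" using k[OF \<open>k \<in> D\<close>] by (elim exE conjE)
      then show ?thesis by simp
    qed
    have inj: "inj_on ?T D"
    proof (rule inj_onI)
      fix k j assume "?T k = ?T j"
      then have "(\<lambda>x. x + a) ` ?T k = (\<lambda>x. x + a) ` ?T j" by simp
      then show "k = j" by (simp add: image_image)
    qed
    have "?T ` D division_of \<Union>(?T ` D)"
    proof (rule division_ofI)
      show "finite (?T ` D)" using division_ofD(1)[OF D] by simp
      fix K assume "K \<in> ?T ` D"
      then obtain k0 where k0: "k0 \<in> D" "K = ?T k0" by blast
      from Tk[OF k0(1)] obtain u v where uv: "K = {u..v}" "u \<le> v" unfolding k0(2) by (elim exE conjE)
      show "K \<noteq> {}" using uv by simp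
      show "\<exists>a b. K = cbox a b" using uv by auto
      show "K \<subseteq> \<Union>(?T ` D)" using k0 by blast
    next
      fix K1 K2 assume "K1 \<in> ?T ` D" "K2 \<in> ?T ` D" and ne: "K1 \<noteq> K2"
      then obtain k1 k2 where kk: "k1 \<in> D" "K1 = ?T k1" "k2 \<in> D" "K2 = ?T k2" by blast
      then have "k1 \<noteq> k2" using ne by blast
      from division_ofD(5)[OF D kk(1,3) this] show "interior K1 \<inter> interior K2 = {}"
        unfolding kk interior_translation_subtract by auto
    qed simp
    moreover have "\<Union>(?T ` D) \<subseteq> {0..b - a}"
    proof (rule Union_least)
      fix K assume "K \<in> ?T ` D"
      then obtain k0 where k0: "k0 \<in> D" "K = ?T k0" by blast
      from Tk[OF k0(1)] obtain u v where "K = {u..v}" "0 \<le> u" "v \<le> b - a" unfolding k0(2) by (elim exE conjE)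
      then show "K \<subseteq> {0..b - a}" by simp
    qed
    moreover have "(\<Sum>k\<in>?T ` D. Sup k - Inf k) = (\<Sum>k\<in>D. Sup k - Inf k)"
      unfolding sum.reindex[OF inj] comp_def
    proof (rule sum.cong[OF refl])
      fix k assume "k \<in> D"
      from TS[OF this] have "Sup k = a + Sup (?T k)" "Inf k = a + Inf (?T k)" by (rule conjunct1, rule conjunct2)
      then show "Sup (?T k) - Inf (?T k) = Sup k - Inf k" by linarith
    qed
    ultimately have "(\<Sum>k\<in>?T ` D. \<bar>f (a + Sup k) - f (a + Inf k)\<bar>) < e" using \<delta>2 len by simp
    moreover have "(\<Sum>k\<in>?T ` D. \<bar>f (a + Sup k) - f (a + Inf k)\<bar>) = (\<Sum>k\<in>D. \<bar>f (Sup k) - f (Inf k)\<bar>)"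
      unfolding sum.reindex[OF inj] comp_def
    proof (rule sum.cong[OF refl])
      fix k assume "k \<in> D"
      from TS[OF this] have "Sup k = a + Sup (?T k)" "Inf k = a + Inf (?T k)" by (rule conjunct1, rule conjunct2)
      then show "\<bar>f (a + Sup (?T k)) - f (a + Inf (?T k))\<bar> = \<bar>f (Sup k) - f (Inf k)\<bar>" by (simp only:)
    qed
    ultimately show "(\<Sum>k\<in>D. \<bar>f (Sup k) - f (Inf k)\<bar>) < e" by simp
  qed
qed

text \<open>Intervals with rational end points suffice.\<close>

lemma AE_open_set_if_intervals:
  fixes T :: "real set"
  assumes T: "open T" and loc: "\<And>a b. a < b \<Longrightarrow> {a..b} \<subseteq> T \<Longrightarrow> negligible {t \<in> {a<..<b}. \<not> P t}"
  shows "AE t in lborel. t \<in> T \<longrightarrow> P t"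
proof -
  define I where "I = {(a,b). a \<in> \<rat> \<and> b \<in> \<rat> \<and> a < b \<and> {a..b} \<subseteq> T}"
  have "countable I" by (rule countable_subset[of _ "\<rat> \<times> \<rat>"]) (auto simp: I_def countable_rat)
  then have "negligible (\<Union>((\<lambda>(a,b). {t \<in> {a<..<b}. \<not> P t}) ` I))"
  proof (intro negligible_countable_Union)
    fix S assume "S \<in> (\<lambda>(a,b). {t \<in> {a<..<b}. \<not> P t}) ` I"
    then obtain a b where "a < b" "{a..b} \<subseteq> T" and S: "S = {t \<in> {a<..<b}. \<not> P t}" by (auto simp: I_def)
    then show "negligible S" unfolding S by (intro loc)
  qed simp
  then have "(\<Union>((\<lambda>(a,b). {t \<in> {a<..<b}. \<not> P t}) ` I)) \<in> null_sets lebesgue" by (simp add: negligible_iff_null_sets)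
  then have "AE t in lebesgue. t \<notin> (\<Union>((\<lambda>(a,b). {t \<in> {a<..<b}. \<not> P t}) ` I))" by (rule AE_not_in)
  then have "AE t in lborel. t \<notin> (\<Union>((\<lambda>(a,b). {t \<in> {a<..<b}. \<not> P t}) ` I))" by (simp only: AE_completion_iff)
  then show ?thesis
  proof eventually_elim
    case (elim t)
    show ?case
    proof
      assume "t \<in> T"
      then obtain r where r: "r > 0" "ball t r \<subseteq> T" by (rule openE[OF T])
      have "t - r/2 < t" "t < t + r/2" using r by simp_all
      obtain a where a: "a \<in> \<rat>" "t - r/2 < a" "a < t" using Rats_dense_in_real[OF \<open>t - r/2 < t\<close>] by blast
      obtain b where b: "b \<in> \<rat>" "t < b" "b < t + r/2" using Rats_dense_in_real[OF \<open>t < t + r/2\<close>] by blast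
      have "{a..b} \<subseteq> ball t r" using a b by (auto simp: dist_real_def)
      then have "{a..b} \<subseteq> T" using r(2) by (rule subset_trans)
      then have "(a,b) \<in> I" using a b by (simp add: I_def)
      then have "t \<notin> {t \<in> {a<..<b}. \<not> P t}" using elim by blast
      then show "P t" using a b by simp
    qed
  qed
qed

lemma Lphi_lborel_finite:
  fixes h :: "real^'n \<Rightarrow> ennreal"
  assumes \<phi>: "weak_Phi \<Omega> \<phi>" and \<beta>: "\<exists>\<beta>>0. AE x in lebesgue_on \<Omega>. \<phi> x \<beta> \<ge> 1" and \<Omega>: "open \<Omega>"
    and hL: "(\<lambda>x. enn2ereal (h x)) \<in> Lphi \<phi> \<Omega>"
    and B: "B \<in> sets lebesgue" "emeasure lebesgue B < \<infinity>"
  shows "(\<integral>\<^sup>+x. (h x * indicator \<Omega> x) * indicator B x \<partial>lborel) < \<infinity>"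
proof -
  have \<Omega>l: "\<Omega> \<in> sets lebesgue" using \<Omega> by simp
  have "(\<integral>\<^sup>+x. (h x * indicator \<Omega> x) * indicator B x \<partial>lborel) = (\<integral>\<^sup>+x. (h x * indicator B x) * indicator \<Omega> x \<partial>lebesgue)"
    by (simp add: nn_integral_completion ac_simps)
  also have "\<dots> = (\<integral>\<^sup>+x. h x * indicator B x \<partial>lebesgue_on \<Omega>)"
    using \<Omega>l by (subst nn_integral_restrict_space) auto
  also have "\<dots> = (\<integral>\<^sup>+x. e2ennreal \<bar>enn2ereal (h x)\<bar> * indicator B x \<partial>lebesgue_on \<Omega>)" by simp
  also have "\<dots> < \<infinity>" by (rule Lphi_integral_finite[OF \<phi> \<beta> \<Omega>l hL B])
  finally show ?thesis .
qed

lemma Lphi_lines_finite: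
  fixes h :: "real^'n \<Rightarrow> ennreal"
  assumes \<phi>: "weak_Phi \<Omega> \<phi>" and \<beta>: "\<exists>\<beta>>0. AE x in lebesgue_on \<Omega>. \<phi> x \<beta> \<ge> 1" and \<Omega>: "open \<Omega>"
    and h: "h \<in> borel_measurable (restrict_space borel \<Omega>)" and hL: "(\<lambda>x. enn2ereal (h x)) \<in> Lphi \<phi> \<Omega>"
  shows "AE x in lborel. \<forall>a b. (\<integral>\<^sup>+t. h (x + t *\<^sub>R e) * indicator \<Omega> (x + t *\<^sub>R e) * indicator {a..b} t \<partial>lborel) < \<infinity>"
proof -
  have b: "(\<lambda>x. h x * indicator \<Omega> x) \<in> borel_measurable borel"
    by (rule borel_imp_lebesgue_on(1)[OF _ h]) (use \<Omega> in simp)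
  show ?thesis
  proof (rule lines_nn_integral_finite[OF b])
    fix j :: nat
    have "emeasure lebesgue (ball (0::real^'n) (real j)) < \<infinity>" using emeasure_lborel_ball_finite[of "0::real^'n" "real j"] by simp
    then show "(\<integral>\<^sup>+x. (h x * indicator \<Omega> x) * indicator (ball 0 (real j)) x \<partial>lborel) < \<infinity>"
      by (intro Lphi_lborel_finite[OF \<phi> \<beta> \<Omega> hL]) auto
  qed
qed

lemma segment_curve_integral:
  assumes seg: "\<forall>t\<in>{a..b}. x + t *\<^sub>R e \<in> \<Omega>" and h: "(\<lambda>x. h x * indicator \<Omega> x) \<in> borel_measurable borel"
  shows "curve_integral (b - a, \<lambda>s. x + (a + s) *\<^sub>R e) h =
    (\<integral>\<^sup>+t. h (x + t *\<^sub>R (e::real^'n)) * indicator \<Omega> (x + t *\<^sub>R e) * indicator {a..b} t \<partial>lborel)"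
proof -
  let ?f = "\<lambda>t. h (x + t *\<^sub>R e) * indicator \<Omega> (x + t *\<^sub>R e) * indicator {a..b} t :: ennreal"
  have "(\<lambda>t. x + t *\<^sub>R e) \<in> borel_measurable borel" by measurable
  from measurable_compose[OF this h] have "?f \<in> borel_measurable borel" by measurable
  from nn_integral_lborel_translate[OF this, of a]
  have "(\<integral>\<^sup>+t. ?f t \<partial>lborel) = (\<integral>\<^sup>+s. ?f (s + a) \<partial>lborel)" by simp
  also have "\<dots> = (\<integral>\<^sup>+s. h (x + (a + s) *\<^sub>R e) * indicator {0..b - a} s \<partial>lborel)"
  proof (rule nn_integral_cong)
    fix s
    have "s + a \<in> {a..b} \<longleftrightarrow> s \<in> {0..b - a}" by auto
    then show "?f (s + a) = h (x + (a + s) *\<^sub>R e) * indicator {0..b - a} s"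
      using seg by (cases "s \<in> {0..b - a}") (simp_all add: add.commute)
  qed
  finally show ?thesis by (simp add: curve_integral_def)
qed

text \<open>
  The exceptional curves have infinite integrals of some \<open>h \<in> L\<^sup>\<phi>(\<Omega>)\<close>, whereas the integrals
  of \<open>h\<close> over the segments of almost every line are finite.
\<close>

lemma ACC_imp_AC_on_lines:
  fixes v :: "real^'n \<Rightarrow> real"
  assumes \<phi>: "weak_Phi \<Omega> \<phi>" and \<beta>: "\<exists>\<beta>>0. AE x in lebesgue_on \<Omega>. \<phi> x \<beta> \<ge> 1" and \<Omega>: "open \<Omega>"
    and v: "v \<in> ACC \<phi> \<Omega>"
  shows "AE x in lborel. \<forall>a b. a \<le> b \<longrightarrow> (\<forall>t\<in>{a..b}. x + t *\<^sub>R axis i 1 \<in> \<Omega>) \<longrightarrow>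
       abs_continuous_on_interval a b (\<lambda>t. v (x + t *\<^sub>R axis i 1))"
proof -
  let ?e = "axis i 1 :: real^'n"
  have sub: "Gamma_NAC \<Omega> v \<subseteq> rect_curves \<Omega>" by (auto simp: Gamma_NAC_def)
  have z: "phi_modulus \<phi> \<Omega> (Gamma_NAC \<Omega> v) = 0" using v by (simp add: ACC_def)
  have \<Omega>b: "\<Omega> \<in> sets borel" using \<Omega> by simp
  obtain h where h: "h \<in> borel_measurable (restrict_space borel \<Omega>)" and hL: "(\<lambda>x. enn2ereal (h x)) \<in> Lphi \<phi> \<Omega>"
    and inf: "\<forall>c\<in>Gamma_NAC \<Omega> v. curve_integral c h = \<infinity>"
    by (rule phi_modulus_zeroD[OF \<phi> \<Omega>b sub z])
  show ?thesis using Lphi_lines_finite[OF \<phi> \<beta> \<Omega> h hL, of ?e]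
  proof eventually_elim
    case (elim x)
    show ?case
    proof (intro allI impI)
      fix a b :: real assume ab: "a \<le> b" and seg: "\<forall>t\<in>{a..b}. x + t *\<^sub>R ?e \<in> \<Omega>"
      show "abs_continuous_on_interval a b (\<lambda>t. v (x + t *\<^sub>R ?e))"
      proof (cases "a = b")
        case True
        then show ?thesis by (intro AC_if_Lipschitz[of a b _ 0]) auto
      next
        case False
        then have lt: "a < b" using ab by simp
        let ?c = "(b - a, \<lambda>s. x + (a + s) *\<^sub>R ?e)"
        have r: "?c \<in> rect_curves \<Omega>" by (rule segment_rect_curve[OF _ lt]) (use seg in simp_all)
        have "curve_integral ?c h < \<infinity>"
          unfolding segment_curve_integral[OF seg borel_imp_lebesgue_on(1)[OF \<Omega>b h]] using elim by simp
        then have "?c \<notin> Gamma_NAC \<Omega> v" using inf by auto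
        then have "abs_continuous_on_interval 0 (b - a) (\<lambda>s. v (x + (a + s) *\<^sub>R ?e))"
          using r by (simp add: Gamma_NAC_def comp_def)
        then show ?thesis by (rule AC_translate)
      qed
    qed
  qed
qed

lemma AC_on_lines_imp_isCont:
  fixes v :: "real^'n \<Rightarrow> real"
  assumes \<Omega>: "open \<Omega>"
    and ac: "\<forall>a b. a \<le> b \<longrightarrow> (\<forall>t\<in>{a..b}. x + t *\<^sub>R e \<in> \<Omega>) \<longrightarrow> abs_continuous_on_interval a b (\<lambda>t. v (x + t *\<^sub>R e))"
    and t: "x + t *\<^sub>R e \<in> \<Omega>"
  shows "isCont (\<lambda>s. v (x + s *\<^sub>R e)) t"
proof -
  have "open ((\<lambda>s::real. x + s *\<^sub>R e) -` \<Omega>)" by (rule open_vimage[OF \<Omega>]) (intro continuous_intros)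
  moreover have "t \<in> (\<lambda>s::real. x + s *\<^sub>R e) -` \<Omega>" using t by simp
  ultimately obtain r where r: "r > 0" "ball t r \<subseteq> (\<lambda>s::real. x + s *\<^sub>R e) -` \<Omega>" by (rule openE)
  let ?a = "t - r/2" and ?b = "t + r/2"
  have "{?a..?b} \<subseteq> ball t r" using r(1) by (auto simp: dist_real_def)
  then have "\<forall>s\<in>{?a..?b}. x + s *\<^sub>R e \<in> \<Omega>" using r(2) by blast
  then have "abs_continuous_on_interval ?a ?b (\<lambda>s. v (x + s *\<^sub>R e))" using ac r(1) by simp
  then have "continuous_on {?a..?b} (\<lambda>s. v (x + s *\<^sub>R e))" by (rule AC_imp_continuous_on)
  then have "continuous_on {?a<..<?b} (\<lambda>s. v (x + s *\<^sub>R e))" by (rule continuous_on_subset) auto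
  moreover have "open {?a<..<?b}" by simp
  moreover have "t \<in> {?a<..<?b}" using r(1) by simp
  ultimately show ?thesis by (simp add: continuous_on_eq_continuous_at)
qed

lemma Lphi_imp_locally_integrable:
  fixes f :: "real^'n \<Rightarrow> real"
  assumes \<phi>: "weak_Phi \<Omega> \<phi>" and \<beta>: "\<exists>\<beta>>0. AE x in lebesgue_on \<Omega>. \<phi> x \<beta> \<ge> 1" and \<Omega>: "open \<Omega>"
    and fL: "(\<lambda>x. ereal (f x)) \<in> Lphi \<phi> \<Omega>"
  shows "f \<in> borel_measurable (lebesgue_on \<Omega>)" "locally_integrable \<Omega> f"
proof -
  have \<Omega>l: "\<Omega> \<in> sets lebesgue" using \<Omega> by simp
  have "(\<lambda>x. ereal (f x)) \<in> borel_measurable (lebesgue_on \<Omega>)" using fL by (simp add: Lphi_def)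
  then have "(\<lambda>x. real_of_ereal (ereal (f x))) \<in> borel_measurable (lebesgue_on \<Omega>)" by measurable
  then show fm: "f \<in> borel_measurable (lebesgue_on \<Omega>)" by simp
  show "locally_integrable \<Omega> f" unfolding locally_integrable_def
  proof (intro allI impI; elim conjE)
    fix K assume K: "compact K" "K \<subseteq> \<Omega>"
    have Kl: "K \<in> lmeasurable" by (rule lmeasurable_compact[OF K(1)])
    have f0: "(\<lambda>x. if x \<in> \<Omega> then f x else 0) \<in> borel_measurable lebesgue" by (rule borel_measurable_if_I[OF fm \<Omega>l])
    have eq: "indicator K x *\<^sub>R f x = indicator K x * (if x \<in> \<Omega> then f x else 0)" for x
      using K(2) by (auto simp: indicator_def)
    show "set_integrable lebesgue K f" unfolding set_integrable_def eq
    proof (rule integrableI_bounded)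
      show "(\<lambda>x. indicator K x * (if x \<in> \<Omega> then f x else 0)) \<in> borel_measurable lebesgue"
        by (rule borel_measurable_times[OF borel_measurable_indicator[OF fmeasurableD[OF Kl]] f0])
      have "(\<integral>\<^sup>+x. ennreal (norm (indicator K x * (if x \<in> \<Omega> then f x else 0))) \<partial>lebesgue) =
          (\<integral>\<^sup>+x. (e2ennreal \<bar>ereal (f x)\<bar> * indicator K x) * indicator \<Omega> x \<partial>lebesgue)"
        by (intro nn_integral_cong) (simp add: indicator_def e2ennreal_ereal)
      also have "\<dots> = (\<integral>\<^sup>+x. e2ennreal \<bar>ereal (f x)\<bar> * indicator K x \<partial>lebesgue_on \<Omega>)"
        using \<Omega>l by (subst nn_integral_restrict_space) auto
      also have "\<dots> < \<infinity>"
        using fmeasurableD[OF Kl] fmeasurableD2[OF Kl] by (intro Lphi_integral_finite[OF \<phi> \<beta> \<Omega>l fL]) (auto simp: less_top)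
      finally show "(\<integral>\<^sup>+x. ennreal (norm (indicator K x * (if x \<in> \<Omega> then f x else 0))) \<partial>lebesgue) < \<infinity>" .
    qed
  qed
qed

lemma has_weak_partial_cong_AE:
  fixes u v g :: "real^'n \<Rightarrow> real"
  assumes \<Omega>: "open \<Omega>" and w: "has_weak_partial \<Omega> u i g"
    and uv: "AE x in lebesgue_on \<Omega>. u x = v x"
  shows "has_weak_partial \<Omega> v i g"
proof -
  have \<Omega>l: "\<Omega> \<in> sets lebesgue" using \<Omega> by simp
  have ae: "AE x in lebesgue. x \<in> \<Omega> \<longrightarrow> u x = v x"
    using uv unfolding AE_lebesgue_on_iff[OF \<Omega>l] AE_completion_iff .
  have "locally_integrable \<Omega> v" unfolding locally_integrable_def
  proof (intro allI impI; elim conjE)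
    fix K assume K: "compact K" "K \<subseteq> \<Omega>"
    have "set_integrable lebesgue K u" using w K unfolding has_weak_partial_def locally_integrable_def by simp
    then have iu: "integrable lebesgue (\<lambda>x. indicator K x *\<^sub>R u x)" unfolding set_integrable_def .
    have aeK: "AE x in lebesgue. indicator K x *\<^sub>R u x = indicator K x *\<^sub>R v x"
      using ae by eventually_elim (use K(2) in \<open>auto simp: indicator_def\<close>)
    have vm: "(\<lambda>x. indicator K x *\<^sub>R v x) \<in> borel_measurable lebesgue"
      by (rule borel_measurable_AE[OF borel_measurable_integrable[OF iu] aeK])
    show "set_integrable lebesgue K v" unfolding set_integrable_def
      by (rule integrable_cong_AE[THEN iffD1, OF borel_measurable_integrable[OF iu] vm aeK iu])
  qed
  moreover have "(\<integral>x\<in>\<Omega>. v x * partial i \<psi> x \<partial>lebesgue) = (\<integral>x\<in>\<Omega>. u x * partial i \<psi> x \<partial>lebesgue)" if \<psi>: "test_function \<Omega> \<psi>" for \<psi>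
  proof -
    obtain K B where K: "compact K" "K \<subseteq> \<Omega>" and zz: "\<forall>x. x \<notin> K \<longrightarrow> \<psi> x = 0 \<and> partial i \<psi> x = 0"
    and BB: "\<forall>x. \<bar>partial i \<psi> x\<bar> \<le> B" and c: "continuous_on UNIV (partial i \<psi>)"
      using test_function_bounds[OF \<psi>, of i] by (elim exE conjE)
    have "set_integrable lebesgue K u" using w K unfolding has_weak_partial_def locally_integrable_def by simp
    then have i: "set_integrable lebesgue \<Omega> (\<lambda>x. u x * partial i \<psi> x)"
    proof (rule set_integrable_mult_bounded[OF _ K(2) c BB[rule_format]])
      show "partial i \<psi> x = 0" if "x \<notin> K" for x using zz that by simp
    qed
    show ?thesis
      unfolding set_lebesgue_integral_def
    proof (intro integral_cong_AE)
      show um: "(\<lambda>x. indicator \<Omega> x *\<^sub>R (u x * partial i \<psi> x)) \<in> borel_measurable lebesgue"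
        using i unfolding set_integrable_def by (rule borel_measurable_integrable)
      show aeO: "AE x in lebesgue. indicator \<Omega> x *\<^sub>R (v x * partial i \<psi> x) = indicator \<Omega> x *\<^sub>R (u x * partial i \<psi> x)"
        using ae by eventually_elim (auto simp: indicator_def)
      then have "AE x in lebesgue. indicator \<Omega> x *\<^sub>R (u x * partial i \<psi> x) = indicator \<Omega> x *\<^sub>R (v x * partial i \<psi> x)"
        by eventually_elim (rule sym)
      then show "(\<lambda>x. indicator \<Omega> x *\<^sub>R (v x * partial i \<psi> x)) \<in> borel_measurable lebesgue" by (rule borel_measurable_AE[OF um])
    qed
  qed
  ultimately show ?thesis using w unfolding has_weak_partial_def by simp
qed

text \<open>
  The upper limit exists whether or not \<open>f\<close> is differentiable and depends measurably on
  parameters.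
\<close>

lemma derivative_as_limsup:
  fixes f :: "real \<Rightarrow> real"
  assumes "(f has_real_derivative D) (at t)"
  shows "limsup (\<lambda>m. ereal (real (Suc m) * (f (t + 1 / real (Suc m)) - f t))) = ereal D"
proof -
  have "((\<lambda>h. (f (t + h) - f t) / h) \<longlongrightarrow> D) (at 0)" using assms by (simp add: DERIV_def)
  moreover have "filterlim (\<lambda>m. 1 / real (Suc m)) (at 0) sequentially"
    unfolding filterlim_at
  proof (intro conjI always_eventually allI)
    show "(\<lambda>m. 1 / real (Suc m)) \<longlonglongrightarrow> 0" using LIMSEQ_inverse_real_of_nat unfolding inverse_eq_divide .
  qed simp_all
  ultimately have "((\<lambda>m. (f (t + 1 / real (Suc m)) - f t) / (1 / real (Suc m))) \<longlongrightarrow> D) sequentially"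
    by (rule filterlim_compose)
  then have "(\<lambda>m. real (Suc m) * (f (t + 1 / real (Suc m)) - f t)) \<longlonglongrightarrow> D" by (simp add: mult.commute)
  then have "(\<lambda>m. ereal (real (Suc m) * (f (t + 1 / real (Suc m)) - f t))) \<longlonglongrightarrow> ereal D" by (simp only: lim_ereal)
  then show ?thesis by (rule lim_imp_Limsup[rotated]) simp
qed

text \<open>
  The weak derivative is the classical one. Since the latter is not known to exist
  everywhere, nor to be measurable, it is represented by the upper limit \<open>g\<close> of difference
  quotients. The two agree almost everywhere, so that \<open>g\<close> is dominated by \<open>\<bar>\<nabla>v\<bar>\<close>.
\<close>

lemma ACCphi_weak_partial:
  fixes v :: "real^'n \<Rightarrow> real"
  assumes \<phi>: "weak_Phi \<Omega> \<phi>" and \<beta>: "\<exists>\<beta>>0. AE x in lebesgue_on \<Omega>. \<phi> x \<beta> \<ge> 1" and \<Omega>: "open \<Omega>"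
    and vL: "(\<lambda>x. ereal (v x)) \<in> Lphi \<phi> \<Omega>" and v: "v \<in> ACCphi \<phi> \<Omega>"
  shows "\<exists>g. has_weak_partial \<Omega> v i g \<and> (\<lambda>x. ereal (g x)) \<in> Lphi \<phi> \<Omega>"
proof -
  let ?e = "axis i 1 :: real^'n"
  have \<Omega>l: "\<Omega> \<in> sets lebesgue" using \<Omega> by simp
  have vACC: "v \<in> ACC \<phi> \<Omega>" and gL: "(\<lambda>x. ereal (norm (classical_grad v x))) \<in> Lphi \<phi> \<Omega>"
    using v by (auto simp: ACCphi_def)
  have vm: "v \<in> borel_measurable (lebesgue_on \<Omega>)" and vl: "locally_integrable \<Omega> v"
    by (rule Lphi_imp_locally_integrable[OF \<phi> \<beta> \<Omega> vL])+
  define v0 where "v0 x = (if x \<in> \<Omega> then v x else 0)" for x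
  have v0: "v0 \<in> borel_measurable lebesgue" unfolding v0_def by (rule borel_measurable_if_I[OF vm \<Omega>l])
  \<comment> \<open>The extension \<open>v0\<close> makes the difference quotients measurable functions on the whole
    space.\<close>
  define g where "g x = real_of_ereal (limsup (\<lambda>m. ereal (real (Suc m) * (v0 (x + (1 / real (Suc m)) *\<^sub>R ?e) - v0 x))))" for x
  have gm0: "g \<in> borel_measurable lebesgue"
  proof -
    have "(\<lambda>x. ereal (real (Suc m) * (v0 (x + (1 / real (Suc m)) *\<^sub>R ?e) - v0 x))) \<in> borel_measurable lebesgue" for m
      by (intro borel_measurable_ereal borel_measurable_times borel_measurable_const borel_measurable_diff
          lebesgue_measurable_translate[OF v0] v0)
    then show ?thesis unfolding g_def by (intro borel_measurable_real_of_ereal borel_measurable_limsup)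
  qed
  then have gm: "g \<in> borel_measurable (lebesgue_on \<Omega>)" by (rule measurable_restrict_space1)
  note ac = ACC_imp_AC_on_lines[OF \<phi> \<beta> \<Omega> vACC, of i]
  have cont: "AE x in lborel. \<forall>t. x + t *\<^sub>R ?e \<in> \<Omega> \<longrightarrow> isCont (\<lambda>s. v (x + s *\<^sub>R ?e)) t"
    using ac by eventually_elim (intro allI impI, rule AC_on_lines_imp_isCont[OF \<Omega>])
  have line: "open ((\<lambda>s::real. x + s *\<^sub>R ?e) -` \<Omega>)" for x
    by (rule open_vimage[OF \<Omega>]) (intro continuous_intros)
  have der: "AE x in lborel. AE t in lborel. x + t *\<^sub>R ?e \<in> \<Omega> \<longrightarrow>
       ((\<lambda>s. v (x + s *\<^sub>R ?e)) has_real_derivative g (x + t *\<^sub>R ?e)) (at t)"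
    using ac
  proof eventually_elim
    case (elim x)
    let ?v = "\<lambda>s. v (x + s *\<^sub>R ?e)"
    have "AE t in lborel. t \<in> (\<lambda>s::real. x + s *\<^sub>R ?e) -` \<Omega> \<longrightarrow> (\<exists>D. (?v has_real_derivative D) (at t))"
    proof (rule AE_open_set_if_intervals[OF line])
      fix a b :: real assume ab: "a < b" "{a..b} \<subseteq> (\<lambda>s::real. x + s *\<^sub>R ?e) -` \<Omega>"
      have "\<forall>t\<in>{a..b}. x + t *\<^sub>R ?e \<in> \<Omega>" using ab(2) by (simp add: subset_eq)
      then have "abs_continuous_on_interval a b ?v" using elim ab(1) by simp
      then show "negligible {t \<in> {a<..<b}. \<not> (\<exists>D. (?v has_real_derivative D) (at t))}" by (rule AC_differentiable_AE)
    qed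
    then show ?case
    proof eventually_elim
      case (elim t)
      show ?case
      proof
        assume t: "x + t *\<^sub>R ?e \<in> \<Omega>"
        then obtain D where D: "(?v has_real_derivative D) (at t)" using elim by auto
        let ?w = "\<lambda>s. v0 (x + s *\<^sub>R ?e)"
        have "(?w has_real_derivative D) (at t)"
        proof (rule has_field_derivative_transform_within_open[OF D line[of x]])
          show "t \<in> (\<lambda>s::real. x + s *\<^sub>R ?e) -` \<Omega>" using t by simp
          fix r :: real assume "r \<in> (\<lambda>s::real. x + s *\<^sub>R ?e) -` \<Omega>"
          then have "x + r *\<^sub>R ?e \<in> \<Omega>" by (rule vimageD)
          then show "v (x + r *\<^sub>R ?e) = v0 (x + r *\<^sub>R ?e)" unfolding v0_def by (rule if_P[symmetric])
        qed
        from derivative_as_limsup[OF this] have "g (x + t *\<^sub>R ?e) = D"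
          unfolding g_def by (simp add: algebra_simps)
        then show "(?v has_real_derivative g (x + t *\<^sub>R ?e)) (at t)" using D by simp
      qed
    qed
  qed
  have "AE x in lborel. x \<in> \<Omega> \<longrightarrow> ((\<lambda>s. v (x + s *\<^sub>R ?e)) has_real_derivative g x) (at 0)"
    by (rule AE_directional_derivative[OF \<Omega> vm gm cont der])
  then have ae: "AE x in lebesgue_on \<Omega>. \<bar>ereal (g x)\<bar> \<le> \<bar>ereal (norm (classical_grad v x))\<bar>"
    unfolding AE_lebesgue_on_iff[OF \<Omega>l]
  proof eventually_elim
    case (elim x)
    show ?case
    proof
      assume "x \<in> \<Omega>"
      then have "partial i v x = g x" using elim unfolding partial_def by (intro DERIV_imp_deriv) simp
      then have "classical_grad v x $ i = g x" by (simp add: classical_grad_def)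
      then show "\<bar>ereal (g x)\<bar> \<le> \<bar>ereal (norm (classical_grad v x))\<bar>"
        using component_le_norm_cart[of "classical_grad v x" i] by simp
    qed
  qed
  have gLp: "(\<lambda>x. ereal (g x)) \<in> Lphi \<phi> \<Omega>"
    by (rule Lphi_dominated[OF \<phi> gL _ ae]) (rule borel_measurable_ereal[OF gm])
  have "locally_integrable \<Omega> g" by (rule Lphi_imp_locally_integrable(2)[OF \<phi> \<beta> \<Omega> gLp])
  from weak_partial_if_AC_on_lines[OF \<Omega> vl this ac der] gLp show ?thesis by blast
qed

theorem ACCphi_imp_W1phi:
  fixes u :: "real^'n \<Rightarrow> ereal"
  assumes \<phi>: "weak_Phi \<Omega> \<phi>" and \<beta>: "\<exists>\<beta>>0. AE x in lebesgue_on \<Omega>. \<phi> x \<beta> \<ge> 1" and \<Omega>: "open \<Omega>"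
    and u: "u \<in> Lphi \<phi> \<Omega>" and v: "v \<in> ACCphi \<phi> \<Omega>" and uv: "AE x in lebesgue_on \<Omega>. u x = ereal (v x)"
  shows "u \<in> W1phi \<phi> \<Omega>"
proof -
  have \<Omega>l: "\<Omega> \<in> sets lebesgue" using \<Omega> by simp
  have "u \<in> borel_measurable (lebesgue_on \<Omega>)" using u by (simp add: Lphi_def)
  then have um: "(\<lambda>x. real_of_ereal (u x)) \<in> borel_measurable (lebesgue_on \<Omega>)" by (rule borel_measurable_real_of_ereal)
  have ae: "AE x in lebesgue_on \<Omega>. real_of_ereal (u x) = v x" using uv by eventually_elim simp
  have ae': "AE x in lebesgue_on \<Omega>. v x = real_of_ereal (u x)" using uv by eventually_elim simp
  have vm: "v \<in> borel_measurable (lebesgue_on \<Omega>)" by (rule borel_measurable_lebesgue_on_AE[OF \<Omega>l um ae])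
  have vL: "(\<lambda>x. ereal (v x)) \<in> Lphi \<phi> \<Omega>"
    by (rule Lphi_dominated[OF \<phi> u borel_measurable_ereal[OF vm]]) (use uv in \<open>eventually_elim, simp\<close>)
  have "\<exists>g. has_weak_partial \<Omega> (\<lambda>x. real_of_ereal (u x)) i g \<and> (\<lambda>x. ereal (g x)) \<in> Lphi \<phi> \<Omega>" for i
  proof -
    obtain g where g: "has_weak_partial \<Omega> v i g" "(\<lambda>x. ereal (g x)) \<in> Lphi \<phi> \<Omega>"
      using ACCphi_weak_partial[OF \<phi> \<beta> \<Omega> vL v, of i] by (elim exE conjE)
    show ?thesis using has_weak_partial_cong_AE[OF \<Omega> g(1) ae'] g(2) by (intro exI[of _ g] conjI)
  qed
  then show ?thesis using u unfolding W1phi_def by simp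
qed

section \<open>Limits of continuously differentiable functions along curves\<close>

lemma partial_diff:
  fixes f g :: "real^'n \<Rightarrow> real"
  assumes "f differentiable (at y)" "g differentiable (at y)"
  shows "partial i (\<lambda>x. f x - g x) y = partial i f y - partial i g y"
proof -
  have "((\<lambda>s. f (y + s *\<^sub>R axis i 1)) has_real_derivative partial i f y) (at 0)"
    using partial_on_line[of f y 0 i] assms(1) by simp
  moreover have "((\<lambda>s. g (y + s *\<^sub>R axis i 1)) has_real_derivative partial i g y) (at 0)"
    using partial_on_line[of g y 0 i] assms(2) by simp
  ultimately have "((\<lambda>s. f (y + s *\<^sub>R axis i 1) - g (y + s *\<^sub>R axis i 1)) has_real_derivative partial i f y - partial i g y) (at 0)"
    by (rule DERIV_diff)
  then show ?thesis unfolding partial_def[of i "\<lambda>x. f x - g x"] by (rule DERIV_imp_deriv)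
qed

lemma classical_grad_diff:
  fixes f g :: "real^'n \<Rightarrow> real"
  assumes "f differentiable (at y)" "g differentiable (at y)"
  shows "classical_grad (\<lambda>x. f x - g x) y = classical_grad f y - classical_grad g y"
  by (simp add: vec_eq_iff classical_grad_def partial_diff[OF assms])

lemma Ck_on_1_diff:
  fixes f g :: "real^'n \<Rightarrow> real"
  assumes f: "Ck_on 1 \<Omega> f" and g: "Ck_on 1 \<Omega> g"
  shows "Ck_on 1 \<Omega> (\<lambda>x. f x - g x)"
proof -
  have d: "f differentiable (at x)" "g differentiable (at x)" if "x \<in> \<Omega>" for x using f g that by simp_all
  have "continuous_on \<Omega> (partial i (\<lambda>x. f x - g x))" for i
  proof -
    have "continuous_on \<Omega> (\<lambda>x. partial i f x - partial i g x)" using f g by (intro continuous_on_diff) simp_all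
    then show ?thesis
      by (rule continuous_on_cong[THEN iffD1, rotated -1]) (simp_all add: partial_diff[OF d])
  qed
  then show ?thesis using d by simp
qed

lemma Ck_on_1_continuous:
  fixes f :: "real^'n \<Rightarrow> real"
  assumes f: "Ck_on 1 \<Omega> f"
  shows "continuous_on \<Omega> f" "continuous_on \<Omega> (classical_grad f)"
proof -
  have d: "f differentiable (at x)" if "x \<in> \<Omega>" for x using f that by simp
  show "continuous_on \<Omega> f" by (intro continuous_at_imp_continuous_on ballI differentiable_imp_continuous_within d)
  have "continuous_on \<Omega> (partial i f)" for i using f by simp
  then show "continuous_on \<Omega> (classical_grad f)" unfolding classical_grad_def by (intro continuous_on_vec_lambda)
qed

lemma C1_nn_increment_along_curve:
  fixes f :: "real^'n \<Rightarrow> real"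
  assumes f: "Ck_on 1 \<Omega> f" and c: "(l, \<gamma>) \<in> rect_curves \<Omega>" and st: "0 \<le> s" "s \<le> t" "t \<le> l"
  shows "ennreal \<bar>f (\<gamma> t) - f (\<gamma> s)\<bar> \<le> (\<integral>\<^sup>+r. ennreal (norm (classical_grad f (\<gamma> r))) * indicator {s..t} r \<partial>lborel)"
proof -
  have "continuous_on {s..t} (\<lambda>r. norm (classical_grad f (\<gamma> r)))"
    by (rule continuous_on_subset[OF C1_increment_along_curve(1)[OF f c st]]) (use st in auto)
  from nn_integral_continuous_interval[OF this] C1_increment_along_curve(2)[OF f c st]
  show ?thesis by (simp add: ennreal_leI)
qed

definition fluct :: "(nat \<Rightarrow> real^'n \<Rightarrow> real) \<Rightarrow> real^'n \<Rightarrow> ennreal" where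
  "fluct d x = (\<Sum>k. ennreal \<bar>d (Suc k) x - d k x\<bar>)"

definition grad_fluct :: "(nat \<Rightarrow> real^'n \<Rightarrow> real) \<Rightarrow> real^'n \<Rightarrow> ennreal" where
  "grad_fluct d x = (\<Sum>k. ennreal (norm (classical_grad (d (Suc k)) x - classical_grad (d k) x)))"

lemma fluct_measurable:
  assumes "\<And>k. Ck_on 1 \<Omega> (d k)"
  shows "fluct d \<in> borel_measurable (restrict_space borel \<Omega>)" "grad_fluct d \<in> borel_measurable (restrict_space borel \<Omega>)"
proof -
  note c = Ck_on_1_continuous[OF assms]
  have [measurable]: "d k \<in> borel_measurable (restrict_space borel \<Omega>)" for k
    by (rule borel_measurable_continuous_on_restrict[OF c(1)])
  have [measurable]: "classical_grad (d k) \<in> borel_measurable (restrict_space borel \<Omega>)" for k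
    by (rule borel_measurable_continuous_on_restrict[OF c(2)])
  show "fluct d \<in> borel_measurable (restrict_space borel \<Omega>)" unfolding fluct_def by measurable
  show "grad_fluct d \<in> borel_measurable (restrict_space borel \<Omega>)" unfolding grad_fluct_def by measurable
qed

lemma fluct_finite_convergent:
  assumes "fluct d x \<noteq> \<infinity>"
  shows "convergent (\<lambda>k. d k x)"
proof -
  have "summable (\<lambda>k. \<bar>d (Suc k) x - d k x\<bar>)"
    using assms unfolding fluct_def by (intro summable_suminf_not_top) auto
  then have "summable (\<lambda>k. d (Suc k) x - d k x)" by (rule summable_rabs_cancel)
  then have "(\<lambda>n. \<Sum>k<n. d (Suc k) x - d k x) \<longlonglongrightarrow> (\<Sum>k. d (Suc k) x - d k x)" by (rule summable_LIMSEQ)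
  then have "(\<lambda>n. d n x - d 0 x) \<longlonglongrightarrow> (\<Sum>k. d (Suc k) x - d k x)" by (simp add: sum_lessThan_telescope[of "\<lambda>k. d k x"])
  then have "(\<lambda>n. (d n x - d 0 x) + d 0 x) \<longlonglongrightarrow> (\<Sum>k. d (Suc k) x - d k x) + d 0 x" by (intro tendsto_add tendsto_const)
  then show ?thesis unfolding convergent_def by auto
qed

lemma grad_le_grad_fluct:
  "ennreal (norm (classical_grad (d k) x)) \<le> ennreal (norm (classical_grad (d 0) x)) + grad_fluct d x"
proof -
  have "ennreal (norm (classical_grad (d k) x)) \<le> ennreal (norm (classical_grad (d 0) x)) +
    (\<Sum>j<k. ennreal (norm (classical_grad (d (Suc j)) x - classical_grad (d j) x)))"
  proof (induction k)
    case (Suc k)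
    have "norm (classical_grad (d (Suc k)) x) \<le> norm (classical_grad (d k) x) + norm (classical_grad (d (Suc k)) x - classical_grad (d k) x)"
      by (metis add.commute diff_add_cancel norm_triangle_ineq)
    then have "ennreal (norm (classical_grad (d (Suc k)) x)) \<le>
       ennreal (norm (classical_grad (d k) x)) + ennreal (norm (classical_grad (d (Suc k)) x - classical_grad (d k) x))"
      by (simp add: ennreal_plus[symmetric] ennreal_leI del: ennreal_plus)
    also have "\<dots> \<le> (ennreal (norm (classical_grad (d 0) x)) +
      (\<Sum>j<k. ennreal (norm (classical_grad (d (Suc j)) x - classical_grad (d j) x)))) +
       ennreal (norm (classical_grad (d (Suc k)) x - classical_grad (d k) x))"
      by (rule add_right_mono[OF Suc])
    finally show ?case by (simp add: add.assoc)
  qed simp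
  also have "\<dots> \<le> ennreal (norm (classical_grad (d 0) x)) + grad_fluct d x"
    unfolding grad_fluct_def by (intro add_left_mono sum_le_suminf) auto
  finally show ?thesis .
qed

text \<open>
  A function with finite integral is finite somewhere, so that \<open>d\<^sub>k\<close> converges at some point
  of the curve. The increments of \<open>d\<^sub>k\<^sub>+\<^sub>1 - d\<^sub>k\<close> along the curve are bounded by summable
  numbers \<open>b\<^sub>k\<close>, which extends the convergence to the other points. The increments of all
  \<open>d\<^sub>k\<close>, and hence those of the limit, are bounded by the integral of \<open>\<bar>\<nabla>d\<^sub>0\<bar> + grad_fluct d\<close>.
\<close>

lemma limit_AC_on_curve:
  fixes d :: "nat \<Rightarrow> real^'n \<Rightarrow> real"
  assumes d: "\<And>k. Ck_on 1 \<Omega> (d k)" and c: "(l, \<gamma>) \<in> rect_curves \<Omega>"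
    and f1: "curve_integral (l, \<gamma>) (fluct d) < \<infinity>" and f2: "curve_integral (l, \<gamma>) (grad_fluct d) < \<infinity>"
  shows "\<And>t. t \<in> {0..l} \<Longrightarrow> convergent (\<lambda>k. d k (\<gamma> t))"
    and "abs_continuous_on_interval 0 l (\<lambda>t. lim (\<lambda>k. d k (\<gamma> t)))"
proof -
  have l: "l > 0" and \<gamma>: "continuous_on {0..l} \<gamma>" "\<gamma> ` {0..l} \<subseteq> \<Omega>" using c by (auto simp: rect_curves_def)
  have dd: "d k differentiable (at x)" if "x \<in> \<Omega>" for k x using d[of k] that by simp
  have "\<exists>t0\<in>{0..l}. fluct d (\<gamma> t0) \<noteq> \<infinity>"
  proof (rule ccontr)
    assume n: "\<not> ?thesis"
    have "curve_integral (l, \<gamma>) (fluct d) = (\<integral>\<^sup>+t. \<infinity> * indicator {0..l} t \<partial>lborel)"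
      unfolding curve_integral_def prod.case
    proof (rule nn_integral_cong)
      fix t show "fluct d (\<gamma> t) * indicator {0..l} t = \<infinity> * indicator {0..l} t"
        using n by (cases "t \<in> {0..l}") auto
    qed
    also have "\<dots> = \<infinity> * emeasure lborel {0..l}" by (rule nn_integral_cmult_indicator) simp
    also have "\<dots> = \<infinity>" using l by (simp add: ennreal_top_mult)
    finally show False using f1 by simp
  qed
  then obtain t0 where t0: "t0 \<in> {0..l}" "fluct d (\<gamma> t0) \<noteq> \<infinity>" by blast
  define b where "b k = (\<integral>\<^sup>+r. ennreal (norm (classical_grad (d (Suc k)) (\<gamma> r) - classical_grad (d k) (\<gamma> r))) * indicator {0..l} r \<partial>lborel)" for k
  have bm: "(\<lambda>r. ennreal (norm (classical_grad (d (Suc k)) (\<gamma> r) - classical_grad (d k) (\<gamma> r))) * indicator {0..l} r) \<in> borel_measurable lborel" for k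
  proof -
    have [measurable]: "classical_grad (d k) \<in> borel_measurable (restrict_space borel \<Omega>)" for k
      by (rule borel_measurable_continuous_on_restrict[OF Ck_on_1_continuous(2)[OF d]])
    have "(\<lambda>x. ennreal (norm (classical_grad (d (Suc k)) x - classical_grad (d k) x))) \<in> borel_measurable (restrict_space borel \<Omega>)"
      by measurable
    from curve_measurable[OF c this] show ?thesis by simp
  qed
  have "(\<Sum>k. b k) = curve_integral (l, \<gamma>) (grad_fluct d)"
    unfolding b_def nn_integral_suminf[OF bm, symmetric] curve_integral_def prod.case grad_fluct_def
    by (simp only: ennreal_suminf_multc)
  then have bfin: "(\<Sum>k. b k) < \<infinity>" using f2 by simp
  have inc: "ennreal \<bar>(d (Suc k) (\<gamma> t) - d k (\<gamma> t)) - (d (Suc k) (\<gamma> s) - d k (\<gamma> s))\<bar> \<le> b k"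
    if st: "0 \<le> s" "s \<le> t" "t \<le> l" for k s t
  proof -
    have "ennreal \<bar>(d (Suc k) (\<gamma> t) - d k (\<gamma> t)) - (d (Suc k) (\<gamma> s) - d k (\<gamma> s))\<bar> \<le>
       (\<integral>\<^sup>+r. ennreal (norm (classical_grad (\<lambda>x. d (Suc k) x - d k x) (\<gamma> r))) * indicator {s..t} r \<partial>lborel)"
      by (rule C1_nn_increment_along_curve[OF Ck_on_1_diff[OF d d] c st])
    also have "\<dots> \<le> b k" unfolding b_def
    proof (rule nn_integral_mono)
      fix r :: real
      show "ennreal (norm (classical_grad (\<lambda>x. d (Suc k) x - d k x) (\<gamma> r))) * indicator {s..t} r \<le>
         ennreal (norm (classical_grad (d (Suc k)) (\<gamma> r) - classical_grad (d k) (\<gamma> r))) * indicator {0..l} r"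
      proof (cases "r \<in> {s..t}")
        case True
        then have "r \<in> {0..l}" using st by simp
        then have "\<gamma> r \<in> \<Omega>" using \<gamma>(2) by blast
        then have "classical_grad (\<lambda>x. d (Suc k) x - d k x) (\<gamma> r) = classical_grad (d (Suc k)) (\<gamma> r) - classical_grad (d k) (\<gamma> r)"
          by (intro classical_grad_diff dd)
        then show ?thesis using \<open>r \<in> {0..l}\<close> True by simp
      qed simp
    qed
    finally show ?thesis .
  qed
  show conv: "convergent (\<lambda>k. d k (\<gamma> t))" if t: "t \<in> {0..l}" for t
  proof (rule fluct_finite_convergent)
    have le: "ennreal \<bar>d (Suc k) (\<gamma> t) - d k (\<gamma> t)\<bar> \<le> ennreal \<bar>d (Suc k) (\<gamma> t0) - d k (\<gamma> t0)\<bar> + b k" for k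
    proof -
      let ?x = "d (Suc k) (\<gamma> t) - d k (\<gamma> t)" and ?y = "d (Suc k) (\<gamma> t0) - d k (\<gamma> t0)"
      have 1: "ennreal \<bar>?x - ?y\<bar> \<le> b k"
      proof (cases "t0 \<le> t")
        case True
        then show ?thesis using inc[of t0 t k] t t0(1) by simp
      next
        case False
        then show ?thesis using inc[of t t0 k] t t0(1) by (simp add: abs_minus_commute)
      qed
      have "\<bar>?x\<bar> \<le> \<bar>?y\<bar> + \<bar>?x - ?y\<bar>" by linarith
      then have "ennreal \<bar>?x\<bar> \<le> ennreal \<bar>?y\<bar> + ennreal \<bar>?x - ?y\<bar>"
        by (simp add: ennreal_plus[symmetric] ennreal_leI del: ennreal_plus)
      also have "\<dots> \<le> ennreal \<bar>?y\<bar> + b k" by (rule add_left_mono[OF 1])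
      finally show ?thesis .
    qed
    have "fluct d (\<gamma> t) \<le> (\<Sum>k. ennreal \<bar>d (Suc k) (\<gamma> t0) - d k (\<gamma> t0)\<bar> + b k)"
      unfolding fluct_def by (intro suminf_le le) auto
    also have "\<dots> = fluct d (\<gamma> t0) + (\<Sum>k. b k)" unfolding fluct_def by (rule suminf_add[symmetric]) auto
    also have "\<dots> < \<infinity>" using t0(2) bfin by (simp add: less_top)
    finally show "fluct d (\<gamma> t) \<noteq> \<infinity>" by simp
  qed
  let ?g = "\<lambda>x. ennreal (norm (classical_grad (d 0) x)) + grad_fluct d x"
  have g0: "classical_grad (d 0) \<in> borel_measurable (restrict_space borel \<Omega>)"
    by (rule borel_measurable_continuous_on_restrict[OF Ck_on_1_continuous(2)[OF d]])
  have gm: "?g \<in> borel_measurable (restrict_space borel \<Omega>)"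
    using g0 fluct_measurable(2)[of \<Omega> d, OF d] by measurable
  have n0m: "(\<lambda>x. ennreal (norm (classical_grad (d 0) x))) \<in> borel_measurable (restrict_space borel \<Omega>)"
    using g0 by measurable
  show "abs_continuous_on_interval 0 l (\<lambda>t. lim (\<lambda>k. d k (\<gamma> t)))"
  proof (rule AC_if_increment_bound[where G="\<lambda>r. ?g (\<gamma> r)"])
    show "(\<lambda>r. ?g (\<gamma> r) * indicator {0..l} r) \<in> borel_measurable borel" by (rule curve_measurable[OF c gm])
    have c0: "continuous_on {0..l} (\<lambda>r. norm (classical_grad (d 0) (\<gamma> r)))"
      by (rule C1_increment_along_curve(1)[OF d c order_refl less_imp_le[OF l] order_refl])
    have "(\<integral>\<^sup>+r. ?g (\<gamma> r) * indicator {0..l} r \<partial>lborel) =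
       (\<integral>\<^sup>+r. ennreal (norm (classical_grad (d 0) (\<gamma> r))) * indicator {0..l} r + grad_fluct d (\<gamma> r) * indicator {0..l} r \<partial>lborel)"
      by (simp only: distrib_right)
    also have "\<dots> = (\<integral>\<^sup>+r. ennreal (norm (classical_grad (d 0) (\<gamma> r))) * indicator {0..l} r \<partial>lborel) + curve_integral (l, \<gamma>) (grad_fluct d)"
      unfolding curve_integral_def prod.case
      using curve_measurable[OF c n0m] curve_measurable[OF c fluct_measurable(2)[of \<Omega> d, OF d]]
      by (intro nn_integral_add) simp_all
    also have "\<dots> < \<infinity>" using f2 nn_integral_continuous_interval[OF c0] by simp
    finally show "(\<integral>\<^sup>+r. ?g (\<gamma> r) * indicator {0..l} r \<partial>lborel) < \<infinity>" .
    fix s t assume st: "0 \<le> s" "s \<le> t" "t \<le> l"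
    have le: "ennreal \<bar>d k (\<gamma> t) - d k (\<gamma> s)\<bar> \<le> (\<integral>\<^sup>+r. ?g (\<gamma> r) * indicator {s..t} r \<partial>lborel)" for k
    proof -
      have "ennreal \<bar>d k (\<gamma> t) - d k (\<gamma> s)\<bar> \<le> (\<integral>\<^sup>+r. ennreal (norm (classical_grad (d k) (\<gamma> r))) * indicator {s..t} r \<partial>lborel)"
        by (rule C1_nn_increment_along_curve[OF d c st])
      also have "\<dots> \<le> (\<integral>\<^sup>+r. ?g (\<gamma> r) * indicator {s..t} r \<partial>lborel)"
        by (intro nn_integral_mono mult_right_mono grad_le_grad_fluct) simp
      finally show ?thesis .
    qed
    have L: "(\<lambda>k. d k (\<gamma> r)) \<longlonglongrightarrow> lim (\<lambda>k. d k (\<gamma> r))" if "r \<in> {0..l}" for r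
      using conv[OF that] by (simp only: convergent_LIMSEQ_iff)
    have "(\<lambda>k. ennreal \<bar>d k (\<gamma> t) - d k (\<gamma> s)\<bar>) \<longlonglongrightarrow> ennreal \<bar>lim (\<lambda>k. d k (\<gamma> t)) - lim (\<lambda>k. d k (\<gamma> s))\<bar>"
      using st by (intro tendsto_ennrealI tendsto_rabs tendsto_diff L) auto
    then show "ennreal \<bar>lim (\<lambda>k. d k (\<gamma> t)) - lim (\<lambda>k. d k (\<gamma> s))\<bar> \<le> (\<integral>\<^sup>+r. ?g (\<gamma> r) * indicator {s..t} r \<partial>lborel)"
      by (rule LIMSEQ_le_const2) (use le in blast)
  qed
qed

text \<open>
  The derivative of \<open>W\<close> has the same integrals over intervals as \<open>g\<close>, by \<open>AC_has_integral\<close>,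
  and two functions with this property agree almost everywhere by Lebesgue differentiation.
\<close>

lemma AC_derivative_eq_integrand:
  fixes W g :: "real \<Rightarrow> real"
  assumes AC: "abs_continuous_on_interval a b W"
    and int: "\<And>s t. a \<le> s \<Longrightarrow> s \<le> t \<Longrightarrow> t \<le> b \<Longrightarrow> (g has_integral (W t - W s)) {s..t}"
  shows "negligible {t \<in> {a<..<b}. \<not> (W has_real_derivative g t) (at t)}"
proof -
  define N where "N = {t \<in> {a<..<b}. \<not> (\<exists>D. (W has_real_derivative D) (at t))}"
  have N: "negligible N" unfolding N_def by (rule AC_differentiable_AE[OF AC])
  have W: "(W has_real_derivative deriv W t) (at t)" if "t \<in> {a<..<b} - N" for t
    using that unfolding N_def by (auto dest: DERIV_imp_deriv)
  define E where "E t = (if t \<in> {a..b} then deriv W t - g t else 0)" for t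
  have E0: "(E has_integral 0) {s..t}" if st: "a \<le> s" "s \<le> t" "t \<le> b" for s t
  proof -
    have Nn: "negligible (insert a (insert b N))" using N by simp
    have sub: "{s..t} \<subseteq> {a..b}" using st by auto
    have "(deriv W has_integral (W t - W s)) {s..t}"
    proof (rule AC_has_integral[OF st(2) AC_subinterval[OF AC sub] Nn])
      show "(W has_real_derivative deriv W x) (at x within {s..t})" if "x \<in> {s..t} - insert a (insert b N)" for x
        by (rule has_field_derivative_at_within[OF W]) (use that st in auto)
    qed
    from has_integral_diff[OF this int[OF st]] have "((\<lambda>t. deriv W t - g t) has_integral 0) {s..t}" by simp
    then show ?thesis by (rule has_integral_eq[rotated]) (use st in \<open>auto simp: E_def\<close>)
  qed
  have Eint: "E integrable_on cbox p q" for p q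
  proof (cases "a \<le> b")
    case True
    have "(\<lambda>t. if t \<in> {a..b} then E t else 0) = E" by (auto simp: E_def fun_eq_iff)
    moreover have "E integrable_on {a..b}" using E0[of a b] True by blast
    ultimately have "E integrable_on UNIV" using integrable_restrict_UNIV[of "{a..b}" E] by simp
    then show ?thesis by (rule integrable_on_subcbox) simp
  next
    case False
    then have E: "E = (\<lambda>_. 0)" by (auto simp: E_def fun_eq_iff)
    show ?thesis unfolding E by (rule integrable_0)
  qed
  obtain N2 where N2: "negligible N2" and cor: "\<forall>x \<epsilon>. x \<notin> N2 \<and> 0 < \<epsilon> \<longrightarrow>
     (\<exists>\<delta>>0. \<forall>h. 0 < h \<and> h < \<delta> \<longrightarrow> norm(integral (cbox x (x + h *\<^sub>R One)) E /\<^sub>R h ^ DIM(real) - E x) < \<epsilon>)"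
    using AE_corner_differentiation[of E, OF Eint] by (elim exE conjE)
  have "E t = 0" if t: "t \<in> {a<..<b}" "t \<notin> N2" for t
  proof (rule ccontr)
    assume "E t \<noteq> 0"
    then have "0 < norm (E t)" by simp
    from cor[rule_format, OF conjI[OF t(2) this]] obtain \<delta> where \<delta>: "\<delta> > 0"
      "\<forall>h. 0 < h \<and> h < \<delta> \<longrightarrow> norm(integral (cbox t (t + h *\<^sub>R One)) E /\<^sub>R h ^ DIM(real) - E t) < norm (E t)"
      by (elim exE conjE)
    define h where "h = min (\<delta>/2) (b - t)"
    have h: "0 < h" "h < \<delta>" "t + h \<le> b" using \<delta>(1) t(1) by (auto simp: h_def)
    have "integral {t..t + h} E = 0" using E0[of t "t + h"] h t(1) by (intro integral_unique) simp
    then show False using \<delta>(2)[rule_format, of h] h by simp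
  qed
  then have "{t \<in> {a<..<b}. \<not> (W has_real_derivative g t) (at t)} \<subseteq> N \<union> N2"
    using W by (force simp: E_def)
  then show ?thesis by (rule negligible_subset[rotated]) (use N N2 in simp)
qed

lemma C1_line_integral:
  fixes f :: "real^'n \<Rightarrow> real"
  assumes f: "Ck_on 1 \<Omega> f" and st: "s \<le> t" and seg: "\<forall>r\<in>{s..t}. x + r *\<^sub>R axis i 1 \<in> \<Omega>"
  shows "continuous_on {s..t} (\<lambda>r. partial i f (x + r *\<^sub>R axis i 1))"
    "((\<lambda>r. partial i f (x + r *\<^sub>R axis i 1)) has_integral (f (x + t *\<^sub>R axis i 1) - f (x + s *\<^sub>R axis i 1))) {s..t}"
proof -
  have pc: "continuous_on \<Omega> (partial i f)" using f by simp
  show "continuous_on {s..t} (\<lambda>r. partial i f (x + r *\<^sub>R axis i 1))"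
    by (rule continuous_on_compose2[OF pc]) (use seg in \<open>auto intro!: continuous_intros\<close>)
  show "((\<lambda>r. partial i f (x + r *\<^sub>R axis i 1)) has_integral (f (x + t *\<^sub>R axis i 1) - f (x + s *\<^sub>R axis i 1))) {s..t}"
  proof (rule fundamental_theorem_of_calculus[OF st])
    fix r assume r: "r \<in> {s..t}"
    have "f differentiable (at (x + r *\<^sub>R axis i 1))" using f bspec[OF seg r] by simp
    from has_field_derivative_at_within[OF partial_on_line[OF this]]
    show "((\<lambda>r. f (x + r *\<^sub>R axis i 1)) has_vector_derivative partial i f (x + r *\<^sub>R axis i 1)) (at r within {s..t})"
      by (simp only: has_real_derivative_iff_has_vector_derivative)
  qed
qed

text \<open>
  Dominated convergence for the integrals of \<open>\<partial>\<^sub>id\<^sub>k\<close>, with the majorant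
  \<open>\<bar>\<nabla>d\<^sub>0\<bar> + grad_fluct d\<close>.
\<close>

lemma limit_line_integral:
  fixes d :: "nat \<Rightarrow> real^'n \<Rightarrow> real"
  assumes d: "\<And>k. Ck_on 1 \<Omega> (d k)" and st: "s \<le> t" and seg: "\<forall>r\<in>{s..t}. x + r *\<^sub>R axis i 1 \<in> \<Omega>"
    and fin: "(\<integral>\<^sup>+r. grad_fluct d (x + r *\<^sub>R axis i 1) * indicator {s..t} r \<partial>lborel) < \<infinity>"
    and fm: "(\<lambda>r. grad_fluct d (x + r *\<^sub>R axis i 1) * indicator {s..t} r) \<in> borel_measurable lborel"
    and conv: "AE r in lborel. x + r *\<^sub>R axis i 1 \<in> \<Omega> \<longrightarrow> (\<lambda>k. partial i (d k) (x + r *\<^sub>R axis i 1)) \<longlonglongrightarrow> g (x + r *\<^sub>R axis i 1)"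
    and v: "\<And>r. r \<in> {s..t} \<Longrightarrow> (\<lambda>k. d k (x + r *\<^sub>R axis i 1)) \<longlonglongrightarrow> v (x + r *\<^sub>R axis i 1)"
  shows "((\<lambda>r. g (x + r *\<^sub>R axis i 1)) has_integral (v (x + t *\<^sub>R axis i 1) - v (x + s *\<^sub>R axis i 1))) {s..t}"
proof -
  let ?y = "\<lambda>r. x + r *\<^sub>R axis i 1 :: real^'n"
  let ?p = "\<lambda>k r. indicator {s..t} r *\<^sub>R partial i (d k) (?y r)"
  note C = C1_line_integral[OF d st seg]
  have si: "set_integrable lborel {s..t} (\<lambda>r. partial i (d k) (?y r))" for k
    by (rule borel_integrable_atLeastAtMost'[OF C(1)])
  have pm: "?p k \<in> borel_measurable lborel" for k
    using si[of k] unfolding set_integrable_def by (rule borel_measurable_integrable)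
  have pint: "(\<integral>r. ?p k r \<partial>lborel) = d k (?y t) - d k (?y s)" for k
    using set_borel_integral_eq_integral(2)[OF si[of k]] integral_unique[OF C(2)[of k]]
    unfolding set_lebesgue_integral_def by simp
  \<comment> \<open>The limit of the integrands is a measurable version of \<open>g\<close> on the segment, extended
    by zero.\<close>
  define q where "q r = lim (\<lambda>k. ?p k r)" for r
  have qm: "q \<in> borel_measurable lborel" unfolding q_def by (rule borel_measurable_lim_metric[OF pm])
  let ?n0 = "\<lambda>r. ennreal (norm (classical_grad (d 0) (?y r))) * indicator {s..t} r"
  let ?F = "\<lambda>r. ?n0 r + grad_fluct d (?y r) * indicator {s..t} r"
  have n0c: "continuous_on {s..t} (\<lambda>r. norm (classical_grad (d 0) (?y r)))"
    by (rule continuous_on_norm, rule continuous_on_compose2[OF Ck_on_1_continuous(2)[OF d]])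
      (use seg in \<open>auto intro!: continuous_intros\<close>)
  have n0m: "?n0 \<in> borel_measurable lborel"
  proof -
    have "(\<lambda>r. norm (classical_grad (d 0) (?y r))) \<in> borel_measurable (restrict_space borel {s..t})"
      by (rule borel_measurable_continuous_on_restrict[OF n0c])
    then have "(\<lambda>r. ennreal (norm (classical_grad (d 0) (?y r)))) \<in> borel_measurable (restrict_space borel {s..t})" by measurable
    then show ?thesis by (subst (asm) borel_measurable_restrict_space_iff_ennreal) auto
  qed
  have Fm: "?F \<in> borel_measurable lborel" using n0m fm by (rule borel_measurable_add)
  have Ffin: "(\<integral>\<^sup>+r. ?F r \<partial>lborel) < \<infinity>"
    using nn_integral_add[OF n0m fm] nn_integral_continuous_interval[OF n0c] fin by simp
  then have Ffin': "(\<integral>\<^sup>+r. ?F r \<partial>lborel) \<noteq> \<infinity>" by simp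
  have Fae: "AE r in lborel. ?F r \<noteq> \<infinity>" by (rule nn_integral_noteq_infinite[OF Fm Ffin'])
  have dom: "integrable lborel (\<lambda>r. enn2real (?F r))"
  proof (rule integrableI_bounded)
    show "(\<lambda>r. enn2real (?F r)) \<in> borel_measurable lborel" using Fm by (rule borel_measurable_enn2real)
    have "(\<integral>\<^sup>+r. ennreal (norm (enn2real (?F r))) \<partial>lborel) \<le> (\<integral>\<^sup>+r. ?F r \<partial>lborel)"
      by (rule nn_integral_mono) (simp add: ennreal_enn2real_if)
    then show "(\<integral>\<^sup>+r. ennreal (norm (enn2real (?F r))) \<partial>lborel) < \<infinity>" using Ffin by (rule le_less_trans)
  qed
  have pq: "AE r in lborel. (\<lambda>k. ?p k r) \<longlonglongrightarrow> q r"
    using conv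
  proof eventually_elim
    case (elim r)
    have "convergent (\<lambda>k. ?p k r)"
    proof (cases "r \<in> {s..t}")
      case True
      then have "(\<lambda>k. partial i (d k) (?y r)) \<longlonglongrightarrow> g (?y r)" using elim seg by blast
      then show ?thesis using True by (auto simp: convergent_def)
    qed (simp add: convergent_const)
    then show ?case unfolding q_def by (simp only: convergent_LIMSEQ_iff)
  qed
  have bound: "AE r in lborel. norm (?p k r) \<le> enn2real (?F r)" for k
    using Fae
  proof eventually_elim
    case (elim r)
    show ?case
    proof (cases "r \<in> {s..t}")
      case True
      have "\<bar>partial i (d k) (?y r)\<bar> \<le> norm (classical_grad (d k) (?y r))"
        using component_le_norm_cart[of "classical_grad (d k) (?y r)" i] by (simp add: classical_grad_def)
      then have "ennreal (norm (?p k r)) \<le> ennreal (norm (classical_grad (d k) (?y r)))"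
        using True by (intro ennreal_leI) simp
      also have "\<dots> \<le> ?F r" using grad_le_grad_fluct[of d k "?y r"] True by simp
      finally have "enn2real (ennreal (norm (?p k r))) \<le> enn2real (?F r)"
        using elim by (intro enn2real_mono) (simp_all add: less_top)
      then show ?thesis by simp
    qed simp
  qed
  have lim1: "(\<lambda>k. \<integral>r. ?p k r \<partial>lborel) \<longlonglongrightarrow> (\<integral>r. q r \<partial>lborel)"
    by (rule integral_dominated_convergence[OF qm pm dom pq bound])
  have qint: "integrable lborel q"
    by (rule integrable_dominated_convergence[OF qm pm dom pq bound])
  have "(\<lambda>k. d k (?y t) - d k (?y s)) \<longlonglongrightarrow> v (?y t) - v (?y s)"
    using st by (intro tendsto_diff v) auto
  then have qval: "(\<integral>r. q r \<partial>lborel) = v (?y t) - v (?y s)"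
    using lim1 unfolding pint by (intro LIMSEQ_unique)
  have q0: "indicator {s..t} r *\<^sub>R q r = q r" for r
  proof (cases "r \<in> {s..t}")
    case False
    then have "q r = lim (\<lambda>k::nat. 0::real)" by (simp add: q_def)
    then show ?thesis by simp
  qed simp
  have qs: "set_integrable lborel {s..t} q" unfolding set_integrable_def q0 by (rule qint)
  have "(q has_integral (v (?y t) - v (?y s))) {s..t}"
    using set_borel_integral_eq_integral[OF qs] qval unfolding set_lebesgue_integral_def q0
    by (simp add: has_integral_iff)
  moreover have "AE r in lborel. r \<in> {s..t} \<longrightarrow> q r = g (?y r)"
    using conv
  proof eventually_elim
    case (elim r)
    show ?case
    proof
      assume r: "r \<in> {s..t}"
      then have "(\<lambda>k. partial i (d k) (?y r)) \<longlonglongrightarrow> g (?y r)" using elim seg by blast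
      then show "q r = g (?y r)" using r by (simp add: q_def limI)
    qed
  qed
  ultimately show ?thesis by (subst (asm) has_integral_AE)
qed

lemma has_weak_partial_diff:
  fixes u v g h :: "real^'n \<Rightarrow> real"
  assumes u: "has_weak_partial \<Omega> u i g" and v: "has_weak_partial \<Omega> v i h"
  shows "has_weak_partial \<Omega> (\<lambda>x. u x - v x) i (\<lambda>x. g x - h x)"
proof -
  have li: "locally_integrable \<Omega> u" "locally_integrable \<Omega> v" "locally_integrable \<Omega> g" "locally_integrable \<Omega> h"
    using u v unfolding has_weak_partial_def by simp_all
  have ld: "locally_integrable \<Omega> (\<lambda>x. a x - b x)" if "locally_integrable \<Omega> a" "locally_integrable \<Omega> b" for a b :: "real^'n \<Rightarrow> real"
    using that unfolding locally_integrable_def by (intro allI impI set_integral_diff(1)) simp_all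
  have eq: "(\<integral>x\<in>\<Omega>. (u x - v x) * partial i \<psi> x \<partial>lebesgue) = - (\<integral>x\<in>\<Omega>. (g x - h x) * \<psi> x \<partial>lebesgue)"
    if \<psi>: "test_function \<Omega> \<psi>" for \<psi>
  proof -
    obtain K B where K: "compact K" "K \<subseteq> \<Omega>" and zz: "\<forall>x. x \<notin> K \<longrightarrow> \<psi> x = 0 \<and> partial i \<psi> x = 0"
    and BB: "\<forall>x. \<bar>\<psi> x\<bar> \<le> B" "\<forall>x. \<bar>partial i \<psi> x\<bar> \<le> B"
    and c: "continuous_on UNIV \<psi>" "continuous_on UNIV (partial i \<psi>)"
      using test_function_bounds[OF \<psi>, of i] by (elim exE conjE)
    have z: "\<psi> x = 0" and pz: "partial i \<psi> x = 0" if "x \<notin> K" for x using zz that by simp_all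
    have K': "set_integrable lebesgue K u" "set_integrable lebesgue K v" "set_integrable lebesgue K g" "set_integrable lebesgue K h"
      using li K unfolding locally_integrable_def by simp_all
    note iu = set_integrable_mult_bounded[OF K'(1) K(2) c(2) BB(2)[rule_format] pz]
    note iv = set_integrable_mult_bounded[OF K'(2) K(2) c(2) BB(2)[rule_format] pz]
    note ig = set_integrable_mult_bounded[OF K'(3) K(2) c(1) BB(1)[rule_format] z]
    note ih = set_integrable_mult_bounded[OF K'(4) K(2) c(1) BB(1)[rule_format] z]
    have 1: "(\<integral>x\<in>\<Omega>. (u x - v x) * partial i \<psi> x \<partial>lebesgue) = (\<integral>x\<in>\<Omega>. u x * partial i \<psi> x \<partial>lebesgue) - (\<integral>x\<in>\<Omega>. v x * partial i \<psi> x \<partial>lebesgue)"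
      unfolding left_diff_distrib by (rule set_integral_diff(2)[OF iu iv])
    have 2: "(\<integral>x\<in>\<Omega>. (g x - h x) * \<psi> x \<partial>lebesgue) = (\<integral>x\<in>\<Omega>. g x * \<psi> x \<partial>lebesgue) - (\<integral>x\<in>\<Omega>. h x * \<psi> x \<partial>lebesgue)"
      unfolding left_diff_distrib by (rule set_integral_diff(2)[OF ig ih])
    have 3: "(\<integral>x\<in>\<Omega>. u x * partial i \<psi> x \<partial>lebesgue) = - (\<integral>x\<in>\<Omega>. g x * \<psi> x \<partial>lebesgue)"
      using u \<psi> unfolding has_weak_partial_def by simp
    have 4: "(\<integral>x\<in>\<Omega>. v x * partial i \<psi> x \<partial>lebesgue) = - (\<integral>x\<in>\<Omega>. h x * \<psi> x \<partial>lebesgue)"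
      using v \<psi> unfolding has_weak_partial_def by simp
    show ?thesis unfolding 1 2 3 4 by simp
  qed
  show ?thesis unfolding has_weak_partial_def
    using ld[OF li(1,2)] ld[OF li(3,4)] eq by simp
qed

section \<open>Representatives of Sobolev functions\<close>

text \<open>Uniqueness of weak derivatives makes the choice in \<open>weak_grad\<close> immaterial.\<close>

lemma weak_grad_eq:
  fixes w :: "real^'n \<Rightarrow> real"
  assumes \<Omega>: "open \<Omega>" and G: "\<And>i. has_weak_partial \<Omega> w i (\<lambda>x. G x $ i)"
  shows "AE x in lebesgue_on \<Omega>. weak_grad \<Omega> w x = G x"
proof -
  have \<Omega>l: "\<Omega> \<in> sets lebesgue" using \<Omega> by simp
  have "AE x in lebesgue_on \<Omega>. (SOME g. has_weak_partial \<Omega> w i g) x = G x $ i" for i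
  proof -
    have "has_weak_partial \<Omega> w i (SOME g. has_weak_partial \<Omega> w i g)" by (rule someI[of "has_weak_partial \<Omega> w i", OF G])
    from weak_partial_unique[OF \<Omega> this G] show ?thesis
      unfolding AE_lebesgue_on_iff[OF \<Omega>l] AE_completion_iff .
  qed
  then have "AE x in lebesgue_on \<Omega>. \<forall>i\<in>UNIV. (SOME g. has_weak_partial \<Omega> w i g) x = G x $ i"
    by (intro AE_finite_allI) simp_all
  then show ?thesis by eventually_elim (simp add: weak_grad_def vec_eq_iff)
qed

text \<open>
  A subsequence of a sequence provided by density. The weak gradient of \<open>u - c\<^sub>n\<close>, which
  enters the norm, is \<open>G - \<nabla>c\<^sub>n\<close> almost everywhere, by uniqueness of weak derivatives.
\<close>

lemma W1phi_approximation:
  fixes u :: "real^'n \<Rightarrow> ereal"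
  assumes \<phi>: "weak_Phi \<Omega> \<phi>" and \<Omega>: "open \<Omega>" and dense: "C1_dense_in_W1phi \<phi> \<Omega>" and u: "u \<in> W1phi \<phi> \<Omega>"
  shows "\<exists>d G. (\<forall>k. Ck_on 1 \<Omega> (d k)) \<and> (\<forall>i. (\<lambda>x. ereal (G x $ i)) \<in> Lphi \<phi> \<Omega>) \<and>
    (\<forall>k. phi_norm \<phi> \<Omega> (\<lambda>x. enn2ereal (ennreal \<bar>real_of_ereal (u x) - d k x\<bar>)) < ennreal (1 / 4^(k+1))) \<and>
    (\<forall>k. phi_norm \<phi> \<Omega> (\<lambda>x. enn2ereal (ennreal (norm (G x - classical_grad (d k) x)))) < ennreal (1 / 4^(k+1)))"
proof -
  have uL: "u \<in> Lphi \<phi> \<Omega>" and "\<forall>i. \<exists>g. has_weak_partial \<Omega> (\<lambda>x. real_of_ereal (u x)) i g \<and> (\<lambda>x. ereal (g x)) \<in> Lphi \<phi> \<Omega>"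
    using u by (auto simp: W1phi_def)
  from choice[OF this(2)] obtain gu where gu: "\<forall>i. has_weak_partial \<Omega> (\<lambda>x. real_of_ereal (u x)) i (gu i) \<and> (\<lambda>x. ereal (gu i x)) \<in> Lphi \<phi> \<Omega>"
    by (elim exE)
  define G :: "real^'n \<Rightarrow> real^'n" where "G x = (\<chi> i. gu i x)" for x
  have G: "has_weak_partial \<Omega> (\<lambda>x. real_of_ereal (u x)) i (\<lambda>x. G x $ i)" "(\<lambda>x. ereal (G x $ i)) \<in> Lphi \<phi> \<Omega>" for i
    using gu by (simp_all add: G_def)
  from dense u have "\<exists>c. (\<forall>k. Ck_on 1 \<Omega> (c k) \<and> (\<lambda>x. ereal (c k x)) \<in> W1phi \<phi> \<Omega>) \<and>
     (\<lambda>k. W1phi_norm \<phi> \<Omega> (\<lambda>x. u x - ereal (c k x))) \<longlonglongrightarrow> 0"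
    unfolding C1_dense_in_W1phi_def by (rule bspec)
  then obtain c where c: "\<forall>k. Ck_on 1 \<Omega> (c k) \<and> (\<lambda>x. ereal (c k x)) \<in> W1phi \<phi> \<Omega>"
    and lim: "(\<lambda>k. W1phi_norm \<phi> \<Omega> (\<lambda>x. u x - ereal (c k x))) \<longlonglongrightarrow> 0" by (elim exE conjE)
  have c1: "Ck_on 1 \<Omega> (c n)" for n using c by blast
  have fin: "AE x in lebesgue_on \<Omega>. \<bar>u x\<bar> \<noteq> \<infinity>" by (rule Lphi_finite_AE[OF \<phi> uL])
  have n1: "phi_norm \<phi> \<Omega> (\<lambda>x. enn2ereal (ennreal \<bar>real_of_ereal (u x) - c n x\<bar>)) \<le> W1phi_norm \<phi> \<Omega> (\<lambda>x. u x - ereal (c n x))" for n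
  proof -
    have "phi_norm \<phi> \<Omega> (\<lambda>x. enn2ereal (ennreal \<bar>real_of_ereal (u x) - c n x\<bar>)) = phi_norm \<phi> \<Omega> (\<lambda>x. u x - ereal (c n x))"
    proof (rule phi_norm_cong_AE[OF \<phi>])
      show "AE x in lebesgue_on \<Omega>. \<bar>enn2ereal (ennreal \<bar>real_of_ereal (u x) - c n x\<bar>)\<bar> = \<bar>u x - ereal (c n x)\<bar>"
        using fin
      proof eventually_elim
        case (elim x)
        then obtain r where "u x = ereal r" by (cases "u x") auto
        then show ?case by (simp add: enn2ereal_ennreal)
      qed
    qed
    then show ?thesis by (simp add: W1phi_norm_def)
  qed
  have n2: "phi_norm \<phi> \<Omega> (\<lambda>x. enn2ereal (ennreal (norm (G x - classical_grad (c n) x)))) \<le> W1phi_norm \<phi> \<Omega> (\<lambda>x. u x - ereal (c n x))" for n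
  proof -
    let ?w = "\<lambda>y. real_of_ereal (u y - ereal (c n y))"
    have eq: "AE x in lebesgue_on \<Omega>. real_of_ereal (u x) - c n x = ?w x"
      using fin
    proof eventually_elim
      case (elim x)
      then obtain r where "u x = ereal r" by (cases "u x") auto
      then show ?case by simp
    qed
    have "has_weak_partial \<Omega> ?w i (\<lambda>x. (G x - classical_grad (c n) x) $ i)" for i
    proof -
      have "has_weak_partial \<Omega> (\<lambda>x. real_of_ereal (u x) - c n x) i (\<lambda>x. G x $ i - partial i (c n) x)"
        by (rule has_weak_partial_diff[OF G(1) C1_weak_partial[OF \<Omega> c1]])
      from has_weak_partial_cong_AE[OF \<Omega> this eq] show ?thesis by (simp add: classical_grad_def)
    qed
    from weak_grad_eq[OF \<Omega> this]
    have ae: "AE x in lebesgue_on \<Omega>. weak_grad \<Omega> ?w x = G x - classical_grad (c n) x" .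
    have "phi_norm \<phi> \<Omega> (\<lambda>x. enn2ereal (ennreal (norm (G x - classical_grad (c n) x)))) = phi_norm \<phi> \<Omega> (\<lambda>x. ereal (norm (weak_grad \<Omega> ?w x)))"
    proof (rule phi_norm_cong_AE[OF \<phi>])
      show "AE x in lebesgue_on \<Omega>. \<bar>enn2ereal (ennreal (norm (G x - classical_grad (c n) x)))\<bar> = \<bar>ereal (norm (weak_grad \<Omega> ?w x))\<bar>"
        using ae by eventually_elim (simp add: enn2ereal_ennreal)
    qed
    then show ?thesis by (simp add: W1phi_norm_def)
  qed
  have "\<exists>n. W1phi_norm \<phi> \<Omega> (\<lambda>x. u x - ereal (c n x)) < ennreal (1 / 4^(k+1))" for k
  proof -
    have "\<forall>\<^sub>F n in sequentially. W1phi_norm \<phi> \<Omega> (\<lambda>x. u x - ereal (c n x)) < ennreal (1 / 4^(k+1))"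
      by (rule order_tendstoD(2)[OF lim]) simp
    then show ?thesis by (auto simp: eventually_sequentially)
  qed
  then have "\<forall>k. \<exists>n. W1phi_norm \<phi> \<Omega> (\<lambda>x. u x - ereal (c n x)) < ennreal (1 / 4^(k+1))" by (intro allI)
  from choice[OF this] obtain \<nu> where \<nu>: "\<forall>k. W1phi_norm \<phi> \<Omega> (\<lambda>x. u x - ereal (c (\<nu> k) x)) < ennreal (1 / 4^(k+1))"
    by (elim exE)
  show ?thesis
  proof (intro exI[of _ "\<lambda>k. c (\<nu> k)"] exI[of _ G] conjI allI c1 G(2))
    fix k
    show "phi_norm \<phi> \<Omega> (\<lambda>x. enn2ereal (ennreal \<bar>real_of_ereal (u x) - c (\<nu> k) x\<bar>)) < ennreal (1 / 4^(k+1))"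
      by (rule le_less_trans[OF n1 spec[OF \<nu>]])
    show "phi_norm \<phi> \<Omega> (\<lambda>x. enn2ereal (ennreal (norm (G x - classical_grad (c (\<nu> k)) x)))) < ennreal (1 / 4^(k+1))"
      by (rule le_less_trans[OF n2 spec[OF \<nu>]])
  qed
qed

lemma suminf_diff_le:
  fixes a :: "nat \<Rightarrow> 'a::real_normed_vector"
  shows "(\<Sum>k. ennreal (norm (a (Suc k) - a k))) \<le> (\<Sum>k. ennreal (norm (b - a k))) + (\<Sum>k. ennreal (norm (b - a k)))"
proof -
  let ?f = "\<lambda>k. ennreal (norm (b - a k))"
  have step: "ennreal (norm (a (Suc k) - a k)) \<le> ?f (Suc k) + ?f k" for k
  proof -
    have "norm (a (Suc k) - a k) = norm ((b - a k) - (b - a (Suc k)))" by simp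
    also have "\<dots> \<le> norm (b - a k) + norm (b - a (Suc k))" by (rule norm_triangle_ineq4)
    finally have "ennreal (norm (a (Suc k) - a k)) \<le> ennreal (norm (b - a (Suc k)) + norm (b - a k))"
      by (intro ennreal_leI) simp
    then show ?thesis by simp
  qed
  have "(\<Sum>k. ennreal (norm (a (Suc k) - a k))) \<le> (\<Sum>k. ?f (Suc k) + ?f k)"
    by (rule suminf_le[OF step]) (rule summableI)+
  also have "\<dots> = (\<Sum>k. ?f (Suc k)) + (\<Sum>k. ?f k)"
    by (rule suminf_add[symmetric]) (rule summableI)+
  also have "\<dots> \<le> (\<Sum>k. ?f k) + (\<Sum>k. ?f k)"
  proof (rule add_right_mono)
    have "(\<Sum>k. ?f k) = (\<Sum>k. ?f (k + 1)) + (\<Sum>j<1. ?f j)" by (rule suminf_offset) (rule summableI)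
    then show "(\<Sum>k. ?f (Suc k)) \<le> (\<Sum>k. ?f k)" by simp
  qed
  finally show ?thesis .
qed

lemma tendsto_if_suminf_finite:
  fixes a :: "nat \<Rightarrow> 'a::real_normed_vector"
  assumes "(\<Sum>k. ennreal (norm (b - a k))) \<noteq> \<infinity>"
  shows "a \<longlonglongrightarrow> b"
proof -
  have "summable (\<lambda>k. norm (b - a k))" using assms by (intro summable_suminf_not_top) auto
  then have "(\<lambda>k. norm (b - a k)) \<longlonglongrightarrow> 0" by (rule summable_LIMSEQ_zero)
  then have "(\<lambda>k. b - a k) \<longlonglongrightarrow> 0" by (simp only: tendsto_norm_zero_iff)
  then have "(\<lambda>k. b - (b - a k)) \<longlonglongrightarrow> b - 0" by (intro tendsto_diff tendsto_const)
  then show ?thesis by simp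
qed

lemma Lphi_vector:
  fixes G :: "real^'n \<Rightarrow> real^'n"
  assumes \<phi>: "weak_Phi \<Omega> \<phi>" and G: "\<And>i. (\<lambda>x. ereal (G x $ i)) \<in> Lphi \<phi> \<Omega>"
  shows "G \<in> borel_measurable (lebesgue_on \<Omega>)" "(\<lambda>x. ereal (norm (G x))) \<in> Lphi \<phi> \<Omega>"
proof -
  have gi: "(\<lambda>x. G x $ i) \<in> borel_measurable (lebesgue_on \<Omega>)" for i
  proof -
    have "(\<lambda>x. ereal (G x $ i)) \<in> borel_measurable (lebesgue_on \<Omega>)" using G by (simp add: Lphi_def)
    from borel_measurable_real_of_ereal[OF this] show ?thesis by simp
  qed
  show Gm: "G \<in> borel_measurable (lebesgue_on \<Omega>)"
  proof (subst borel_measurable_euclidean_space, rule ballI)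
    fix b :: "real^'n" assume "b \<in> Basis"
    then obtain i where "b = axis i 1" by (auto simp: Basis_vec_def)
    then show "(\<lambda>x. G x \<bullet> b) \<in> borel_measurable (lebesgue_on \<Omega>)" using gi[of i] by (simp add: inner_axis)
  qed
  have aL: "(\<lambda>x. enn2ereal (ennreal \<bar>G x $ i\<bar>)) \<in> Lphi \<phi> \<Omega>" for i
  proof (rule Lphi_dominated[OF \<phi> G])
    have "(\<lambda>x. ereal \<bar>G x $ i\<bar>) \<in> borel_measurable (lebesgue_on \<Omega>)"
      by (intro borel_measurable_ereal borel_measurable_abs gi)
    then show "(\<lambda>x. enn2ereal (ennreal \<bar>G x $ i\<bar>)) \<in> borel_measurable (lebesgue_on \<Omega>)" by (simp add: enn2ereal_ennreal)
    show "AE x in lebesgue_on \<Omega>. \<bar>enn2ereal (ennreal \<bar>G x $ i\<bar>)\<bar> \<le> \<bar>ereal (G x $ i)\<bar>"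
      by (simp add: enn2ereal_ennreal)
  qed
  have sL: "(\<lambda>x. enn2ereal (\<Sum>i\<in>F. ennreal \<bar>G x $ i\<bar>)) \<in> Lphi \<phi> \<Omega>" if "finite F" for F
    using that
  proof (induction F rule: finite_induct)
    case empty
    show ?case
      by (rule Lphi_dominated[OF \<phi> G[of undefined]]) (simp_all add: zero_ennreal.rep_eq)
  next
    case (insert i F)
    then show ?case using Lphi_add_ennreal[OF \<phi> aL[of i] insert.IH] by simp
  qed
  show "(\<lambda>x. ereal (norm (G x))) \<in> Lphi \<phi> \<Omega>"
  proof (rule Lphi_dominated[OF \<phi> sL[of UNIV]])
    show "(\<lambda>x. ereal (norm (G x))) \<in> borel_measurable (lebesgue_on \<Omega>)"
      using Gm by measurable
    have "enn2ereal (\<Sum>i\<in>UNIV. ennreal \<bar>G x $ i\<bar>) = ereal (\<Sum>i\<in>UNIV. \<bar>G x $ i\<bar>)" for x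
      by (simp add: sum_ennreal enn2ereal_ennreal sum_nonneg)
    then show "AE x in lebesgue_on \<Omega>. \<bar>ereal (norm (G x))\<bar> \<le> \<bar>enn2ereal (\<Sum>i\<in>UNIV. ennreal \<bar>G x $ i\<bar>)\<bar>"
      by (simp add: norm_le_l1_cart sum_nonneg)
  qed simp
qed

text \<open>Curves with a finite integral of \<open>fluct d + grad_fluct d\<close> are not exceptional.\<close>

lemma limit_in_ACC:
  fixes d :: "nat \<Rightarrow> real^'n \<Rightarrow> real"
  assumes \<phi>: "weak_Phi \<Omega> \<phi>" and d: "\<And>k. Ck_on 1 \<Omega> (d k)"
    and hL: "(\<lambda>x. enn2ereal (fluct d x + grad_fluct d x)) \<in> Lphi \<phi> \<Omega>"
  shows "(\<lambda>x. lim (\<lambda>k. d k x)) \<in> ACC \<phi> \<Omega>"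
proof -
  let ?v = "\<lambda>x. lim (\<lambda>k. d k x)" and ?h = "\<lambda>x. fluct d x + grad_fluct d x"
  note fm = fluct_measurable[of \<Omega> d, OF d]
  have hm: "?h \<in> borel_measurable (restrict_space borel \<Omega>)" using fm by (rule borel_measurable_add)
  have "phi_modulus \<phi> \<Omega> (Gamma_NAC \<Omega> ?v) = 0"
  proof (rule phi_modulus_zeroI[OF \<phi> _ hm hL])
    show "Gamma_NAC \<Omega> ?v \<subseteq> rect_curves \<Omega>" by (auto simp: Gamma_NAC_def)
    fix c assume "c \<in> Gamma_NAC \<Omega> ?v"
    then obtain l \<gamma> where c: "c = (l, \<gamma>)" "(l, \<gamma>) \<in> rect_curves \<Omega>" and nac: "\<not> abs_continuous_on_interval 0 l (?v \<circ> \<gamma>)"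
      by (auto simp: Gamma_NAC_def)
    show "curve_integral c ?h = \<infinity>"
    proof (rule ccontr)
      assume n: "curve_integral c ?h \<noteq> \<infinity>"
      have "curve_integral c ?h = (\<integral>\<^sup>+t. fluct d (\<gamma> t) * indicator {0..l} t + grad_fluct d (\<gamma> t) * indicator {0..l} t \<partial>lborel)"
        unfolding curve_integral_def c(1) prod.case by (simp only: distrib_right)
      also have "\<dots> = curve_integral (l, \<gamma>) (fluct d) + curve_integral (l, \<gamma>) (grad_fluct d)"
        unfolding curve_integral_def prod.case
        using curve_measurable[OF c(2) fm(1)] curve_measurable[OF c(2) fm(2)]
        by (intro nn_integral_add) simp_all
      finally have "curve_integral (l, \<gamma>) (fluct d) < \<infinity>" "curve_integral (l, \<gamma>) (grad_fluct d) < \<infinity>"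
        using n by (auto simp: less_top)
      from limit_AC_on_curve(2)[OF d c(2) this] nac show False by (simp add: comp_def)
    qed
  qed
  then show ?thesis by (simp add: ACC_def)
qed

text \<open>
  On a segment over which \<open>fluct d\<close> and \<open>grad_fluct d\<close> have finite integrals, \<open>d\<^sub>k\<close> converges
  at every point and the limit is an indefinite integral of the \<open>i\<close>-th component of \<open>G\<close>.
  This applies to almost every line.
\<close>

lemma limit_classical_grad:
  fixes d :: "nat \<Rightarrow> real^'n \<Rightarrow> real" and G :: "real^'n \<Rightarrow> real^'n"
  defines "v \<equiv> \<lambda>x. lim (\<lambda>k. d k x)"
  assumes \<phi>: "weak_Phi \<Omega> \<phi>" and \<beta>: "\<exists>\<beta>>0. AE x in lebesgue_on \<Omega>. \<phi> x \<beta> \<ge> 1" and \<Omega>: "open \<Omega>"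
    and d: "\<And>k. Ck_on 1 \<Omega> (d k)"
    and fL: "(\<lambda>x. enn2ereal (fluct d x)) \<in> Lphi \<phi> \<Omega>" and gL: "(\<lambda>x. enn2ereal (grad_fluct d x)) \<in> Lphi \<phi> \<Omega>"
    and vACC: "v \<in> ACC \<phi> \<Omega>" and vm: "v \<in> borel_measurable (lebesgue_on \<Omega>)"
    and Gm: "\<And>i. (\<lambda>x. G x $ i) \<in> borel_measurable (lebesgue_on \<Omega>)"
    and G: "AE x in lebesgue_on \<Omega>. (\<lambda>k. classical_grad (d k) x) \<longlonglongrightarrow> G x"
  shows "AE x in lebesgue_on \<Omega>. classical_grad v x = G x"
proof -
  have \<Omega>l: "\<Omega> \<in> sets lebesgue" and \<Omega>b: "\<Omega> \<in> sets borel" using \<Omega> by simp_all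
  note fm = fluct_measurable[of \<Omega> d, OF d]
  note bm = borel_imp_lebesgue_on(1)[OF \<Omega>b fm(1)] borel_imp_lebesgue_on(1)[OF \<Omega>b fm(2)]
  have "AE x in lebesgue_on \<Omega>. partial i v x = G x $ i" for i
  proof -
    let ?e = "axis i 1 :: real^'n"
    have gi: "AE x in lborel. x \<in> \<Omega> \<longrightarrow> (\<lambda>k. partial i (d k) x) \<longlonglongrightarrow> G x $ i"
      using G unfolding AE_lebesgue_on_iff[OF \<Omega>l]
    proof eventually_elim
      case (elim x)
      show ?case
      proof
        assume "x \<in> \<Omega>"
        then have "(\<lambda>k. classical_grad (d k) x) \<longlonglongrightarrow> G x" using elim by blast
        from tendsto_vec_nth[OF this, of i] show "(\<lambda>k. partial i (d k) x) \<longlonglongrightarrow> G x $ i" by (simp add: classical_grad_def)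
      qed
    qed
    have A: "AE x in lborel. \<forall>a b. a \<le> b \<longrightarrow> (\<forall>t\<in>{a..b}. x + t *\<^sub>R ?e \<in> \<Omega>) \<longrightarrow> abs_continuous_on_interval a b (\<lambda>t. v (x + t *\<^sub>R ?e))"
      by (rule ACC_imp_AC_on_lines[OF \<phi> \<beta> \<Omega> vACC])
    have cont: "AE x in lborel. \<forall>t. x + t *\<^sub>R ?e \<in> \<Omega> \<longrightarrow> isCont (\<lambda>s. v (x + s *\<^sub>R ?e)) t"
      using A by eventually_elim (rule allI, rule impI, rule AC_on_lines_imp_isCont[OF \<Omega>])
    have der: "AE x in lborel. AE t in lborel. x + t *\<^sub>R ?e \<in> \<Omega> \<longrightarrow>
       ((\<lambda>s. v (x + s *\<^sub>R ?e)) has_real_derivative G (x + t *\<^sub>R ?e) $ i) (at t)"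
      using AE_lines[OF gi, of ?e] A Lphi_lines_finite[OF \<phi> \<beta> \<Omega> fm(1) fL, of ?e] Lphi_lines_finite[OF \<phi> \<beta> \<Omega> fm(2) gL, of ?e]
    proof eventually_elim
      case (elim x)
      note E = elim
      let ?T = "(\<lambda>t::real. x + t *\<^sub>R ?e) -` \<Omega>"
      have T: "open ?T" by (rule open_vimage[OF \<Omega>]) (intro continuous_intros)
      have "AE t in lborel. t \<in> ?T \<longrightarrow> ((\<lambda>s. v (x + s *\<^sub>R ?e)) has_real_derivative G (x + t *\<^sub>R ?e) $ i) (at t)"
      proof (rule AE_open_set_if_intervals[OF T])
        fix a b :: real assume ab: "a < b" and sub: "{a..b} \<subseteq> ?T"
        have seg: "\<forall>r\<in>{a..b}. x + r *\<^sub>R ?e \<in> \<Omega>" using sub by auto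
        have c: "(b - a, \<lambda>s. x + (a + s) *\<^sub>R ?e) \<in> rect_curves \<Omega>"
          by (rule segment_rect_curve[OF _ ab]) (use seg in \<open>auto simp: norm_axis_1\<close>)
        have f1: "curve_integral (b - a, \<lambda>s. x + (a + s) *\<^sub>R ?e) (fluct d) < \<infinity>"
          unfolding segment_curve_integral[OF seg bm(1)] using E(3) by simp
        have f2: "curve_integral (b - a, \<lambda>s. x + (a + s) *\<^sub>R ?e) (grad_fluct d) < \<infinity>"
          unfolding segment_curve_integral[OF seg bm(2)] using E(4) by simp
        have lim: "(\<lambda>k. d k (x + r *\<^sub>R ?e)) \<longlonglongrightarrow> v (x + r *\<^sub>R ?e)" if r: "r \<in> {a..b}" for r
        proof -
          have "r - a \<in> {0..b - a}" using r by simp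
          from limit_AC_on_curve(1)[OF d c f1 f2 this] show ?thesis
            unfolding v_def by (simp add: convergent_LIMSEQ_iff)
        qed
        show "negligible {t \<in> {a<..<b}. \<not> ((\<lambda>s. v (x + s *\<^sub>R ?e)) has_real_derivative G (x + t *\<^sub>R ?e) $ i) (at t)}"
        proof (rule AC_derivative_eq_integrand)
          show "abs_continuous_on_interval a b (\<lambda>s. v (x + s *\<^sub>R ?e))"
            using E(2) ab seg by simp
          fix s t :: real assume st: "a \<le> s" "s \<le> t" "t \<le> b"
          have seg': "\<forall>r\<in>{s..t}. x + r *\<^sub>R ?e \<in> \<Omega>" using seg st by simp
          have eq: "(\<lambda>r. grad_fluct d (x + r *\<^sub>R ?e) * indicator {s..t} r) =
             (\<lambda>r. grad_fluct d (x + r *\<^sub>R ?e) * indicator \<Omega> (x + r *\<^sub>R ?e) * indicator {s..t} r)"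
            using seg' by (auto simp: fun_eq_iff indicator_def)
          have fin: "(\<integral>\<^sup>+r. grad_fluct d (x + r *\<^sub>R ?e) * indicator {s..t} r \<partial>lborel) < \<infinity>"
            unfolding eq using E(4) by simp
          have lm: "(\<lambda>t. x + t *\<^sub>R ?e) \<in> borel_measurable borel" by measurable
          have fmeas: "(\<lambda>r. grad_fluct d (x + r *\<^sub>R ?e) * indicator {s..t} r) \<in> borel_measurable lborel"
            unfolding eq using measurable_compose[OF lm bm(2)] by measurable
          show "((\<lambda>r. G (x + r *\<^sub>R ?e) $ i) has_integral (v (x + t *\<^sub>R ?e) - v (x + s *\<^sub>R ?e))) {s..t}"
            by (rule limit_line_integral[OF d st(2) seg' fin fmeas E(1) lim]) (use st in auto)
        qed
      qed
      then show ?case by simp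
    qed
    have "AE x in lborel. x \<in> \<Omega> \<longrightarrow> ((\<lambda>s. v (x + s *\<^sub>R ?e)) has_real_derivative G x $ i) (at 0)"
      by (rule AE_directional_derivative[OF \<Omega> vm Gm cont der])
    then show ?thesis unfolding AE_lebesgue_on_iff[OF \<Omega>l]
      by eventually_elim (simp add: partial_def DERIV_imp_deriv)
  qed
  then have "AE x in lebesgue_on \<Omega>. \<forall>i\<in>UNIV. partial i v x = G x $ i"
    by (intro AE_finite_allI) simp_all
  then show ?thesis by eventually_elim (simp add: classical_grad_def vec_eq_iff)
qed

text \<open>
  The sums \<open>H1 = \<Sum>\<bar>u - d\<^sub>k\<bar>\<close> and \<open>H2 = \<Sum>\<bar>G - \<nabla>d\<^sub>k\<bar>\<close> lie in \<open>L\<^sup>\<phi>(\<Omega>)\<close>. They are finite almost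
  everywhere, which gives \<open>d\<^sub>k \<longlonglongrightarrow> u\<close> and \<open>\<nabla>d\<^sub>k \<longlonglongrightarrow> G\<close> there, and their doubles dominate \<open>fluct d\<close>
  and \<open>grad_fluct d\<close>.
\<close>

theorem W1phi_imp_ACCphi:
  fixes u :: "real^'n \<Rightarrow> ereal"
  assumes \<phi>: "weak_Phi \<Omega> \<phi>" and \<beta>: "\<exists>\<beta>>0. AE x in lebesgue_on \<Omega>. \<phi> x \<beta> \<ge> 1" and \<Omega>: "open \<Omega>"
    and dense: "C1_dense_in_W1phi \<phi> \<Omega>" and u: "u \<in> W1phi \<phi> \<Omega>"
  shows "\<exists>v\<in>ACCphi \<phi> \<Omega>. AE x in lebesgue_on \<Omega>. u x = ereal (v x)"
proof -
  have \<Omega>l: "\<Omega> \<in> sets lebesgue" and \<Omega>b: "\<Omega> \<in> sets borel" using \<Omega> by simp_all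
  have uL: "u \<in> Lphi \<phi> \<Omega>" using u by (simp add: W1phi_def)
  obtain d G where dd: "\<forall>k. Ck_on 1 \<Omega> (d k)" and GL: "\<forall>i. (\<lambda>x. ereal (G x $ i)) \<in> Lphi \<phi> \<Omega>"
    and n1: "\<forall>k. phi_norm \<phi> \<Omega> (\<lambda>x. enn2ereal (ennreal \<bar>real_of_ereal (u x) - d k x\<bar>)) < ennreal (1 / 4^(k+1))"
    and n2: "\<forall>k. phi_norm \<phi> \<Omega> (\<lambda>x. enn2ereal (ennreal (norm (G x - classical_grad (d k) x)))) < ennreal (1 / 4^(k+1))"
    using W1phi_approximation[OF \<phi> \<Omega> dense u] by (elim exE conjE)
  have d: "Ck_on 1 \<Omega> (d k)" for k using dd by blast
  let ?u = "\<lambda>x. real_of_ereal (u x)"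
  define H1 where "H1 x = (\<Sum>k. ennreal \<bar>?u x - d k x\<bar>)" for x
  define H2 where "H2 x = (\<Sum>k. ennreal (norm (G x - classical_grad (d k) x)))" for x
  have um: "?u \<in> borel_measurable (lebesgue_on \<Omega>)"
    using uL by (intro borel_measurable_real_of_ereal) (simp add: Lphi_def)
  note Gv = Lphi_vector[OF \<phi> GL[rule_format]]
  have dm: "d k \<in> borel_measurable (lebesgue_on \<Omega>)" "classical_grad (d k) \<in> borel_measurable (lebesgue_on \<Omega>)" for k
    using Ck_on_1_continuous[OF d] by (auto intro!: continuous_imp_measurable_on_sets_lebesgue \<Omega>l)
  have H1L: "(\<lambda>x. enn2ereal (H1 x)) \<in> Lphi \<phi> \<Omega>" unfolding H1_def
  proof (rule Lphi_suminf[OF \<phi> _ n1[rule_format]])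
    show "(\<lambda>x. ennreal \<bar>?u x - d k x\<bar>) \<in> borel_measurable (lebesgue_on \<Omega>)" for k
      using um dm(1)[of k] by measurable
  qed
  have H2L: "(\<lambda>x. enn2ereal (H2 x)) \<in> Lphi \<phi> \<Omega>" unfolding H2_def
  proof (rule Lphi_suminf[OF \<phi> _ n2[rule_format]])
    show "(\<lambda>x. ennreal (norm (G x - classical_grad (d k) x))) \<in> borel_measurable (lebesgue_on \<Omega>)" for k
      using Gv(1) dm(2)[of k] by measurable
  qed
  note fm = fluct_measurable[of \<Omega> d, OF d]
  have fl: "fluct d \<in> borel_measurable (lebesgue_on \<Omega>)" "grad_fluct d \<in> borel_measurable (lebesgue_on \<Omega>)"
    by (rule borel_imp_lebesgue_on(2)[OF \<Omega>b fm(1)], rule borel_imp_lebesgue_on(2)[OF \<Omega>b fm(2)])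
  have fL: "(\<lambda>x. enn2ereal (fluct d x)) \<in> Lphi \<phi> \<Omega>"
  proof (rule Lphi_dominated[OF \<phi> Lphi_add_ennreal[OF \<phi> H1L H1L]])
    show "(\<lambda>x. enn2ereal (fluct d x)) \<in> borel_measurable (lebesgue_on \<Omega>)" using fl(1) by measurable
    have "fluct d x \<le> H1 x + H1 x" for x
      using suminf_diff_le[of "\<lambda>k. d k x" "?u x"] by (simp add: fluct_def H1_def)
    then show "AE x in lebesgue_on \<Omega>. \<bar>enn2ereal (fluct d x)\<bar> \<le> \<bar>enn2ereal (H1 x + H1 x)\<bar>"
      by (simp add: less_eq_ennreal.rep_eq)
  qed
  have gL: "(\<lambda>x. enn2ereal (grad_fluct d x)) \<in> Lphi \<phi> \<Omega>"
  proof (rule Lphi_dominated[OF \<phi> Lphi_add_ennreal[OF \<phi> H2L H2L]])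
    show "(\<lambda>x. enn2ereal (grad_fluct d x)) \<in> borel_measurable (lebesgue_on \<Omega>)" using fl(2) by measurable
    have "grad_fluct d x \<le> H2 x + H2 x" for x
      using suminf_diff_le[of "\<lambda>k. classical_grad (d k) x" "G x"] by (simp add: grad_fluct_def H2_def)
    then show "AE x in lebesgue_on \<Omega>. \<bar>enn2ereal (grad_fluct d x)\<bar> \<le> \<bar>enn2ereal (H2 x + H2 x)\<bar>"
      by (simp add: less_eq_ennreal.rep_eq)
  qed
  define v where "v = (\<lambda>x. lim (\<lambda>k. d k x))"
  have vACC: "v \<in> ACC \<phi> \<Omega>" unfolding v_def
    by (rule limit_in_ACC[OF \<phi> d Lphi_add_ennreal[OF \<phi> fL gL]])
  have uv: "AE x in lebesgue_on \<Omega>. ?u x = v x"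
    using Lphi_finite_AE[OF \<phi> H1L]
  proof eventually_elim
    case (elim x)
    then have "(\<Sum>k. ennreal (norm (?u x - d k x))) \<noteq> \<infinity>" by (auto simp: H1_def top_ennreal.rep_eq)
    from tendsto_if_suminf_finite[OF this] show ?case unfolding v_def by (simp add: limI)
  qed
  have Gconv: "AE x in lebesgue_on \<Omega>. (\<lambda>k. classical_grad (d k) x) \<longlonglongrightarrow> G x"
    using Lphi_finite_AE[OF \<phi> H2L]
  proof eventually_elim
    case (elim x)
    then have "(\<Sum>k. ennreal (norm (G x - classical_grad (d k) x))) \<noteq> \<infinity>" by (auto simp: H2_def top_ennreal.rep_eq)
    then show ?case by (rule tendsto_if_suminf_finite)
  qed
  have vm: "v \<in> borel_measurable (lebesgue_on \<Omega>)" by (rule borel_measurable_lebesgue_on_AE[OF \<Omega>l um uv])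
  have Gi: "(\<lambda>x. G x $ i) \<in> borel_measurable (lebesgue_on \<Omega>)" for i
    using Lphi_imp_locally_integrable(1)[OF \<phi> \<beta> \<Omega> GL[rule_format]] .
  have grad: "AE x in lebesgue_on \<Omega>. classical_grad v x = G x"
    unfolding v_def by (rule limit_classical_grad[OF \<phi> \<beta> \<Omega> d fL gL vACC[unfolded v_def] vm[unfolded v_def] Gi Gconv])
  have "(\<lambda>x. ereal (norm (classical_grad v x))) \<in> Lphi \<phi> \<Omega>"
  proof (rule Lphi_dominated[OF \<phi> Gv(2)])
    have "(\<lambda>x. norm (classical_grad v x)) \<in> borel_measurable (lebesgue_on \<Omega>)"
    proof (rule borel_measurable_lebesgue_on_AE[OF \<Omega>l])
      show "(\<lambda>x. norm (G x)) \<in> borel_measurable (lebesgue_on \<Omega>)" using Gv(1) by measurable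
      show "AE x in lebesgue_on \<Omega>. norm (G x) = norm (classical_grad v x)" using grad by eventually_elim simp
    qed
    then show "(\<lambda>x. ereal (norm (classical_grad v x))) \<in> borel_measurable (lebesgue_on \<Omega>)" by (rule borel_measurable_ereal)
    show "AE x in lebesgue_on \<Omega>. \<bar>ereal (norm (classical_grad v x))\<bar> \<le> \<bar>ereal (norm (G x))\<bar>"
      using grad by eventually_elim simp
  qed
  then have "v \<in> ACCphi \<phi> \<Omega>" using vACC by (simp add: ACCphi_def)
  moreover have "AE x in lebesgue_on \<Omega>. u x = ereal (v x)"
    using uv Lphi_finite_AE[OF \<phi> uL]
  proof eventually_elim
    case (elim x)
    then show ?case by (cases "u x") auto
  qed
  ultimately show ?thesis by (intro bexI)
qed

theorem theorem5p13:
  fixes \<Omega> :: "(real ^ 'n) set"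
    and \<phi> :: "real ^ 'n \<Rightarrow> real \<Rightarrow> ennreal"
    and u :: "real ^ 'n \<Rightarrow> ereal"
  assumes "open \<Omega>"
    and "weak_Phi \<Omega> \<phi>"
    and "\<exists>\<beta>>0. AE x in lebesgue_on \<Omega>. \<phi> x \<beta> \<ge> 1"
    and "C1_dense_in_W1phi \<phi> \<Omega>"
  shows "u \<in> W1phi \<phi> \<Omega> \<longleftrightarrow>
    u \<in> Lphi \<phi> \<Omega> \<and> (\<exists>v \<in> ACCphi \<phi> \<Omega>. AE x in lebesgue_on \<Omega>. u x = ereal (v x))"
proof
  assume u: "u \<in> W1phi \<phi> \<Omega>"
  then have "u \<in> Lphi \<phi> \<Omega>" by (simp add: W1phi_def)
  then show "u \<in> Lphi \<phi> \<Omega> \<and> (\<exists>v \<in> ACCphi \<phi> \<Omega>. AE x in lebesgue_on \<Omega>. u x = ereal (v x))"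
    using W1phi_imp_ACCphi[OF assms(2,3,1,4) u] by (rule conjI)
next
  assume "u \<in> Lphi \<phi> \<Omega> \<and> (\<exists>v \<in> ACCphi \<phi> \<Omega>. AE x in lebesgue_on \<Omega>. u x = ereal (v x))"
  then show "u \<in> W1phi \<phi> \<Omega>" using ACCphi_imp_W1phi[OF assms(2,3,1)] by (elim conjE bexE)
qed

end
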